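(* Let $G$ be a Cohen--Macaulay very well-covered graph with $2n$ vertices $x_1,\dots,x_n,y_1,\dots,y_n$ in standard labelling. Then: (a) $\sum_{i\ge 1}(-1)^i\beta_i(S/I(G)^\vee)=-1$. (b) $$e(S/I(G)^\vee)=|E(G)|=\frac12\sum_{C\in\mathcal C(G)}\ \sum_{i=0}^{|\mathcal C(G;C)|}(-1)^{i+1}\binom{|\mathcal C(G;C)|}{i}(n+i)^2.$$
   Context: Graphs are finite, simple and undirected. $K$ is a field, $S=K[x_1,\dots,x_n,y_1,\dots,y_n]$, and vertices of $G$ are identified with variables of $S$. The edge ideal $I(G)$ is generated by the products of the endpoints of edges of $G$; the cover ideal $I(G)^\vee$ is generated by the monomials $\prod_{z\in C}z$, $C$ a minimal vertex cover of $G$. $G$ is unmixed if all minimal vertex covers have the same cardinality; $G$ is very well-covered if it is unmixed, has no isolated vertices, and $2\,\mathrm{height}(I(G))=|V(G)|$; $G$ is Cohen--Macaulay if $S/I(G)$ is a Cohen--Macaulay ring. $\beta_i$ is the $i$-th total Betti number over $S$. Standard labelling: a Cohen--Macaulay very well-covered graph with $2n$ vertices always admits a labelling $V(G)=\{x_1,\dots,x_n,y_1,\dots,y_n\}$ such that: (i) $X=\{x_1,\dots,x_n\}$ is a minimal vertex cover and $Y=\{y_1,\dots,y_n\}$ is a maximal independent set; (ii) $x_iy_i\in E(G)$ for all $i$; (iii) if $x_iy_j\in E(G)$ then $i\le j$; (iv) if $x_iy_j\in E(G)$ then $x_ix_j\notin E(G)$; (v) if $z_ix_j,\,y_jx_k\in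 E(G)$ then $z_ix_k\in E(G)$, for any distinct $i,j,k$ and $z_i\in\{x_i,y_i\}$. Any labelling satisfying (i)--(v) is called standard. $\mathcal C(G)$ is the set of minimal vertex covers of $G$. For $C\in\mathcal C(G)$, $\mathcal C(G;C)=\{x_s: y_s\in C\text{ and }(C\setminus\{y_s\})\cup\{x_s\}\in\mathcal C(G)\}$. For a finitely generated graded $S$-module $M$ of dimension $d$ with Hilbert polynomial $P_M(t)=\sum_{i=0}^{d-1}(-1)^{d-1-i}e_{d-1-i}\binom{t+i}{i}$, the multiplicity is $e(M)=e_0$ if $d>0$ and $e(M)=\mathrm{length}(M)$ if $d=0$. *)

theory Defs
  imports
    Complex_Main
    "HOL-Library.Poly_Mapping"
    "HOL-Library.Extended_Nat"
    "HOL-Library.Cardinality"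
    "HOL-Algebra.QuotRing"
    "HOL-Algebra.Ring_Divisibility"
    "HOL-Algebra.Embedded_Algebras"
    "HOL-Algebra.Algebraic_Closure_Type"
begin

section \<open>Commutative algebra\<close>

subsection \<open>Krull dimension, height, length\<close>

definition prime_chain :: "('a, 'b) ring_scheme \<Rightarrow> nat \<Rightarrow> (nat \<Rightarrow> 'a set) \<Rightarrow> bool" where
  "prime_chain R k P \<longleftrightarrow> (\<forall>i\<le>k. primeideal (P i) R) \<and> (\<forall>i<k. P i \<subset> P (Suc i))"

definition krull_dim :: "('a, 'b) ring_scheme \<Rightarrow> enat" where
  "krull_dim R = Sup {enat k | k. \<exists>P. prime_chain R k P}"

definition prime_height :: "('a, 'b) ring_scheme \<Rightarrow> 'a set \<Rightarrow> enat" where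
  "prime_height R p = Sup {enat k | k. \<exists>P. prime_chain R k P \<and> P k = p}"

definition height :: "('a, 'b) ring_scheme \<Rightarrow> 'a set \<Rightarrow> enat" where
  "height R I = Inf {prime_height R p | p. primeideal p R \<and> I \<subseteq> p}"

text \<open>The submodules of a cyclic module \<open>S/I\<close> are the ideals of the ring \<open>S/I\<close>, so this is also
  the length of \<open>S/I\<close> as an \<open>S\<close>-module.\<close>

definition ring_length :: "('a, 'b) ring_scheme \<Rightarrow> enat" where
  "ring_length R = Sup {enat k | k. \<exists>J. (\<forall>i\<le>k. ideal (J i) R) \<and> (\<forall>i<k. J i \<subset> J (Suc i))}"

subsection \<open>Localization at a prime ideal\<close>

definition loc_rel ::
    "('a, 'b) ring_scheme \<Rightarrow> 'a set \<Rightarrow> (('a \<times> 'a) \<times> ('a \<times> 'a)) set" where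
  "loc_rel R p =
    {((a, s), (b, t)). a \<in> carrier R \<and> b \<in> carrier R \<and> s \<in> carrier R - p \<and> t \<in> carrier R - p \<and>
       (\<exists>u\<in>carrier R - p. u \<otimes>\<^bsub>R\<^esub> (t \<otimes>\<^bsub>R\<^esub> a) = u \<otimes>\<^bsub>R\<^esub> (s \<otimes>\<^bsub>R\<^esub> b))}"

definition loc_frac ::
    "('a, 'b) ring_scheme \<Rightarrow> 'a set \<Rightarrow> 'a \<Rightarrow> 'a \<Rightarrow> ('a \<times> 'a) set" where
  "loc_frac R p a s = loc_rel R p `` {(a, s)}"

definition localization :: "('a, 'b) ring_scheme \<Rightarrow> 'a set \<Rightarrow> ('a \<times> 'a) set ring" where
  "localization R p =
    \<lparr>carrier = (carrier R \<times> (carrier R - p)) // loc_rel R p,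
     monoid.mult = (\<lambda>A B. \<Union>(a, s)\<in>A. \<Union>(b, t)\<in>B. loc_frac R p (a \<otimes>\<^bsub>R\<^esub> b) (s \<otimes>\<^bsub>R\<^esub> t)),
     one = loc_frac R p \<one>\<^bsub>R\<^esub> \<one>\<^bsub>R\<^esub>,
     ring.zero = loc_frac R p \<zero>\<^bsub>R\<^esub> \<one>\<^bsub>R\<^esub>,
     add = (\<lambda>A B. \<Union>(a, s)\<in>A. \<Union>(b, t)\<in>B.
       loc_frac R p ((t \<otimes>\<^bsub>R\<^esub> a) \<oplus>\<^bsub>R\<^esub> (s \<otimes>\<^bsub>R\<^esub> b)) (s \<otimes>\<^bsub>R\<^esub> t))\<rparr>"

subsection \<open>Cohen--Macaulay rings\<close>

definition regular_sequence :: "('a, 'b) ring_scheme \<Rightarrow> 'a list \<Rightarrow> bool" where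
  "regular_sequence R as \<longleftrightarrow>
     set as \<subseteq> carrier R \<and> Idl\<^bsub>R\<^esub> (set as) \<noteq> carrier R \<and>
     (\<forall>i<length as. \<forall>r\<in>carrier R.
        as ! i \<otimes>\<^bsub>R\<^esub> r \<in> Idl\<^bsub>R\<^esub> (set (take i as)) \<longrightarrow> r \<in> Idl\<^bsub>R\<^esub> (set (take i as)))"

definition grade :: "('a, 'b) ring_scheme \<Rightarrow> 'a set \<Rightarrow> enat" where
  "grade R I = Sup {enat (length as) | as. regular_sequence R as \<and> set as \<subseteq> I}"

definition cohen_macaulay_local :: "('a, 'b) ring_scheme \<Rightarrow> bool" where
  "cohen_macaulay_local R \<longleftrightarrow>
     cring R \<and> noetherian_ring R \<and>
     (\<exists>m. {J. maximalideal J R} = {m} \<and> grade R m = krull_dim R)"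

definition cohen_macaulay_ring :: "('a, 'b) ring_scheme \<Rightarrow> bool" where
  "cohen_macaulay_ring R \<longleftrightarrow>
     cring R \<and> noetherian_ring R \<and>
     (\<forall>m. maximalideal m R \<longrightarrow> cohen_macaulay_local (localization R m))"

section \<open>Polynomial rings and graded invariants of cyclic modules\<close>

type_synonym ('v, 'k) mpoly = "('v \<Rightarrow>\<^sub>0 nat) \<Rightarrow>\<^sub>0 'k"

abbreviation polyring :: "('v, 'k::field) mpoly ring" where
  "polyring \<equiv> ring_of_type_algebra"

definition Var :: "'v \<Rightarrow> ('v, 'k::field) mpoly" where
  "Var v = Poly_Mapping.single (Poly_Mapping.single v 1) 1"

definition Const :: "'k::field \<Rightarrow> ('v, 'k) mpoly" where
  "Const c = Poly_Mapping.single 0 c"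

definition mdeg :: "('v \<Rightarrow>\<^sub>0 nat) \<Rightarrow> nat" where
  "mdeg m = (\<Sum>v\<in>Poly_Mapping.keys m. Poly_Mapping.lookup m v)"

definition homogeneous :: "nat \<Rightarrow> ('v, 'k::field) mpoly \<Rightarrow> bool" where
  "homogeneous t f \<longleftrightarrow> (\<forall>m\<in>Poly_Mapping.keys f. mdeg m = t)"

definition irrelevant_ideal :: "('v, 'k::field) mpoly set" where
  "irrelevant_ideal = Idl\<^bsub>polyring\<^esub> (range Var)"

subsection \<open>Betti numbers\<close>

text \<open>The free module \<open>S\<^sup>r\<close> is represented by the functions supported in \<open>{..<r}\<close>,
  a map \<open>S\<^sup>c \<rightarrow> S\<^sup>r\<close> by its matrix.\<close>

definition free_module :: "nat \<Rightarrow> (nat \<Rightarrow> 'r::comm_ring_1) set" where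
  "free_module r = {v. \<forall>j\<ge>r. v j = 0}"

definition matrix_map ::
    "nat \<Rightarrow> nat \<Rightarrow> (nat \<Rightarrow> nat \<Rightarrow> 'r::comm_ring_1) \<Rightarrow> (nat \<Rightarrow> 'r) \<Rightarrow> nat \<Rightarrow> 'r" where
  "matrix_map r c A v = (\<lambda>j. if j < r then (\<Sum>k<c. A j k * v k) else 0)"

text \<open>A minimal graded free resolution of \<open>S/I\<close>,
  \<open>0 \<rightarrow> F\<^sub>p \<rightarrow> \<dots> \<rightarrow> F\<^sub>1 \<rightarrow> F\<^sub>0 \<rightarrow> S/I \<rightarrow> 0\<close>,
  of finite length (as it is over a polynomial ring, by Hilbert's syzygy theorem).
  The module \<open>F\<^sub>i\<close> has rank \<open>b i\<close> and its \<open>j\<close>-th basis element has degree \<open>a i j\<close>; \<open>d i\<close> is the matrix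
  of \<open>F\<^sub>i\<^sub>+\<^sub>1 \<rightarrow> F\<^sub>i\<close>, and the \<open>j\<close>-th basis element of \<open>F\<^sub>0\<close> is mapped to the residue class of the form
  \<open>g j\<close>. Minimality means that the image of \<open>F\<^sub>i\<^sub>+\<^sub>1\<close> lies in \<open>m F\<^sub>i\<close>, with \<open>m\<close> the irrelevant ideal.\<close>

definition minimal_graded_free_resolution ::
    "('v, 'k::field) mpoly set \<Rightarrow> (nat \<Rightarrow> nat) \<Rightarrow> (nat \<Rightarrow> nat \<Rightarrow> nat) \<Rightarrow>
     (nat \<Rightarrow> ('v, 'k) mpoly) \<Rightarrow> (nat \<Rightarrow> nat \<Rightarrow> nat \<Rightarrow> ('v, 'k) mpoly) \<Rightarrow> bool" where
  "minimal_graded_free_resolution I b a g d \<longleftrightarrow>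
     (\<exists>p. \<forall>i>p. b i = 0) \<and>
     (\<forall>j<b 0. homogeneous (a 0 j) (g j)) \<and>
     (\<forall>i. \<forall>j<b i. \<forall>k<b (Suc i). \<forall>m\<in>Poly_Mapping.keys (d i j k).
        a i j + mdeg m = a (Suc i) k) \<and>
     (\<forall>f. \<exists>v\<in>free_module (b 0). f - (\<Sum>j<b 0. g j * v j) \<in> I) \<and>
     {v \<in> free_module (b 0). (\<Sum>j<b 0. g j * v j) \<in> I}
       = matrix_map (b 0) (b 1) (d 0) ` free_module (b 1) \<and>
     (\<forall>i. {v \<in> free_module (b (Suc i)). matrix_map (b i) (b (Suc i)) (d i) v = (\<lambda>_. 0)}
       = matrix_map (b (Suc i)) (b (Suc (Suc i))) (d (Suc i)) ` free_module (b (Suc (Suc i)))) \<and>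
     (\<forall>i. \<forall>j<b i. \<forall>k<b (Suc i). d i j k \<in> irrelevant_ideal)"

text \<open>The \<open>i\<close>-th total Betti number of \<open>S/I\<close>, for a homogeneous ideal \<open>I\<close>. The resolution is unique
  up to isomorphism, so the ranks do not depend on the choice.\<close>

definition betti :: "('v, 'k::field) mpoly set \<Rightarrow> nat \<Rightarrow> nat" where
  "betti I = (SOME b. \<exists>a g d. minimal_graded_free_resolution I b a g d)"

subsection \<open>Hilbert function and multiplicity\<close>

definition hilbert_function :: "('v, 'k::field) mpoly set \<Rightarrow> nat \<Rightarrow> nat" where
  "hilbert_function I t =
     ring.dim (polyring Quot I) {I +>\<^bsub>polyring\<^esub> Const c | c. True}
       {I +>\<^bsub>polyring\<^esub> f | f. homogeneous t f}"

text \<open>\<open>e\<close> are the Hilbert coefficients of \<open>S/I\<close>: the Hilbert polynomial is the only polynomial that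
  agrees with the Hilbert function in all large degrees, hence it is
  \<open>\<Sum>i<d. (-1)^(d-1-i) * e (d-1-i) * binom (t+i) i\<close> exactly if the following holds.\<close>

definition hilbert_coeffs ::
    "('v, 'k::field) mpoly set \<Rightarrow> nat \<Rightarrow> (nat \<Rightarrow> int) \<Rightarrow> bool" where
  "hilbert_coeffs I d e \<longleftrightarrow>
     (\<forall>\<^sub>F t in sequentially. int (hilbert_function I t) =
        (\<Sum>i=0..d-1. (-1) ^ (d - 1 - i) * e (d - 1 - i) * int ((t + i) choose i)))"

definition module_multiplicity :: "('v, 'k::field) mpoly set \<Rightarrow> int" where
  "module_multiplicity I =
     (let d = the_enat (krull_dim (polyring Quot I)) in
      if d = 0 then int (the_enat (ring_length (polyring Quot I)))
      else (THE e\<^sub>0. \<exists>e. hilbert_coeffs I d e \<and> e 0 = e\<^sub>0))"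

section \<open>Graphs\<close>

text \<open>A graph is given by its edge set; its vertex set is the whole finite type \<open>'v\<close>.\<close>

definition simple_graph :: "'v::finite set set \<Rightarrow> bool" where
  "simple_graph E \<longleftrightarrow> (\<forall>e\<in>E. card e = 2)"

definition vertex_cover :: "'v::finite set set \<Rightarrow> 'v set \<Rightarrow> bool" where
  "vertex_cover E C \<longleftrightarrow> (\<forall>e\<in>E. e \<inter> C \<noteq> {})"

definition minimal_covers :: "'v::finite set set \<Rightarrow> 'v set set" where
  "minimal_covers E = {C. vertex_cover E C \<and> (\<forall>C'\<subset>C. \<not> vertex_cover E C')}"

definition independent_set :: "'v::finite set set \<Rightarrow> 'v set \<Rightarrow> bool" where
  "independent_set E A \<longleftrightarrow> (\<forall>e\<in>E. \<not> e \<subseteq> A)"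

definition maximal_independent_set :: "'v::finite set set \<Rightarrow> 'v set \<Rightarrow> bool" where
  "maximal_independent_set E A \<longleftrightarrow> independent_set E A \<and> (\<forall>B. A \<subset> B \<longrightarrow> \<not> independent_set E B)"

definition edge_ideal :: "'v::finite set set \<Rightarrow> ('v, 'k::field) mpoly set" where
  "edge_ideal E = Idl\<^bsub>polyring\<^esub> {\<Prod>z\<in>e. Var z | e. e \<in> E}"

definition cover_ideal :: "'v::finite set set \<Rightarrow> ('v, 'k::field) mpoly set" where
  "cover_ideal E = Idl\<^bsub>polyring\<^esub> {\<Prod>z\<in>C. Var z | C. C \<in> minimal_covers E}"

definition unmixed :: "'v::finite set set \<Rightarrow> bool" where
  "unmixed E \<longleftrightarrow> (\<forall>C\<in>minimal_covers E. \<forall>D\<in>minimal_covers E. card C = card D)"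

definition very_well_covered :: "'k::field itself \<Rightarrow> 'v::finite set set \<Rightarrow> bool" where
  "very_well_covered K E \<longleftrightarrow>
     unmixed E \<and> (\<forall>v. \<exists>e\<in>E. v \<in> e) \<and>
     2 * height polyring (edge_ideal E :: ('v, 'k) mpoly set) = enat CARD('v)"

definition cohen_macaulay_graph :: "'k::field itself \<Rightarrow> 'v::finite set set \<Rightarrow> bool" where
  "cohen_macaulay_graph K E \<longleftrightarrow>
     cohen_macaulay_ring (polyring Quot (edge_ideal E :: ('v, 'k) mpoly set))"

subsection \<open>Standard labellings\<close>

text \<open>The index set \<open>{1..n}\<close> is a finite linearly ordered type \<open>'n\<close>, so \<open>n = CARD('n)\<close>. A labelled
  graph on \<open>2n\<close> vertices has vertex type \<open>'n + 'n\<close>.\<close>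

abbreviation xv :: "'n \<Rightarrow> 'n + 'n" where "xv \<equiv> Inl"
abbreviation yv :: "'n \<Rightarrow> 'n + 'n" where "yv \<equiv> Inr"

definition standard_labelling :: "('n::{finite, linorder} + 'n) set set \<Rightarrow> bool" where
  "standard_labelling E \<longleftrightarrow>
     range xv \<in> minimal_covers E \<and> maximal_independent_set E (range yv) \<and>
     (\<forall>i. {xv i, yv i} \<in> E) \<and>
     (\<forall>i j. {xv i, yv j} \<in> E \<longrightarrow> i \<le> j) \<and>
     (\<forall>i j. {xv i, yv j} \<in> E \<longrightarrow> {xv i, xv j} \<notin> E) \<and>
     (\<forall>i j k. i \<noteq> j \<and> j \<noteq> k \<and> i \<noteq> k \<longrightarrow>
        (\<forall>z\<in>{xv i, yv i}. {z, xv j} \<in> E \<and> {yv j, xv k} \<in> E \<longrightarrow> {z, xv k} \<in> E))"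

definition exchange_set ::
    "('n::{finite, linorder} + 'n) set set \<Rightarrow> ('n + 'n) set \<Rightarrow> ('n + 'n) set" where
  "exchange_set E C =
     {xv s | s. yv s \<in> C \<and> (C - {yv s}) \<union> {xv s} \<in> minimal_covers E}"

end

theory Submission
  imports Defs
begin

text \<open>A monomial lies in the cover ideal exactly if its support is a vertex cover. In a standard
  labelling a minimal cover \<open>C\<close> is determined by \<open>{i. y\<^sub>i \<in> C}\<close>, and every vertex cover \<open>W\<close> contains
  exactly one minimal cover \<open>C\<close> with \<open>W \<inter> \<C>(G;C) = {}\<close>, namely the one with the least index set. Hence
  the cover ideal has linear quotients, with colon ideals generated by the variables in \<open>\<C>(G;C)\<close>, and
  iterated mapping cones give a minimal resolution. Multiplication by a monomial of the ideal is
  null-homotopic on any resolution; evaluating all variables at 1 gives a contractible complex of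
  vector spaces, so the alternating sum of the ranks vanishes.

  The Hilbert function counts the monomials whose support is not a cover. The largest such supports
  are the complements of the edges, which yields dimension \<open>2n - 2\<close> and multiplicity \<open>|E(G)|\<close>. The same
  complements are the only ones that contribute when the partition of all covers into the
  intervals above is evaluated by \<open>(t d/dt)\<^sup>2\<close> at \<open>t = 1\<close>, which gives the last formula.\<close>

text \<open>\<open>betti\<close> is a choice among the rank sequences of minimal resolutions. One
  such resolution therefore has to be built, which is the purpose of the linear quotients; the value
  of the sum is then derived for whichever resolution the choice returns. Two facts about it
  suffice: minimality forces rank 1 in step 0, and the alternating sum of all ranks is 0. The point
  with all coordinates 1 lies off the zero set of the ideal, which is why the resolution stays exact
  when it is evaluated there.

  The constructed resolution is minimal for reasons of degree: all minimal covers have the same size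
  and all colon ideals are generated by variables, so the comparison maps of the mapping cones can
  be chosen with entries of positive degree.

  The upper bound for the Krull dimension is a matter of growth: a chain of primes that is too long
  yields more products of bounded degree than there are monomials of that degree outside the
  ideal.\<close>

abbreviation lookup :: "('a \<Rightarrow>\<^sub>0 'b::zero) \<Rightarrow> 'a \<Rightarrow> 'b" where "lookup \<equiv> Poly_Mapping.lookup"
abbreviation keys :: "('a \<Rightarrow>\<^sub>0 'b::zero) \<Rightarrow> 'a set" where "keys \<equiv> Poly_Mapping.keys"
abbreviation single :: "'a \<Rightarrow> 'b \<Rightarrow> ('a \<Rightarrow>\<^sub>0 'b::zero)" where "single \<equiv> Poly_Mapping.single"

section \<open>Ideals spanned by monomials with prescribed supports\<close>

lemma poly_mapping_expand: "f = (\<Sum>m\<in>keys f. single m (lookup f m))"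
  by (rule poly_mapping_eqI)
    (auto simp: lookup_sum lookup_single when_def sum.delta' in_keys_iff)

lemma keys_add_nat: "keys (a + b) = keys a \<union> keys (b :: 'v \<Rightarrow>\<^sub>0 nat)"
  by (auto simp: in_keys_iff lookup_add)

lemma keys_diff_subset: "keys (f - g) \<subseteq> keys f \<union> keys (g :: 'a \<Rightarrow>\<^sub>0 'b::ab_group_add)"
  by (auto simp: in_keys_iff lookup_minus)

lemma lookup_single_times:
  fixes f :: "('v \<Rightarrow>\<^sub>0 nat) \<Rightarrow>\<^sub>0 'k::comm_ring_1"
  shows "lookup (single u c * f) (u + m) = c * lookup f m"
proof -
  have "single u c * f = (\<Sum>k\<in>keys f. single (u + k) (c * lookup f k))"
    by (subst poly_mapping_expand[of f]) (simp add: sum_distrib_left mult_single)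
  then have "lookup (single u c * f) (u + m) = (\<Sum>k\<in>keys f. (c * lookup f k when k = m))"
    by (simp add: lookup_sum lookup_single)
  also have "\<dots> = c * lookup f m"
    by (auto simp: when_def sum.delta in_keys_iff)
  finally show ?thesis .
qed

lemma keys_single_times:
  fixes f :: "('v \<Rightarrow>\<^sub>0 nat) \<Rightarrow>\<^sub>0 'k::comm_ring_1"
  shows "keys (single u 1 * f) = (+) u ` keys f"
proof
  show "keys (single u 1 * f) \<subseteq> (+) u ` keys f"
    using keys_mult[of "single u (1::'k)" f] by (auto simp: image_def)
  show "(+) u ` keys f \<subseteq> keys (single u 1 * f)"
    by (auto simp: in_keys_iff lookup_single_times)
qed

lemma mdeg_eq_sum: "mdeg m = (\<Sum>v\<in>UNIV. lookup (m :: 'v::finite \<Rightarrow>\<^sub>0 nat) v)"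
  unfolding mdeg_def by (rule sum.mono_neutral_left) (auto simp: in_keys_iff)

lemma mdeg_add: "mdeg (a + b) = mdeg a + mdeg (b :: 'v::finite \<Rightarrow>\<^sub>0 nat)"
  by (simp add: mdeg_eq_sum lookup_add sum.distrib)

lemma mdeg_eq_0_iff: "mdeg m = 0 \<longleftrightarrow> m = (0 :: 'v::finite \<Rightarrow>\<^sub>0 nat)"
  by (auto simp: mdeg_eq_sum intro: poly_mapping_eqI)

definition sqfree_mono :: "'v set \<Rightarrow> 'v \<Rightarrow>\<^sub>0 nat" where
  "sqfree_mono C = (\<Sum>z\<in>C. single z 1)"

lemma lookup_sqfree_mono: "finite C \<Longrightarrow> lookup (sqfree_mono C) v = (if v \<in> C then 1 else 0)"
  by (simp add: sqfree_mono_def lookup_sum lookup_single when_def)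

lemma keys_sqfree_mono [simp]: "keys (sqfree_mono C) = (C :: 'v::finite set)"
  by (auto simp: in_keys_iff lookup_sqfree_mono split: if_splits)

lemma mdeg_sqfree_mono [simp]: "mdeg (sqfree_mono C) = card (C :: 'v::finite set)"
  by (simp add: mdeg_def lookup_sqfree_mono)

lemma prod_Var: "finite C \<Longrightarrow> (\<Prod>z\<in>C. Var z) = single (sqfree_mono C) (1 :: 'k::field)"
  by (induction rule: finite_induct) (auto simp: Var_def sqfree_mono_def mult_single)

text \<open>For monotone \<open>P\<close> these are the squarefree monomial ideals, the zero ideal
  and the whole ring included. Recording only which supports occur turns colon ideals and new
  generators into operations on predicates of sets.\<close>

definition supp_ideal :: "('v set \<Rightarrow> bool) \<Rightarrow> ('v, 'k::field) mpoly set" where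
  "supp_ideal P = {f. \<forall>m\<in>keys f. P (keys m)}"

lemma supp_ideal_0 [simp]: "0 \<in> supp_ideal P"
  by (simp add: supp_ideal_def)

lemma supp_ideal_add: "f \<in> supp_ideal P \<Longrightarrow> g \<in> supp_ideal P \<Longrightarrow> f + g \<in> supp_ideal P"
  using Poly_Mapping.keys_add[of f g] by (auto simp: supp_ideal_def)

lemma supp_ideal_diff: "f \<in> supp_ideal P \<Longrightarrow> g \<in> supp_ideal P \<Longrightarrow> f - g \<in> supp_ideal P"
  using keys_diff_subset[of f g] by (auto simp: supp_ideal_def)

lemma supp_ideal_uminus: "f \<in> supp_ideal P \<Longrightarrow> - f \<in> supp_ideal P"
  by (auto simp: supp_ideal_def in_keys_iff)

lemma supp_ideal_sum: "(\<And>i. i \<in> A \<Longrightarrow> f i \<in> supp_ideal P) \<Longrightarrow> sum f A \<in> supp_ideal P"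
  by (induction A rule: infinite_finite_induct) (auto intro: supp_ideal_add)

lemma supp_ideal_times:
  assumes "mono P" "f \<in> supp_ideal P"
  shows "g * f \<in> supp_ideal P" "f * g \<in> supp_ideal P"
proof -
  show "g * f \<in> supp_ideal P"
    unfolding supp_ideal_def mem_Collect_eq
  proof
    fix m assume "m \<in> keys (g * f)"
    then obtain a b where ab: "m = a + b" "b \<in> keys f" using keys_mult[of g f] by blast
    have "P (keys b)" using ab assms(2) by (simp add: supp_ideal_def)
    moreover have "P (keys b) \<le> P (keys m)"
      by (rule monoD[OF assms(1)]) (simp add: ab keys_add_nat)
    ultimately show "P (keys m)" by simp
  qed
  then show "f * g \<in> supp_ideal P" by (simp add: mult.commute)
qed

text \<open>The colon ideal of \<open>supp_ideal P\<close> by a monomial is again of this form, with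
  the support of the monomial added inside the predicate.\<close>

lemma single_times_in_supp_ideal_iff:
  "single u 1 * f \<in> supp_ideal P \<longleftrightarrow> f \<in> supp_ideal (\<lambda>A. P (keys u \<union> A))"
  by (auto simp: supp_ideal_def keys_single_times keys_add_nat)

lemma le_sqfree_mono_ex:
  fixes m :: "'v::finite \<Rightarrow>\<^sub>0 nat"
  assumes "C \<subseteq> keys m"
  shows "\<exists>m'. m = sqfree_mono C + m'"
proof
  show "m = sqfree_mono C + (m - sqfree_mono C)"
    using assms
    by (intro poly_mapping_eqI) (auto simp: lookup_add lookup_minus lookup_sqfree_mono in_keys_iff
        dest!: subsetD)
qed

text \<open>A term whose support violates \<open>P\<close> has a support containing
  \<open>C\<close>, so the monomial of \<open>C\<close> divides it; collecting these terms gives the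
  second summand. The right-hand side has the shape that a mapping cone resolves.\<close>

lemma supp_ideal_insert:
  fixes P :: "'v::finite set \<Rightarrow> bool"
  assumes "mono P"
  shows "(supp_ideal (\<lambda>A. P A \<or> C \<subseteq> A) :: ('v, 'k::field) mpoly set)
    = {f + single (sqfree_mono C) 1 * g | f g. f \<in> supp_ideal P}" (is "?L = ?R")
proof
  have monoL: "mono (\<lambda>A. P A \<or> C \<subseteq> A)" using assms by (auto simp: mono_def)
  show "?R \<subseteq> ?L"
    by (auto simp: single_times_in_supp_ideal_iff intro!: supp_ideal_add)
      (auto simp: supp_ideal_def)
  show "?L \<subseteq> ?R"
  proof
    fix f assume f: "f \<in> ?L"
    define N where "N = {m\<in>keys f. \<not> P (keys m)}"
    have "\<forall>m\<in>N. \<exists>m'. m = sqfree_mono C + m'"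
      using f by (auto simp: N_def supp_ideal_def intro!: le_sqfree_mono_ex)
    then obtain h where h: "\<And>m. m \<in> N \<Longrightarrow> m = sqfree_mono C + h m" by metis
    have "f = (\<Sum>m\<in>keys f - N. single m (lookup f m)) + (\<Sum>m\<in>N. single m (lookup f m))"
      by (subst poly_mapping_expand[of f], rule sum.subset_diff) (auto simp: N_def)
    also have "(\<Sum>m\<in>N. single m (lookup f m))
        = single (sqfree_mono C) 1 * (\<Sum>m\<in>N. single (h m) (lookup f m))"
      unfolding sum_distrib_left by (rule sum.cong) (auto simp: mult_single simp flip: h)
    finally have "f = (\<Sum>m\<in>keys f - N. single m (lookup f m))
      + single (sqfree_mono C) 1 * (\<Sum>m\<in>N. single (h m) (lookup f m))" .
    moreover have "(\<Sum>m\<in>keys f - N. single m (lookup f m)) \<in> supp_ideal P"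
      by (rule supp_ideal_sum) (auto simp: supp_ideal_def N_def)
    ultimately show "f \<in> ?R" by blast
  qed
qed

section \<open>Ideals of the polynomial ring generated by squarefree monomials\<close>

lemma polyring_simps [simp]:
  "carrier polyring = UNIV" "x \<otimes>\<^bsub>polyring\<^esub> y = x * y" "\<one>\<^bsub>polyring\<^esub> = 1"
  "\<zero>\<^bsub>polyring\<^esub> = 0" "x \<oplus>\<^bsub>polyring\<^esub> y = x + y"
  by (simp_all add: ring_of_type_algebra_def)

lemma ring_polyring: "ring (polyring :: ('v, 'k::field) mpoly ring)"
  by (rule ring_from_type_algebra)

lemma cring_polyring: "cring (polyring :: ('v, 'k::field) mpoly ring)"
  by (rule cring_from_type_algebra)

lemma a_inv_polyring [simp]: "\<ominus>\<^bsub>polyring\<^esub> (x :: ('v, 'k::field) mpoly) = - x"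
proof -
  interpret ring "polyring :: ('v, 'k::field) mpoly ring" by (rule ring_polyring)
  show ?thesis using minus_equality[of "- x" x] by simp
qed

lemma ideal_polyring_iff:
  "ideal I (polyring :: ('v, 'k::field) mpoly ring) \<longleftrightarrow>
     0 \<in> I \<and> (\<forall>f\<in>I. \<forall>g\<in>I. f + g \<in> I) \<and> (\<forall>f\<in>I. \<forall>g. g * f \<in> I)" (is "?L \<longleftrightarrow> ?R")
proof
  assume ?L
  then interpret ideal I "polyring :: ('v, 'k) mpoly ring" .
  show ?R using additive_subgroup.zero_closed[OF is_additive_subgroup]
      additive_subgroup.a_closed[OF is_additive_subgroup] I_l_closed by simp
next
  assume R: ?R
  interpret ring "polyring :: ('v, 'k) mpoly ring" by (rule ring_polyring)
  have neg: "- f \<in> I" if "f \<in> I" for f using R that by (metis mult_minus1)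
  show ?L
  proof (rule idealI)
    show "subgroup I (add_monoid (polyring :: ('v, 'k) mpoly ring))"
      by (rule add.subgroupI) (use R neg in \<open>auto simp flip: a_inv_def\<close>)
  qed (use R in \<open>auto simp: ring_polyring mult.commute\<close>)
qed

lemma ideal_sum:
  assumes "ideal I (polyring :: ('v, 'k::field) mpoly ring)"
  shows "(\<And>i. i \<in> A \<Longrightarrow> f i \<in> I) \<Longrightarrow> sum f A \<in> I"
  using assms by (induction A rule: infinite_finite_induct) (simp_all add: ideal_polyring_iff)

lemma ideal_supp_ideal: "mono P \<Longrightarrow> ideal (supp_ideal P) (polyring :: ('v, 'k::field) mpoly ring)"
  by (auto simp: ideal_polyring_iff intro: supp_ideal_add supp_ideal_times)

lemma Idl_sqfree:
  fixes U :: "'v::finite set set"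
  shows "Idl\<^bsub>polyring\<^esub> {\<Prod>z\<in>C. Var z | C. C \<in> U}
    = (supp_ideal (\<lambda>A. \<exists>C\<in>U. C \<subseteq> A) :: ('v, 'k::field) mpoly set)" (is "?I = ?S")
proof
  have "mono (\<lambda>A. \<exists>C\<in>U. C \<subseteq> A)" by (auto simp: mono_def)
  then have "ideal ?S polyring" by (rule ideal_supp_ideal)
  moreover have "{\<Prod>z\<in>C. Var z | C. C \<in> U} \<subseteq> ?S"
    by (auto simp: prod_Var supp_ideal_def)
  ultimately show "?I \<subseteq> ?S" by (auto simp: genideal_def)
  show "?S \<subseteq> ?I"
    unfolding genideal_def
  proof (intro subsetI InterI, clarify)
    fix f J assume f: "f \<in> ?S"
      and J: "ideal J (polyring :: ('v, 'k) mpoly ring)" "{\<Prod>z\<in>C. Var z | C. C \<in> U} \<subseteq> J"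
    interpret J: ideal J "polyring :: ('v, 'k) mpoly ring" by (rule J)
    have "single m c \<in> J" if "m \<in> keys f" for m c
    proof -
      obtain C where C: "C \<in> U" "C \<subseteq> keys m" using f \<open>m \<in> keys f\<close> by (auto simp: supp_ideal_def)
      then obtain m' where "m = sqfree_mono C + m'" using le_sqfree_mono_ex by blast
      then have "single m c = single m' c * (\<Prod>z\<in>C. Var z)"
        by (simp add: prod_Var mult_single add.commute)
      then show ?thesis using J C by (auto simp: ideal_polyring_iff)
    qed
    then have "sum (\<lambda>m. single m (lookup f m)) (keys f) \<in> J"
      by (intro ideal_sum[OF J(1)])
    then show "f \<in> J" using poly_mapping_expand[of f] by simp
  qed
qed

lemma irrelevant_ideal_eq:
  "(irrelevant_ideal :: ('v::finite, 'k::field) mpoly set) = supp_ideal (\<lambda>A. A \<noteq> {})"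
proof -
  have "range (Var :: 'v \<Rightarrow> ('v, 'k) mpoly) = {\<Prod>z\<in>C. Var z | C. C \<in> range (\<lambda>v. {v})}"
  proof (intro equalityI subsetI)
    fix f :: "('v, 'k) mpoly" assume "f \<in> range Var"
    then obtain v where "f = Var v" by blast
    then have "f = (\<Prod>z\<in>{v}. Var z)" by simp
    then show "f \<in> {\<Prod>z\<in>C. Var z | C. C \<in> range (\<lambda>v. {v})}" by blast
  qed auto
  then show ?thesis unfolding irrelevant_ideal_def by (simp only: Idl_sqfree) (auto simp: supp_ideal_def simp flip: keys_eq_empty)
qed

section \<open>The cover ideal in terms of supports\<close>

lemma vertex_cover_mono: "mono (vertex_cover E)"
  by (auto simp: mono_def vertex_cover_def)

lemma minimal_cover_exists:
  assumes "vertex_cover E W"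
  shows "\<exists>C\<in>minimal_covers E. C \<subseteq> W"
proof -
  obtain C where C: "C \<subseteq> W" "vertex_cover E C"
    and "\<forall>D\<in>{C. vertex_cover E C}. D \<subseteq> C \<longrightarrow> C = D"
    using finite_has_minimal2[of "{C. vertex_cover E C}" W] assms by auto
  then show ?thesis by (intro bexI[of _ C]) (auto simp: minimal_covers_def)
qed

lemma cover_ideal_eq:
  "(cover_ideal E :: ('v::finite, 'k::field) mpoly set) = supp_ideal (vertex_cover E)"
proof -
  have "vertex_cover E A" if "C \<in> minimal_covers E" "C \<subseteq> A" for A C
    using that by (fastforce simp: minimal_covers_def vertex_cover_def)
  then have eq: "(\<lambda>A. \<exists>C\<in>minimal_covers E. C \<subseteq> A) = vertex_cover E"
    using minimal_cover_exists[of E] unfolding fun_eq_iff by metis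
  show ?thesis unfolding cover_ideal_def Idl_sqfree eq ..
qed

section \<open>Minimal vertex covers in a standard labelling\<close>

locale standard_graph =
  fixes E :: "('n::{finite, linorder} + 'n) set set"
  assumes simple: "simple_graph E" and unmixed: "unmixed E" and standard: "standard_labelling E"
begin

lemma matching_edge: "{xv i, yv i} \<in> E"
  using standard by (auto simp: standard_labelling_def)

lemma edge_xy_le: "{xv i, yv j} \<in> E \<Longrightarrow> i \<le> j"
  using standard by (auto simp: standard_labelling_def)

lemma edge_yy: "{yv i, yv j} \<notin> E"
  using standard
  by (auto simp: standard_labelling_def maximal_independent_set_def independent_set_def)

lemma edge_neq: "{u, v} \<in> E \<Longrightarrow> u \<noteq> v"
  using simple by (auto simp: simple_graph_def)

lemma edge_xy_xx: "{xv i, yv j} \<in> E \<Longrightarrow> {xv i, xv j} \<notin> E"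
  using standard by (auto simp: standard_labelling_def)

lemma edge_trans:
  "i \<noteq> j \<Longrightarrow> j \<noteq> k \<Longrightarrow> i \<noteq> k \<Longrightarrow> z \<in> {xv i, yv i} \<Longrightarrow> {z, xv j} \<in> E \<Longrightarrow> {yv j, xv k} \<in> E
    \<Longrightarrow> {z, xv k} \<in> E"
  using standard unfolding standard_labelling_def by blast

lemma edge_cases:
  assumes "e \<in> E"
  obtains i j where "e = {xv i, xv j}" "i \<noteq> j" | i j where "e = {xv i, yv j}"
proof -
  have "card e = 2" using assms simple by (simp add: simple_graph_def)
  then obtain u v where uv: "e = {u, v}" "u \<noteq> v" by (auto simp: card_2_iff)
  with assms edge_yy that show ?thesis
    by (cases u; cases v) (auto simp: insert_commute)
qed

text \<open>Condition (v) speaks of three distinct indices; the other cases are trivial or a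
  matching edge. Together with (ii) and (iii) this makes \<open>{xv i, yv j} \<in> E\<close> a
  partial order on the indices, which the given linear order extends.\<close>

lemma xy_trans:
  assumes "{xv k, yv i} \<in> E" "{xv i, yv j} \<in> E"
  shows "{xv k, yv j} \<in> E"
proof -
  consider "i = j" | "i = k" | "k = j" | "i \<noteq> j" "i \<noteq> k" "k \<noteq> j" by blast
  then show ?thesis
  proof cases
    case 4
    then show ?thesis using edge_trans[of j i k "yv j"] assms by (auto simp: insert_commute)
  qed (use assms matching_edge in auto)
qed

text \<open>An end \<open>xv a\<close> of an edge may be moved down the order of
  \<open>xy_trans\<close>. For \<open>k = b\<close> the two hypotheses contradict condition
  (iv).\<close>

lemma xx_transfer:
  assumes "{xv a, xv b} \<in> E" "{xv k, yv a} \<in> E"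
  shows "{xv k, xv b} \<in> E"
proof -
  consider "k = a" | "k = b" | "k \<noteq> a" "k \<noteq> b" by blast
  then show ?thesis
  proof cases
    case 2
    then show ?thesis using assms edge_xy_xx[of b a] by (auto simp: insert_commute)
  next
    case 3
    moreover have "a \<noteq> b" using assms(1) edge_neq by blast
    ultimately show ?thesis
      using edge_trans[of b a k "xv b"] assms by (auto simp: insert_commute)
  qed (use assms in auto)
qed

lemma card_minimal_cover:
  assumes "C \<in> minimal_covers E"
  shows "card C = CARD('n)"
proof -
  have "range xv \<in> minimal_covers E" using standard by (simp add: standard_labelling_def)
  then have "card C = card (range xv :: ('n + 'n) set)"
    using unmixed assms unfolding unmixed_def by blast
  then show ?thesis by (simp add: card_image)
qed

lemma vertex_cover_edge: "vertex_cover E W \<Longrightarrow> {u, v} \<in> E \<Longrightarrow> u \<in> W \<or> v \<in> W"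
  by (fastforce simp: vertex_cover_def)

text \<open>A minimal cover has \<open>CARD('n)\<close> elements and meets each of the
  \<open>CARD('n)\<close> disjoint matching edges, so it meets each of them exactly once.\<close>

lemma minimal_cover_exclusive:
  assumes "C \<in> minimal_covers E"
  shows "yv i \<in> C \<longleftrightarrow> xv i \<notin> C"
proof -
  define A B where "A = {i. xv i \<in> C}" and "B = {i. yv i \<in> C}"
  have vc: "vertex_cover E C" using assms by (simp add: minimal_covers_def)
  then have AB: "A \<union> B = UNIV"
    using vertex_cover_edge[OF vc matching_edge] by (auto simp: A_def B_def)
  have "C = xv ` A \<union> yv ` B"
    unfolding A_def B_def by (auto simp: image_def) (metis sum.exhaust)
  moreover have "card (xv ` A \<union> yv ` B) = card (xv ` A) + card (yv ` B)"
    by (rule card_Un_disjoint) auto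
  ultimately have "card C = card (xv ` A) + card (yv ` B)" by simp
  then have "card C = card A + card B" by (simp add: card_image)
  also have "\<dots> = CARD('n) + card (A \<inter> B)" using card_Un_Int[of A B] AB by simp
  finally have "A \<inter> B = {}" using card_minimal_cover[OF assms] by simp
  then show ?thesis using AB by (auto simp: A_def B_def)
qed

text \<open>Removing any vertex leaves its matching edge uncovered.\<close>

lemma minimal_coverI:
  assumes "vertex_cover E W" "\<And>i. \<not> (xv i \<in> W \<and> yv i \<in> W)"
  shows "W \<in> minimal_covers E"
  unfolding minimal_covers_def
proof (intro CollectI conjI allI impI notI)
  fix C' assume C': "C' \<subset> W" "vertex_cover E C'"
  then obtain z where z: "z \<in> W" "z \<notin> C'" by blast
  obtain i where "z = xv i \<or> z = yv i" by (cases z) auto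
  then show False using z C' assms(2)[of i] vertex_cover_edge[OF C'(2) matching_edge[of i]] by auto
qed (rule assms(1))

section \<open>The least cover inside a given vertex cover\<close>

definition y_index :: "('n + 'n) set \<Rightarrow> 'n set" where
  "y_index C = {i. yv i \<in> C}"

lemma y_index_inj:
  assumes "C \<in> minimal_covers E" "D \<in> minimal_covers E" "y_index C = y_index D"
  shows "C = D"
proof -
  have "z \<in> C \<longleftrightarrow> z \<in> D" for z
    using assms(3) minimal_cover_exclusive[OF assms(1)] minimal_cover_exclusive[OF assms(2)]
    by (cases z) (auto simp: y_index_def set_eq_iff)
  then show ?thesis by blast
qed

text \<open>A cover inside \<open>W\<close> misses every \<open>xv i\<close> outside
  \<open>W\<close> and therefore contains all neighbours \<open>yv j\<close> of such
  vertices.\<close>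

definition forced :: "('n + 'n) set \<Rightarrow> 'n set" where
  "forced W = {j. \<exists>i. xv i \<notin> W \<and> {xv i, yv j} \<in> E}"

definition least_cover :: "('n + 'n) set \<Rightarrow> ('n + 'n) set" where
  "least_cover W = xv ` (- forced W) \<union> yv ` forced W"

lemma in_least_cover_iff [simp]:
  "xv i \<in> least_cover W \<longleftrightarrow> i \<notin> forced W" "yv i \<in> least_cover W \<longleftrightarrow> i \<in> forced W"
  by (auto simp: least_cover_def)

lemma y_index_least_cover [simp]: "y_index (least_cover W) = forced W"
  by (simp add: y_index_def)

text \<open>The forced indices are closed upwards in the order of \<open>xy_trans\<close>, which
  covers the edges between an \<open>xv\<close> and a \<open>yv\<close>. The edges between two
  \<open>xv\<close> need \<open>xx_transfer\<close>.\<close>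

lemma least_cover_minimal:
  assumes "vertex_cover E W"
  shows "least_cover W \<in> minimal_covers E"
proof (rule minimal_coverI)
  have "e \<inter> least_cover W \<noteq> {}" if "e \<in> E" for e
    using that
  proof (cases rule: edge_cases)
    case (1 i j)
    have False if ij: "i \<in> forced W" "j \<in> forced W"
    proof -
      obtain k l where k: "xv k \<notin> W" "{xv k, yv i} \<in> E" and l: "xv l \<notin> W" "{xv l, yv j} \<in> E"
        using ij unfolding forced_def by blast
      \<comment> \<open>Both ends are moved down to the vertices \<open>xv k\<close> and
        \<open>xv l\<close> that force them. These lie outside \<open>W\<close>, so \<open>W\<close>
        would miss the edge between them.\<close>
      have "{xv k, xv j} \<in> E" using xx_transfer k(2) 1 \<open>e \<in> E\<close> by blast
      then have "{xv l, xv k} \<in> E" using xx_transfer[of j k l] l(2) by (simp add: insert_commute)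
      then show False using assms vertex_cover_edge k(1) l(1) by blast
    qed
    then show ?thesis using 1 by auto
  next
    case (2 i j)
    then show ?thesis using xy_trans \<open>e \<in> E\<close> by (auto simp: forced_def)
  qed
  then show "vertex_cover E (least_cover W)" by (simp add: vertex_cover_def)
qed simp

lemma least_cover_subset:
  assumes "vertex_cover E W"
  shows "least_cover W \<subseteq> W"
  using assms vertex_cover_edge matching_edge unfolding least_cover_def forced_def by blast

lemma forced_least:
  assumes "D \<in> minimal_covers E" "D \<subseteq> W"
  shows "forced W \<subseteq> y_index D"
  using assms vertex_cover_edge[of D]
  by (auto simp: forced_def y_index_def minimal_covers_def)

text \<open>Let \<open>s\<close> be forced by \<open>xv k\<close> outside \<open>W\<close>. Then
  \<open>k\<close> is forced as well, through its matching edge. If \<open>xv s\<close> lies in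
  \<open>W\<close>, then \<open>k\<close> and \<open>s\<close> differ, and exchanging
  \<open>yv s\<close> for \<open>xv s\<close> uncovers the edge \<open>{xv k, yv s}\<close>.\<close>

lemma exchange_set_least_cover:
  assumes "vertex_cover E W"
  shows "W \<inter> exchange_set E (least_cover W) = {}"
proof -
  have False if s: "s \<in> forced W" "xv s \<in> W"
    and D: "(least_cover W - {yv s}) \<union> {xv s} \<in> minimal_covers E" for s
  proof -
    obtain k where k: "xv k \<notin> W" "{xv k, yv s} \<in> E" using s by (auto simp: forced_def)
    then have "k \<in> forced W" using matching_edge by (auto simp: forced_def)
    moreover have "xv k \<in> (least_cover W - {yv s}) \<union> {xv s} \<or> yv s \<in> (least_cover W - {yv s}) \<union> {xv s}"
      using D k(2) by (intro vertex_cover_edge) (simp_all add: minimal_covers_def)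
    ultimately show False using k(1) s(2) by auto
  qed
  then show ?thesis by (auto simp: exchange_set_def)
qed

text \<open>The index set of \<open>C\<close> contains \<open>forced W\<close>. If it had a further
  element, the least one, \<open>s\<close>, could be exchanged, so \<open>xv s\<close> would be
  outside \<open>W\<close>; but then \<open>s\<close> would be forced by its matching edge.\<close>

lemma least_cover_unique:
  assumes C: "C \<in> minimal_covers E" "C \<subseteq> W" "W \<inter> exchange_set E C = {}"
  shows "C = least_cover W"
proof -
  have vcC: "vertex_cover E C" using C by (simp add: minimal_covers_def)
  then have W: "vertex_cover E W" using C(2) by (auto simp: vertex_cover_def)
  have "y_index C - forced W = {}"
  proof (rule ccontr)
    assume ne: "y_index C - forced W \<noteq> {}"
    define s where "s = Min (y_index C - forced W)"
    have s: "yv s \<in> C" "s \<notin> forced W"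
      using Min_in[OF _ ne] by (auto simp: s_def y_index_def)
    have smin: "s \<le> i" if "yv i \<in> C" "i \<notin> forced W" for i
      using that unfolding s_def by (intro Min_le) (auto simp: y_index_def)
    have "(C - {yv s}) \<union> {xv s} \<in> minimal_covers E"
    proof (rule minimal_coverI)
      have "e \<inter> ((C - {yv s}) \<union> {xv s}) \<noteq> {}" if e: "e \<in> E" for e
        using e
      proof (cases rule: edge_cases)
        case (1 i j)
        then show ?thesis using vcC e by (fastforce simp: vertex_cover_def)
      next
        case (2 i j)
        \<comment> \<open>Only edges at \<open>yv s\<close> can become uncovered. If
          \<open>xv i\<close> is missing from \<open>C\<close>, then \<open>yv i\<close> is in
          \<open>C\<close>, \<open>i\<close> is not forced because \<open>s\<close> is not, and
          \<open>i \<le> s\<close> by condition (iii); the minimality of \<open>s\<close> leaves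
          \<open>i = s\<close>.\<close>
        have "xv i \<in> C \<or> i = s" if "j = s"
        proof (rule ccontr)
          assume i: "\<not> (xv i \<in> C \<or> i = s)"
          then have "yv i \<in> C" using minimal_cover_exclusive[OF C(1)] by blast
          moreover have "i \<notin> forced W" using s(2) xy_trans 2 e that by (auto simp: forced_def)
          moreover have "i \<le> s" using edge_xy_le 2 e that by blast
          ultimately show False using smin i by force
        qed
        then show ?thesis using vcC e 2 vertex_cover_edge[OF vcC, of "xv i" "yv j"] by auto
      qed
      then show "vertex_cover E ((C - {yv s}) \<union> {xv s})" by (simp add: vertex_cover_def)
    qed (use minimal_cover_exclusive[OF C(1)] in auto)
    then have "xv s \<in> exchange_set E C" using s by (auto simp: exchange_set_def)
    then have "xv s \<notin> W" using C(3) by blast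
    then show False using s(2) matching_edge by (auto simp: forced_def)
  qed
  then have "y_index C = forced W" using forced_least[OF C(1,2)] by blast
  then show ?thesis using y_index_inj[OF C(1) least_cover_minimal[OF W]] by simp
qed

text \<open>The fibres of \<open>least_cover\<close> are Boolean intervals; this is the form in
  which the covers are counted below.\<close>

lemma least_cover_eq_iff:
  assumes "C \<in> minimal_covers E"
  shows "vertex_cover E W \<and> least_cover W = C \<longleftrightarrow> C \<subseteq> W \<and> W \<inter> exchange_set E C = {}"
proof
  assume "vertex_cover E W \<and> least_cover W = C"
  then show "C \<subseteq> W \<and> W \<inter> exchange_set E C = {}"
    using least_cover_subset exchange_set_least_cover by metis
next
  assume W: "C \<subseteq> W \<and> W \<inter> exchange_set E C = {}"
  have "vertex_cover E C" using assms by (simp add: minimal_covers_def)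
  then have "vertex_cover E W" using W monoD[OF vertex_cover_mono, of C W E] by simp
  then show "vertex_cover E W \<and> least_cover W = C"
    using W least_cover_unique[OF assms] by metis
qed

text \<open>By \<open>single_times_in_supp_ideal_iff\<close> this computes the colon ideal of the
  covers in \<open>U\<close> by the monomial of \<open>C\<close>. The hypotheses hold if
  \<open>U\<close> consists of the covers preceding \<open>C\<close> in an order that refines
  inclusion of index sets. If \<open>A\<close> avoids the exchange set, then \<open>C\<close> is the
  least cover inside \<open>C \<union> A\<close>, so any \<open>D\<close> in \<open>U\<close> inside
  that set would have a larger index set or be \<open>C\<close> itself.\<close>

lemma linear_quotient:
  assumes C: "C \<in> minimal_covers E" and U: "U \<subseteq> minimal_covers E" "C \<notin> U"
    and below: "\<And>D. D \<in> minimal_covers E \<Longrightarrow> y_index D \<subset> y_index C \<Longrightarrow> D \<in> U"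
    and above: "\<And>D. D \<in> U \<Longrightarrow> \<not> y_index C \<subset> y_index D"
  shows "(\<exists>D\<in>U. D \<subseteq> C \<union> A) \<longleftrightarrow> A \<inter> exchange_set E C \<noteq> {}"
proof
  assume "\<exists>D\<in>U. D \<subseteq> C \<union> A"
  then obtain D where D: "D \<in> U" "D \<subseteq> C \<union> A" by blast
  show "A \<inter> exchange_set E C \<noteq> {}"
  proof
    assume "A \<inter> exchange_set E C = {}"
    moreover have "C \<inter> exchange_set E C = {}"
      using minimal_cover_exclusive[OF C] by (auto simp: exchange_set_def)
    ultimately have "C = least_cover (C \<union> A)" by (intro least_cover_unique[OF C]) auto
    then have "y_index C \<subseteq> y_index D" using forced_least[of D "C \<union> A"] D U(1)
      by (metis subsetD y_index_least_cover)
    then have "y_index C = y_index D" using above[OF D(1)] by blast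
    then show False using y_index_inj[OF C] U D by blast
  qed
next
  assume "A \<inter> exchange_set E C \<noteq> {}"
  then obtain s where s: "xv s \<in> A" "yv s \<in> C" "(C - {yv s}) \<union> {xv s} \<in> minimal_covers E"
    by (auto simp: exchange_set_def)
  moreover have "y_index ((C - {yv s}) \<union> {xv s}) \<subset> y_index C"
    using s(2) by (auto simp: y_index_def)
  ultimately show "\<exists>D\<in>U. D \<subseteq> C \<union> A"
    by (intro bexI[of _ "(C - {yv s}) \<union> {xv s}"] below) auto
qed

end

section \<open>Counting edges\<close>

definition alt_square :: "nat \<Rightarrow> nat \<Rightarrow> real" where
  "alt_square N k = (\<Sum>i=0..k. (-1) ^ i * real (k choose i) * (real N + real i) ^ 2)"

text \<open>Pascal's rule, mirroring
  \<open>t^N (1 - t)^(k+1) = t^N (1 - t)^k - t^(N+1) (1 - t)^k\<close>.\<close>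

lemma alt_square_Suc: "alt_square N (Suc k) = alt_square N k - alt_square (Suc N) k"
proof -
  have "alt_square N (Suc k) = (real N)^2 + (\<Sum>i=0..k. (-1) ^ Suc i * real (Suc k choose Suc i) * (real N + real (Suc i)) ^ 2)"
    unfolding alt_square_def by (subst sum.atLeast0_atMost_Suc_shift) simp
  also have "(\<Sum>i=0..k. (-1) ^ Suc i * real (Suc k choose Suc i) * (real N + real (Suc i)) ^ 2)
     = (\<Sum>i=0..k. (-1) ^ Suc i * real (k choose Suc i) * (real N + real (Suc i)) ^ 2) - alt_square (Suc N) k"
    unfolding alt_square_def sum_subtractf[symmetric]
    by (rule sum.cong) (auto simp: algebra_simps)
  also have "(real N)^2 + ((\<Sum>i=0..k. (-1) ^ Suc i * real (k choose Suc i) * (real N + real (Suc i)) ^ 2) - alt_square (Suc N) k)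
     = (\<Sum>i=0..Suc k. (-1) ^ i * real (k choose i) * (real N + real i) ^ 2) - alt_square (Suc N) k"
    by (subst sum.atLeast0_atMost_Suc_shift) simp
  also have "\<dots> = alt_square N k - alt_square (Suc N) k" by (simp add: alt_square_def)
  finally show ?thesis .
qed

lemma alt_square_0: "alt_square N 0 = (real N)^2"
  by (simp add: alt_square_def)

text \<open>Up to sign \<open>alt_square N k\<close> is the \<open>k\<close>-th finite difference of
  the square function at \<open>N\<close>: the second difference is constant and all higher ones
  vanish.\<close>

lemma alt_square_2: "alt_square N 2 = 2"
  by (simp add: numeral_2_eq_2 alt_square_Suc alt_square_0 power2_eq_square algebra_simps)

lemma alt_square_ge_3: "k \<ge> 3 \<Longrightarrow> alt_square N k = 0"
proof (induction k arbitrary: N rule: nat_induct_at_least)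
  case base
  have "alt_square N (Suc 2) = 0" by (simp only: alt_square_Suc alt_square_2)
  then show ?case by simp
next
  case (Suc k)
  then show ?case by (simp add: alt_square_Suc)
qed

text \<open>Summing \<open>t\<^sup>N (1 - t)\<^sup>k\<close> over the sizes of the sets in a Boolean interval
  telescopes, and \<^term>\<open>alt_square N k\<close> is the value of \<open>(t d/dt)\<^sup>2\<close> of that polynomial at 1.\<close>

lemma sum_alt_square_Pow:
  assumes "finite L"
  shows "(\<Sum>U\<in>Pow L. alt_square (N + card U) (k + (card L - card U))) = alt_square N k"
  using assms
proof (induction arbitrary: N k rule: finite_induct)
  case (insert v L)
  have fin: "finite U" if "U \<subseteq> L" for U using that insert finite_subset by blast
  have "(\<Sum>U\<in>Pow (insert v L). alt_square (N + card U) (k + (card (insert v L) - card U)))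
     = (\<Sum>U\<in>Pow L. alt_square (N + card U) (k + (Suc (card L) - card U)))
       + (\<Sum>U\<in>insert v ` Pow L. alt_square (N + card U) (k + (Suc (card L) - card U)))"
    using insert by (subst Pow_insert, subst sum.union_disjoint) auto
  also have "(\<Sum>U\<in>insert v ` Pow L. alt_square (N + card U) (k + (Suc (card L) - card U)))
     = (\<Sum>U\<in>Pow L. alt_square (Suc N + card U) (k + (card L - card U)))"
  proof (subst sum.reindex)
    show "inj_on (insert v) (Pow L)"
      using insert(2) by (intro inj_onI) (metis Diff_insert_absorb PowD subsetD)
  qed (use insert fin in \<open>auto simp: card_insert_if subset_eq intro!: sum.cong\<close>)
  also have "(\<Sum>U\<in>Pow L. alt_square (N + card U) (k + (Suc (card L) - card U)))
     = (\<Sum>U\<in>Pow L. alt_square (N + card U) (Suc k + (card L - card U)))"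
    using insert by (intro sum.cong) (auto simp: Suc_diff_le card_mono)
  finally show ?case using insert by (simp only: insert.IH alt_square_Suc[of N k])
qed simp

text \<open>The weight of \<open>W\<close> stands for
  \<open>t^card W (1 - t)^(CARD('v) - card W)\<close>, the probability of \<open>W\<close> when each
  vertex is drawn independently with probability \<open>t\<close>. The event of containing
  \<open>C\<close> and avoiding \<open>Z\<close> has probability
  \<open>t^card C (1 - t)^card Z\<close>.\<close>

lemma sum_alt_square_interval:
  fixes C Z :: "'v::finite set"
  assumes "C \<inter> Z = {}"
  shows "(\<Sum>W\<in>{W. C \<subseteq> W \<and> W \<inter> Z = {}}. alt_square (card W) (CARD('v) - card W))
    = alt_square (card C) (card Z)"
proof -
  define L where "L = UNIV - C - Z"
  have L: "card C + card Z + card L = CARD('v)"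
  proof -
    have "card L = CARD('v) - card (C \<union> Z)"
      by (subst card_Diff_subset[symmetric]) (auto simp: L_def Diff_eq Int_assoc)
    moreover have "card (C \<union> Z) \<le> CARD('v)" by (intro card_mono) auto
    ultimately show ?thesis using assms by (simp add: card_Un_disjoint)
  qed
  have "(\<Sum>W\<in>{W. C \<subseteq> W \<and> W \<inter> Z = {}}. alt_square (card W) (CARD('v) - card W))
     = (\<Sum>U\<in>Pow L. alt_square (card (C \<union> U)) (CARD('v) - card (C \<union> U)))"
    by (rule sum.reindex_bij_witness[of _ "\<lambda>U. C \<union> U" "\<lambda>W. W - C"])
      (use assms in \<open>auto simp: L_def Un_absorb1\<close>)
  also have "\<dots> = (\<Sum>U\<in>Pow L. alt_square (card C + card U) (card Z + (card L - card U)))"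
  proof (rule sum.cong)
    fix U assume U: "U \<in> Pow L"
    then have "card (C \<union> U) = card C + card U"
      by (intro card_Un_disjoint) (auto simp: L_def)
    moreover have "card U \<le> card L" using U by (intro card_mono) auto
    ultimately show "alt_square (card (C \<union> U)) (CARD('v) - card (C \<union> U))
        = alt_square (card C + card U) (card Z + (card L - card U))"
      using L by (intro arg_cong2[of _ _ _ _ alt_square]) auto
  qed simp
  finally show ?thesis by (simp add: sum_alt_square_Pow)
qed

lemma noncover_compl:
  fixes E :: "'v::finite set set"
  assumes "simple_graph E" "\<not> vertex_cover E W"
  shows "card (- W) \<ge> 2" and "card (- W) = 2 \<Longrightarrow> - W \<in> E"
proof -
  obtain e where e: "e \<in> E" "e \<subseteq> - W" using assms(2) by (auto simp: vertex_cover_def)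
  have "card e = 2" using assms(1) e by (simp add: simple_graph_def)
  moreover have "card e \<le> card (- W)" using e by (intro card_mono) auto
  ultimately show "card (- W) \<ge> 2" by simp
  show "- W \<in> E" if "card (- W) = 2"
    using card_subset_eq[of "- W" e] e that \<open>card e = 2\<close> by auto
qed

lemma sum_alt_square_noncovers:
  fixes E :: "'v::finite set set"
  assumes "simple_graph E"
  shows "(\<Sum>W\<in>{W. \<not> vertex_cover E W}. alt_square (card W) (CARD('v) - card W)) = 2 * real (card E)"
proof -
  have compl: "CARD('v) - card W = card (- W)" for W :: "'v set"
    by (simp add: Compl_eq_Diff_UNIV card_Diff_subset)
  note ge2 = noncover_compl(1)[OF assms] and eq2 = noncover_compl(2)[OF assms]
  have "(\<Sum>W\<in>{W. \<not> vertex_cover E W}. alt_square (card W) (CARD('v) - card W))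
    = (\<Sum>W\<in>uminus ` E. alt_square (card W) (CARD('v) - card W))"
  proof (rule sum.mono_neutral_right)
    show "uminus ` E \<subseteq> {W. \<not> vertex_cover E W}" by (auto simp: vertex_cover_def)
    show "\<forall>W\<in>{W. \<not> vertex_cover E W} - uminus ` E. alt_square (card W) (CARD('v) - card W) = 0"
    proof
      fix W assume W: "W \<in> {W. \<not> vertex_cover E W} - uminus ` E"
      then have "card (- W) \<noteq> 2" using eq2[of W] by (auto simp: image_iff)
      then show "alt_square (card W) (CARD('v) - card W) = 0"
        using ge2[of W] W by (intro alt_square_ge_3) (auto simp: compl)
    qed
  qed simp
  also have "\<dots> = (\<Sum>e\<in>E. 2)"
    using assms by (subst sum.reindex)
      (auto simp: compl alt_square_2 simple_graph_def inj_on_def intro!: sum.cong)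
  finally show ?thesis by simp
qed

context standard_graph
begin

lemma exchange_disjoint:
  assumes "C \<in> minimal_covers E"
  shows "C \<inter> exchange_set E C = {}"
  using minimal_cover_exclusive[OF assms] by (auto simp: exchange_set_def)

theorem card_edges:
  "real (card E) = 1 / 2 * (\<Sum>C\<in>minimal_covers E. \<Sum>i=0..card (exchange_set E C).
      (-1) ^ (i + 1) * real (card (exchange_set E C) choose i) * (real CARD('n) + real i) ^ 2)"
proof -
  let ?a = "\<lambda>W :: ('n + 'n) set. alt_square (card W) (CARD('n + 'n) - card W)"
  \<comment> \<open>All subsets of the vertex set form the interval with \<open>C = Z = {}\<close>,
    of weight \<open>alt_square 0 0 = 0\<close>. So the covers and the other sets cancel.\<close>
  have "0 = (\<Sum>W\<in>UNIV. ?a W)"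
    using sum_alt_square_interval[of "{}" "{} :: ('n + 'n) set"]
    by (simp del: card_sum add: alt_square_0)
  also have "\<dots> = (\<Sum>W\<in>{W. vertex_cover E W}. ?a W) + (\<Sum>W\<in>{W. \<not> vertex_cover E W}. ?a W)"
    by (subst sum.union_disjoint[symmetric]) (auto intro!: sum.cong)
  also have "(\<Sum>W\<in>{W. vertex_cover E W}. ?a W)
     = (\<Sum>C\<in>minimal_covers E. \<Sum>W | W \<in> {W. vertex_cover E W} \<and> least_cover W = C. ?a W)"
    using least_cover_minimal by (intro sum.group[symmetric]) auto
  also have "\<dots> = (\<Sum>C\<in>minimal_covers E. alt_square CARD('n) (card (exchange_set E C)))"
    using sum_alt_square_interval[OF exchange_disjoint]
    by (intro sum.cong) (simp_all add: least_cover_eq_iff card_minimal_cover)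
  finally have "2 * real (card E)
      = - (\<Sum>C\<in>minimal_covers E. alt_square CARD('n) (card (exchange_set E C)))"
    using sum_alt_square_noncovers[OF simple] by simp
  then show ?thesis
    by (simp add: alt_square_def sum_negf[symmetric])
qed

end

section \<open>Linear resolutions by iterated mapping cones\<close>

lemma sum_lessThan_add: "(\<Sum>k<c + c'. f k) = (\<Sum>k<c. f k) + (\<Sum>k<c'. f (c + k :: nat) :: 'a::comm_monoid_add)"
  by (induction c') (auto simp: add.assoc)

lemma matrix_map_in_free [simp]: "matrix_map r c A v \<in> free_module r"
  by (simp add: matrix_map_def free_module_def)

lemma matrix_map_add:
  "matrix_map r c A (\<lambda>k. v k + w k) = (\<lambda>j. matrix_map r c A v j + matrix_map r c A w j)"
  by (auto simp: matrix_map_def algebra_simps sum.distrib)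

lemma matrix_map_diff:
  "matrix_map r c A (\<lambda>k. v k - w k) = (\<lambda>j. matrix_map r c A v j - matrix_map r c A w j)"
  by (auto simp: matrix_map_def algebra_simps sum_subtractf)

lemma matrix_map_0 [simp]: "matrix_map r c A (\<lambda>_. 0) = (\<lambda>_. 0)"
  by (auto simp: matrix_map_def)

lemma matrix_map_comp:
  "matrix_map r c A (matrix_map c s B y) = matrix_map r s (\<lambda>j l. \<Sum>k<c. A j k * B k l) y"
proof (rule HOL.ext)
  fix j
  have "(\<Sum>k<c. A j k * (\<Sum>l<s. B k l * y l)) = (\<Sum>l<s. (\<Sum>k<c. A j k * B k l) * y l)"
    by (simp add: sum_distrib_left sum_distrib_right mult.assoc) (rule sum.swap)
  then show "matrix_map r c A (matrix_map c s B y) j = matrix_map r s (\<lambda>j l. \<Sum>k<c. A j k * B k l) y j"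
    by (simp add: matrix_map_def)
qed

lemma matrix_map_restrict: "matrix_map r c A (\<lambda>k. if k < c then y k else 0) = matrix_map r c A y"
  unfolding matrix_map_def by (intro HOL.ext if_cong sum.cong) auto

lemma matrix_map_unit:
  "k < c \<Longrightarrow> matrix_map r c A (\<lambda>l. if l = k then 1 else 0) = (\<lambda>j. if j < r then A j k else 0)"
  unfolding matrix_map_def by (intro HOL.ext if_cong) (simp_all add: mult_delta_right)

lemma matrix_map_cong:
  "(\<And>j k. j < r \<Longrightarrow> k < c \<Longrightarrow> A j k = B j k) \<Longrightarrow> matrix_map r c A = matrix_map r c B"
  unfolding matrix_map_def by (intro HOL.ext) simp

definition vec_append :: "nat \<Rightarrow> (nat \<Rightarrow> 'a) \<Rightarrow> (nat \<Rightarrow> 'a) \<Rightarrow> nat \<Rightarrow> 'a" where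
  "vec_append r x y = (\<lambda>j. if j < r then x j else y (j - r))"

text \<open>The shape of a mapping cone differential: block upper triangular, with the comparison
  map \<open>P\<close> in the corner.\<close>

definition block_matrix ::
    "nat \<Rightarrow> nat \<Rightarrow> (nat \<Rightarrow> nat \<Rightarrow> 'a::zero) \<Rightarrow> (nat \<Rightarrow> nat \<Rightarrow> 'a) \<Rightarrow> (nat \<Rightarrow> nat \<Rightarrow> 'a) \<Rightarrow> nat \<Rightarrow> nat \<Rightarrow> 'a" where
  "block_matrix r c A P B = (\<lambda>j k. if j < r then (if k < c then A j k else P j (k - c))
     else (if k < c then 0 else B (j - r) (k - c)))"

lemma matrix_map_block:
  "matrix_map (r + r') (c + c') (block_matrix r c A P B) (vec_append c x y)
    = vec_append r (\<lambda>j. matrix_map r c A x j + matrix_map r c' P y j) (matrix_map r' c' B y)"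
  by (rule HOL.ext) (simp add: matrix_map_def vec_append_def block_matrix_def sum_lessThan_add less_diff_conv2)

lemma vec_append_in_free: "y \<in> free_module c' \<Longrightarrow> vec_append c x y \<in> free_module (c + c')"
  by (auto simp: free_module_def vec_append_def)

lemma free_module_add_cases:
  assumes "v \<in> free_module (c + c')"
  obtains x y where "x \<in> free_module c" "y \<in> free_module c'" "v = vec_append c x y"
proof
  show "(\<lambda>j. if j < c then v j else 0) \<in> free_module c" "(\<lambda>j. v (c + j)) \<in> free_module c'"
    using assms by (auto simp: free_module_def)
qed (auto simp: vec_append_def)

lemma vec_append_eq_iff:
  assumes "x \<in> free_module c" "x' \<in> free_module c"
  shows "vec_append c x y = vec_append c x' y' \<longleftrightarrow> x = x' \<and> y = y'"
proof
  assume eq: "vec_append c x y = vec_append c x' y'"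
  have "x j = x' j" for j
    using fun_cong[OF eq, of j] assms by (cases "j < c") (auto simp: vec_append_def free_module_def)
  moreover have "y j = y' j" for j
    using fun_cong[OF eq, of "c + j"] by (simp add: vec_append_def)
  ultimately show "x = x' \<and> y = y'" by blast
qed simp

lemma vec_append_0 [simp]: "vec_append c (\<lambda>_. 0) (\<lambda>_. 0) = (\<lambda>_. 0)"
  by (auto simp: vec_append_def)

section \<open>Homogeneous polynomials and graded lifting\<close>

lemma homogeneous_0 [simp]: "homogeneous t 0"
  by (simp add: homogeneous_def)

lemma homogeneous_add: "homogeneous t f \<Longrightarrow> homogeneous t g \<Longrightarrow> homogeneous t (f + g)"
  using Poly_Mapping.keys_add[of f g] unfolding homogeneous_def by blast

lemma homogeneous_diff: "homogeneous t f \<Longrightarrow> homogeneous t g \<Longrightarrow> homogeneous t (f - g)"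
  using keys_diff_subset[of f g] unfolding homogeneous_def by blast

lemma homogeneous_uminus: "homogeneous t f \<Longrightarrow> homogeneous t (- f)"
  using homogeneous_diff[of t 0 f] by simp

lemma homogeneous_sum: "(\<And>i. i \<in> A \<Longrightarrow> homogeneous t (f i)) \<Longrightarrow> homogeneous t (sum f A)"
  by (induction A rule: infinite_finite_induct) (auto intro: homogeneous_add)

lemma homogeneous_times:
  fixes f g :: "('v::finite, 'k::field) mpoly"
  shows "homogeneous s f \<Longrightarrow> homogeneous t g \<Longrightarrow> homogeneous (s + t) (f * g)"
  using keys_mult[of f g] unfolding homogeneous_def by (fastforce simp: mdeg_add)

lemma homogeneous_part_exists:
  fixes f :: "('v::finite, 'k::field) mpoly"
  shows "\<exists>g. homogeneous b g \<and> (\<forall>m\<in>keys (f - g). mdeg m \<noteq> b)"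
proof (intro exI conjI)
  let ?g = "\<Sum>m | m \<in> keys f \<and> mdeg m = b. single m (lookup f m)"
  show "homogeneous b ?g" by (rule homogeneous_sum) (auto simp: homogeneous_def)
  have "f - ?g = (\<Sum>m | m \<in> keys f \<and> mdeg m \<noteq> b. single m (lookup f m))"
  proof -
    have "f = (\<Sum>m\<in>keys f. single m (lookup f m))" by (rule poly_mapping_expand)
    also have "\<dots> = (\<Sum>m | m \<in> keys f \<and> mdeg m \<noteq> b. single m (lookup f m)) + ?g"
      by (subst sum.union_disjoint[symmetric]) (auto intro!: sum.cong)
    finally show ?thesis unfolding diff_eq_eq .
  qed
  then show "\<forall>m\<in>keys (f - ?g). mdeg m \<noteq> b"
    using keys_sum[of "\<lambda>m. single m (lookup f m)"] by (auto split: if_splits dest!: subsetD)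
qed

text \<open>The component of degree \<open>b\<close> of any preimage is again a preimage, because
  the other components contribute only in degrees different from \<open>a + b\<close>. This keeps
  the comparison maps of a mapping cone homogeneous.\<close>

lemma homogeneous_lift:
  fixes A :: "nat \<Rightarrow> nat \<Rightarrow> ('v::finite, 'k::field) mpoly"
  assumes A: "\<And>j k. j < r \<Longrightarrow> k < c \<Longrightarrow> homogeneous a (A j k)"
    and v: "matrix_map r c A v = w"
    and w: "\<And>j. j < r \<Longrightarrow> homogeneous (a + b) (w j)"
  shows "\<exists>v'\<in>free_module c. (\<forall>k. homogeneous b (v' k)) \<and> matrix_map r c A v' = w"
proof -
  have "\<exists>h. \<forall>k. homogeneous b (h k) \<and> (\<forall>m\<in>keys (v k - h k). mdeg m \<noteq> b)"
    using homogeneous_part_exists by (intro choice allI)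
  then obtain h where h: "\<And>k. homogeneous b (h k)" "\<And>k. \<forall>m\<in>keys (v k - h k). mdeg m \<noteq> b"
    by blast
  define v' where "v' = (\<lambda>k. if k < c then h k else 0)"
  have "w j = matrix_map r c A v' j" if j: "j < r" for j
  proof -
    define g where "g = w j - matrix_map r c A v' j"
    have "homogeneous (a + b) (matrix_map r c A v' j)"
      using A h(1) by (auto simp: matrix_map_def v'_def intro!: homogeneous_sum homogeneous_times)
    then have g1: "homogeneous (a + b) g" unfolding g_def using w j by (intro homogeneous_diff)
    have "g = (\<Sum>k<c. A j k * (v k - h k))"
      using j unfolding g_def v[symmetric] by (simp add: matrix_map_def v'_def algebra_simps sum_subtractf)
    moreover have "mdeg m \<noteq> a + b" if m: "m \<in> keys (\<Sum>k<c. A j k * (v k - h k))" for m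
    proof -
      obtain k where k: "k < c" "m \<in> keys (A j k * (v k - h k))"
        using subsetD[OF keys_sum m] by blast
      then obtain m1 m2 where "m = m1 + m2" "m1 \<in> keys (A j k)" "m2 \<in> keys (v k - h k)"
        using keys_mult[of "A j k" "v k - h k"] by blast
      then show ?thesis using A[OF j k(1)] h(2)[of k] by (auto simp: homogeneous_def mdeg_add)
    qed
    ultimately have "keys g = {}" using g1 unfolding homogeneous_def by blast
    then show ?thesis by (simp add: g_def)
  qed
  then have "matrix_map r c A v' = w"
    using v[symmetric] by (auto simp: matrix_map_def)
  then show ?thesis using h by (intro bexI[of _ v']) (auto simp: v'_def free_module_def)
qed

text \<open>A resolution of the quotient by an ideal generated in degree \<open>D\<close>, with
  linear entries in all later maps. For \<open>D > 0\<close> every nonzero entry has positive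
  degree, so minimality is automatic.\<close>

definition linear_resolution ::
    "('v, 'k::field) mpoly set \<Rightarrow> nat \<Rightarrow> (nat \<Rightarrow> nat) \<Rightarrow> (nat \<Rightarrow> nat \<Rightarrow> nat \<Rightarrow> ('v, 'k) mpoly) \<Rightarrow> bool" where
  "linear_resolution I D r d \<longleftrightarrow>
     (\<exists>p. \<forall>i>p. r i = 0) \<and> r 0 = 1 \<and>
     (\<forall>i. \<forall>j<r i. \<forall>k<r (Suc i). homogeneous (if i = 0 then D else 1) (d i j k)) \<and>
     {v \<in> free_module 1. v 0 \<in> I} = matrix_map 1 (r 1) (d 0) ` free_module (r 1) \<and>
     (\<forall>i. {v \<in> free_module (r (Suc i)). matrix_map (r i) (r (Suc i)) (d i) v = (\<lambda>_. 0)}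
       = matrix_map (r (Suc i)) (r (Suc (Suc i))) (d (Suc i)) ` free_module (r (Suc (Suc i))))"

lemma linear_resolution_zero: "linear_resolution {0} D (\<lambda>i. if i = 0 then 1 else 0) (\<lambda>_ _ _. 0)"
  by (auto simp: linear_resolution_def free_module_def matrix_map_def image_def fun_eq_iff not_less_eq_eq
      intro!: exI[of _ 0] exI[of _ "\<lambda>_. 0"])

text \<open>Multiplication by \<open>u\<close> embeds the quotient by the colon ideal
  \<open>{f. u * f \<in> J}\<close> into the quotient by \<open>J\<close>, and the cokernel is the
  quotient by the enlarged ideal. So the cone of a lift to the resolutions resolves that cokernel.
  The lift has entries of degree \<open>D\<close> in step 0 and of degree 1 afterwards, which keeps
  the cone linear.\<close>

lemma mapping_cone:
  fixes J :: "('v::finite, 'k::field) mpoly set"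
  assumes J: "ideal J polyring" and F: "linear_resolution J D r d"
    and K: "linear_resolution {f. u * f \<in> J} 1 s e" and u: "homogeneous D u"
  shows "\<exists>r d. linear_resolution {f + u * g | f g. f \<in> J} D r d"
proof -
  define dF where "dF i = matrix_map (r i) (r (Suc i)) (d i)" for i
  define dK where "dK i = matrix_map (s i) (s (Suc i)) (e i)" for i
  have F0: "r 0 = 1" and Fhom: "\<And>i j k. j < r i \<Longrightarrow> k < r (Suc i) \<Longrightarrow> homogeneous (if i = 0 then D else 1) (d i j k)"
    and Fim: "{v \<in> free_module 1. v 0 \<in> J} = dF 0 ` free_module (r 1)"
    and Fex: "\<And>i. {v \<in> free_module (r (Suc i)). dF i v = (\<lambda>_. 0)} = dF (Suc i) ` free_module (r (Suc (Suc i)))"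
    using F by (auto simp: linear_resolution_def dF_def)
  have Khom: "\<And>i j k. j < s i \<Longrightarrow> k < s (Suc i) \<Longrightarrow> homogeneous 1 (e i j k)"
    using K by (simp add: linear_resolution_def del: One_nat_def)
  have K0: "s 0 = 1" and Kim: "{v \<in> free_module 1. u * v 0 \<in> J} = dK 0 ` free_module (s 1)"
    and Kex: "\<And>i. {v \<in> free_module (s (Suc i)). dK i v = (\<lambda>_. 0)} = dK (Suc i) ` free_module (s (Suc (Suc i)))"
    using K by (auto simp: linear_resolution_def dK_def)
  obtain p q where p: "\<And>i. i > p \<Longrightarrow> r i = 0" and q: "\<And>i. i > q \<Longrightarrow> s i = 0"
    using F K by (auto simp: linear_resolution_def)
  have [simp]: "dF i v \<in> free_module (r i)" "dK i w \<in> free_module (s i)" for i v w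
    by (simp_all add: dF_def dK_def)

  \<comment> \<open>\<open>good\<close> is what the next lifting step requires: the composite with
    the differential of \<open>K\<close> consists of boundaries of \<open>F\<close>.
    \<open>compat\<close> has the sign of the cone built in, so the block matrices carry no
    signs.\<close>
  define good where "good i P \<longleftrightarrow>
      (\<forall>j<r i. \<forall>k<s i. homogeneous (if i = 0 then D else 1) (P j k)) \<and>
      (\<forall>y. matrix_map (r i) (s i) P (dK i y) \<in> dF i ` free_module (r (Suc i))) \<and>
      (i = 0 \<longrightarrow> P = (\<lambda>_ _. u))" for i P
  define compat where "compat i P P' \<longleftrightarrow>
      (\<forall>y. dF i (matrix_map (r (Suc i)) (s (Suc i)) P' y) = (\<lambda>j. - matrix_map (r i) (s i) P (dK i y) j))" for i P P'
  have "\<exists>P. \<forall>i. good i (P i) \<and> compat i (P i) (P (Suc i))"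
  proof (rule dependent_nat_choice)
    have "matrix_map (r 0) (s 0) (\<lambda>_ _. u) (dK 0 y) \<in> dF 0 ` free_module (r 1)" for y
    proof -
      \<comment> \<open>\<open>Kim\<close> speaks of vectors in the free module only;
        \<open>matrix_map\<close> ignores the entries removed here.\<close>
      define y' where "y' = (\<lambda>k. if k < s 1 then y k else 0)"
      have "dK 0 y' = dK 0 y" "y' \<in> free_module (s 1)"
        by (simp_all add: dK_def matrix_map_restrict y'_def free_module_def)
      then have "u * dK 0 y 0 \<in> J" using Kim by (metis (mono_tags, lifting) imageI mem_Collect_eq)
      then have "matrix_map (r 0) (s 0) (\<lambda>_ _. u) (dK 0 y) \<in> {v \<in> free_module 1. v 0 \<in> J}"
        using F0 K0 by (simp add: matrix_map_def free_module_def)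
      then show ?thesis unfolding Fim .
    qed
    then show "\<exists>P. good 0 P" using u by (intro exI[of _ "\<lambda>_ _. u"]) (simp add: good_def)
  next
    fix P i assume P: "good i P"
    have "\<exists>v\<in>free_module (r (Suc i)). (\<forall>j. homogeneous 1 (v j)) \<and>
        dF i v = matrix_map (r i) (s i) P (\<lambda>j. if j < s i then e i j k else 0)" if k: "k < s (Suc i)" for k
    proof -
      let ?w = "matrix_map (r i) (s i) P (\<lambda>j. if j < s i then e i j k else 0)"
      have "(\<lambda>j. if j < s i then e i j k else 0) = dK i (\<lambda>l. if l = k then 1 else 0)"
        using k by (simp add: dK_def matrix_map_unit)
      moreover have "matrix_map (r i) (s i) P (dK i (\<lambda>l. if l = k then 1 else 0)) \<in> dF i ` free_module (r (Suc i))"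
        using P unfolding good_def by blast
      ultimately obtain v where v: "dF i v = ?w" by auto
      show ?thesis unfolding dF_def
      proof (rule homogeneous_lift)
        show "homogeneous ((if i = 0 then D else 1) + 1) (?w j)" if "j < r i" for j
        proof -
          have "homogeneous ((if i = 0 then D else 1) + 1) (P j l * e i l k)" if "l < s i" for l
            using \<open>j < r i\<close> P that Khom k unfolding good_def by (intro homogeneous_times) blast+
          then show ?thesis
            using that unfolding matrix_map_def by (auto intro!: homogeneous_sum)
        qed
        show "homogeneous (if i = 0 then D else 1) (d i j k)" if "j < r i" "k < r (Suc i)" for j k
          using Fhom that .
        show "matrix_map (r i) (r (Suc i)) (d i) v = ?w" using v by (simp add: dF_def)
      qed
    qed
    then obtain V where "\<forall>k\<in>{..<s (Suc i)}. V k \<in> free_module (r (Suc i)) \<and> (\<forall>j. homogeneous 1 (V k j)) \<and>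
        dF i (V k) = matrix_map (r i) (s i) P (\<lambda>j. if j < s i then e i j k else 0)"
      using bchoice[of "{..<s (Suc i)}" "\<lambda>k v. v \<in> free_module (r (Suc i)) \<and> (\<forall>j. homogeneous 1 (v j)) \<and>
        dF i v = matrix_map (r i) (s i) P (\<lambda>j. if j < s i then e i j k else 0)"] by blast
    then have V: "\<And>k. k < s (Suc i) \<Longrightarrow> V k \<in> free_module (r (Suc i))"
      "\<And>k j. k < s (Suc i) \<Longrightarrow> homogeneous 1 (V k j)"
      "\<And>k. k < s (Suc i) \<Longrightarrow> dF i (V k) = matrix_map (r i) (s i) P (\<lambda>j. if j < s i then e i j k else 0)"
      by blast+
    define P' where "P' j k = - V k j" for j k
    have compat: "compat i P P'"
      unfolding compat_def
    proof
      fix y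
      have "dF i (matrix_map (r (Suc i)) (s (Suc i)) P' y) = matrix_map (r i) (s (Suc i)) (\<lambda>j l. - (\<Sum>k<s i. P j k * e i k l)) y"
        unfolding dF_def matrix_map_comp
      proof (rule fun_cong[of _ _ y], rule matrix_map_cong)
        fix j k assume jk: "j < r i" "k < s (Suc i)"
        have "(\<Sum>l<r (Suc i). d i j l * V k l) = (\<Sum>l<s i. P j l * e i l k)"
          using fun_cong[OF V(3)[OF jk(2)], of j] jk by (simp add: dF_def matrix_map_def)
        then show "(\<Sum>l<r (Suc i). d i j l * P' l k) = - (\<Sum>l<s i. P j l * e i l k)"
          by (simp add: P'_def sum_negf)
      qed
      also have "\<dots> = (\<lambda>j. - matrix_map (r i) (s i) P (dK i y) j)"
        unfolding dK_def matrix_map_comp by (rule HOL.ext) (simp add: matrix_map_def sum_negf)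
      finally show "dF i (matrix_map (r (Suc i)) (s (Suc i)) P' y) = (\<lambda>j. - matrix_map (r i) (s i) P (dK i y) j)" .
    qed
    have "matrix_map (r (Suc i)) (s (Suc i)) P' (dK (Suc i) y) \<in> dF (Suc i) ` free_module (r (Suc (Suc i)))" for y
    proof -
      define y' where "y' = (\<lambda>k. if k < s (Suc (Suc i)) then y k else 0)"
      have "dK (Suc i) y' = dK (Suc i) y" "y' \<in> free_module (s (Suc (Suc i)))"
        by (simp_all add: dK_def matrix_map_restrict y'_def free_module_def)
      then have "dK i (dK (Suc i) y) = (\<lambda>_. 0)" using Kex[of i] by (metis (mono_tags, lifting) imageI mem_Collect_eq)
      then have "dF i (matrix_map (r (Suc i)) (s (Suc i)) P' (dK (Suc i) y)) = (\<lambda>_. 0)"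
        using compat by (simp add: compat_def)
      then show ?thesis unfolding Fex[of i, symmetric] by simp
    qed
    then have "good (Suc i) P'"
      using V(2) by (auto simp: good_def P'_def homogeneous_uminus)
    then show "\<exists>P'. good (Suc i) P' \<and> compat i P P'" using compat by blast
  qed
  then obtain P where good: "\<And>i. good i (P i)" and compat: "\<And>i. compat i (P i) (P (Suc i))" by blast
  define \<phi> where "\<phi> i = matrix_map (r i) (s i) (P i)" for i
  have \<phi>_chain: "dF i (\<phi> (Suc i) y) = (\<lambda>j. - \<phi> i (dK i y) j)" for i y
    using compat by (simp add: compat_def \<phi>_def)
  have \<phi>0: "\<phi> 0 y = (\<lambda>j. if j = 0 then u * y 0 else 0)" for y
    using good[of 0] F0 K0 by (auto simp: good_def \<phi>_def matrix_map_def)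

  \<comment> \<open>\<open>K\<close> enters the cone shifted by one step, with nothing in step
    0.\<close>
  define s' where "s' i = (case i of 0 \<Rightarrow> 0 | Suc i \<Rightarrow> s i)" for i
  define e' where "e' i = (case i of 0 \<Rightarrow> (\<lambda>_ _. 0) | Suc i \<Rightarrow> e i)" for i
  define dK' where "dK' i = matrix_map (s' i) (s i) (e' i)" for i
  define R where "R i = r i + s' i" for i
  define B where "B i = block_matrix (r i) (r (Suc i)) (d i) (P i) (e' i)" for i
  have s'_simps [simp]: "s' 0 = 0" "s' (Suc i) = s i" for i by (simp_all add: s'_def)
  have dK'_Suc: "dK' (Suc i) = dK i" for i by (simp add: dK'_def dK_def e'_def)
  have dK'_0: "dK' 0 y = (\<lambda>_. 0)" for y by (simp add: dK'_def matrix_map_def)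
  have B_app: "matrix_map (R i) (R (Suc i)) (B i) (vec_append (r (Suc i)) x y)
      = vec_append (r i) (\<lambda>j. dF i x j + \<phi> i y j) (dK' i y)" for i x y
    by (simp add: R_def B_def dF_def \<phi>_def dK'_def matrix_map_block)
  have dFdF: "dF i (dF (Suc i) x) = (\<lambda>_. 0)" if "x \<in> free_module (r (Suc (Suc i)))" for i x
    using Fex[of i] that by blast
  have dKdK: "dK' i (dK i y) = (\<lambda>_. 0)" if "y \<in> free_module (s (Suc i))" for i y
    using Kex that by (cases i) (auto simp: dK'_0 dK'_Suc)
  have lin: "\<phi> i (\<lambda>_. 0) = (\<lambda>_. 0)" for i by (simp add: \<phi>_def)

  have "linear_resolution {f + u * g | f g. f \<in> J} D R B"
    unfolding linear_resolution_def
  proof (intro conjI allI impI)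
    show "\<exists>t. \<forall>i>t. R i = 0"
    proof (intro exI allI impI)
      fix i assume "i > max p (Suc q)"
      then show "R i = 0" using p q by (cases i) (auto simp: R_def)
    qed
    show R0: "R 0 = 1" by (simp add: R_def F0)
    show "homogeneous (if i = 0 then D else 1) (B i j k)" if "j < R i" "k < R (Suc i)" for i j k
    proof (cases "j < r i")
      case True
      have "homogeneous (if i = 0 then D else 1) (P i j l)" if "l < s i" for l
        using good[of i] True that unfolding good_def by blast
      then show ?thesis using True that Fhom[of j i k] by (simp add: R_def B_def block_matrix_def)
    next
      case False
      then obtain n where "i = Suc n" using \<open>j < R i\<close> by (cases i) (auto simp: R_def)
      then show ?thesis using False that Khom[of "j - r i" n "k - r (Suc i)"]
        by (simp add: R_def B_def block_matrix_def e'_def)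
    qed
    show "{v \<in> free_module 1. v 0 \<in> {f + u * g |f g. f \<in> J}} = matrix_map 1 (R 1) (B 0) ` free_module (R 1)"
    proof (intro equalityI subsetI)
      fix v assume "v \<in> {v \<in> free_module 1. v 0 \<in> {f + u * g |f g. f \<in> J}}"
      then obtain f g where v: "v \<in> free_module 1" "v 0 = f + u * g" "f \<in> J" by blast
      have "(\<lambda>j. if j = 0 then f else 0) \<in> dF 0 ` free_module (r 1)"
        unfolding Fim[symmetric] using v by (simp add: free_module_def)
      then obtain x where x: "x \<in> free_module (r 1)" "dF 0 x = (\<lambda>j. if j = 0 then f else 0)" by force
      define y where "y = (\<lambda>j::nat. if j = 0 then g else 0)"
      have "y \<in> free_module (s 0)" using K0 by (simp add: y_def free_module_def)
      then have "vec_append (r 1) x y \<in> free_module (R 1)"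
        by (simp add: R_def vec_append_in_free)
      moreover have "matrix_map (R 0) (R (Suc 0)) (B 0) (vec_append (r (Suc 0)) x y) = v"
        unfolding B_app using x(2) F0 v by (auto simp: \<phi>0 dK'_0 vec_append_def y_def free_module_def)
      ultimately show "v \<in> matrix_map 1 (R 1) (B 0) ` free_module (R 1)"
        using R0 by (auto intro!: image_eqI)
    next
      fix v assume "v \<in> matrix_map 1 (R 1) (B 0) ` free_module (R 1)"
      then obtain z where z: "z \<in> free_module (R 1)" "v = matrix_map 1 (R 1) (B 0) z" by blast
      obtain x y where xy: "x \<in> free_module (r 1)" "y \<in> free_module (s 0)" "z = vec_append (r 1) x y"
        using z(1) by (auto simp: R_def elim: free_module_add_cases)
      have "v = vec_append (r 0) (\<lambda>j. dF 0 x j + \<phi> 0 y j) (dK' 0 y)"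
        using z xy B_app[of 0 x y] R0 by simp
      then have "v 0 = dF 0 x 0 + u * y 0" using F0 by (simp add: vec_append_def \<phi>0)
      moreover have "dF 0 x 0 \<in> J" using xy(1) Fim by blast
      ultimately show "v \<in> {v \<in> free_module 1. v 0 \<in> {f + u * g |f g. f \<in> J}}" using z by auto
    qed
    show "{v \<in> free_module (R (Suc i)). matrix_map (R i) (R (Suc i)) (B i) v = (\<lambda>_. 0)} =
         matrix_map (R (Suc i)) (R (Suc (Suc i))) (B (Suc i)) ` free_module (R (Suc (Suc i)))" for i
    proof (intro equalityI subsetI)
      fix v assume "v \<in> {v \<in> free_module (R (Suc i)). matrix_map (R i) (R (Suc i)) (B i) v = (\<lambda>_. 0)}"
      then have v: "v \<in> free_module (r (Suc i) + s i)" "matrix_map (R i) (R (Suc i)) (B i) v = (\<lambda>_. 0)"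
        by (simp_all add: R_def)
      obtain x y where xy: "x \<in> free_module (r (Suc i))" "y \<in> free_module (s i)" "v = vec_append (r (Suc i)) x y"
        using v(1) by (rule free_module_add_cases)
      have "vec_append (r i) (\<lambda>j. dF i x j + \<phi> i y j) (dK' i y) = vec_append (r i) (\<lambda>_. 0) (\<lambda>_. 0)"
        using v(2) unfolding xy(3) B_app by simp
      then have eqs: "(\<lambda>j. dF i x j + \<phi> i y j) = (\<lambda>_. 0)" "dK' i y = (\<lambda>_. 0)"
        by (subst (asm) vec_append_eq_iff; force simp: free_module_def dF_def \<phi>_def matrix_map_def)+
      \<comment> \<open>For \<open>i = 0\<close> there is no equation in \<open>K\<close>. Instead
        \<open>u * y 0\<close> is the negative of an element of \<open>J\<close>, so
        \<open>y 0\<close> lies in the colon ideal. For larger \<open>i\<close> the exactness of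
        \<open>K\<close> applies.\<close>
      have "y \<in> dK i ` free_module (s (Suc i))"
      proof (cases i)
        case 0
        have "dF 0 x 0 + u * y 0 = 0" using fun_cong[OF eqs(1), of 0] 0 by (simp add: \<phi>0)
        moreover have "dF 0 x 0 \<in> J" using xy(1) Fim 0 by auto
        ultimately have "u * y 0 \<in> J"
          using J unfolding ideal_polyring_iff by (metis add_eq_0_iff mult_minus1)
        then show ?thesis using Kim xy(2) 0 K0 by auto
      next
        case (Suc n)
        then show ?thesis using Kex[of n] eqs(2) xy(2) by (auto simp: dK'_Suc)
      qed
      then obtain z where z: "z \<in> free_module (s (Suc i))" "y = dK i z" by blast
      \<comment> \<open>Subtracting the boundary of \<open>z\<close> in the cone removes
        \<open>y\<close>; what remains of \<open>x\<close> is a cycle of \<open>F\<close>.\<close>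
      have "dF i (\<lambda>j. x j - \<phi> (Suc i) z j) = (\<lambda>j. dF i x j - dF i (\<phi> (Suc i) z) j)"
        by (simp add: dF_def matrix_map_diff)
      also have "\<dots> = (\<lambda>_. 0)" using eqs(1) unfolding \<phi>_chain z(2)[symmetric] by simp
      finally have "(\<lambda>j. x j - \<phi> (Suc i) z j) \<in> {v \<in> free_module (r (Suc i)). dF i v = (\<lambda>_. 0)}"
        using xy(1) by (simp add: free_module_def \<phi>_def matrix_map_def)
      then have "(\<lambda>j. x j - \<phi> (Suc i) z j) \<in> dF (Suc i) ` free_module (r (Suc (Suc i)))"
        unfolding Fex .
      then obtain x' where x': "(\<lambda>j. x j - \<phi> (Suc i) z j) = dF (Suc i) x'" "x' \<in> free_module (r (Suc (Suc i)))"
        by (rule imageE)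
      have "matrix_map (R (Suc i)) (R (Suc (Suc i))) (B (Suc i)) (vec_append (r (Suc (Suc i))) x' z) = v"
        unfolding B_app xy(3) by (simp add: x'(1)[symmetric] dK'_Suc z(2))
      moreover have "vec_append (r (Suc (Suc i))) x' z \<in> free_module (R (Suc (Suc i)))"
        using z(1) by (simp add: R_def vec_append_in_free)
      ultimately show "v \<in> matrix_map (R (Suc i)) (R (Suc (Suc i))) (B (Suc i)) ` free_module (R (Suc (Suc i)))"
        by (auto intro!: image_eqI)
    next
      fix v assume "v \<in> matrix_map (R (Suc i)) (R (Suc (Suc i))) (B (Suc i)) ` free_module (R (Suc (Suc i)))"
      then obtain w where w: "w \<in> free_module (r (Suc (Suc i)) + s (Suc i))"
        "v = matrix_map (R (Suc i)) (R (Suc (Suc i))) (B (Suc i)) w" by (auto simp: R_def)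
      obtain x y where xy: "x \<in> free_module (r (Suc (Suc i)))" "y \<in> free_module (s (Suc i))" "w = vec_append (r (Suc (Suc i))) x y"
        using w(1) by (rule free_module_add_cases)
      have "matrix_map (R i) (R (Suc i)) (B i) v
         = vec_append (r i) (\<lambda>j. dF i (\<lambda>j. dF (Suc i) x j + \<phi> (Suc i) y j) j + \<phi> i (dK i y) j) (dK' i (dK i y))"
        unfolding w(2) xy(3) B_app by (simp add: dK'_Suc)
      also have "(\<lambda>j. dF i (\<lambda>j. dF (Suc i) x j + \<phi> (Suc i) y j) j + \<phi> i (dK i y) j)
         = (\<lambda>j. dF i (dF (Suc i) x) j + dF i (\<phi> (Suc i) y) j + \<phi> i (dK i y) j)"
        by (simp add: dF_def matrix_map_add)
      also have "\<dots> = (\<lambda>_. 0)" unfolding \<phi>_chain dFdF[OF xy(1)] by simp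
      finally have "matrix_map (R i) (R (Suc i)) (B i) v = (\<lambda>_. 0)" by (simp add: dKdK[OF xy(2)])
      then show "v \<in> {v \<in> free_module (R (Suc i)). matrix_map (R i) (R (Suc i)) (B i) v = (\<lambda>_. 0)}"
        using w(2) by simp
    qed
  qed
  then show ?thesis by blast
qed

lemma supp_ideal_False [simp]: "supp_ideal (\<lambda>_. False) = {0}"
  unfolding supp_ideal_def by (auto simp flip: keys_eq_empty)

lemma homogeneous_single: "homogeneous (mdeg m) (single m c)"
  by (simp add: homogeneous_def)

lemma mapping_cone_supp_ideal:
  fixes P :: "'v::finite set \<Rightarrow> bool"
  assumes "mono P" and "linear_resolution (supp_ideal P :: ('v, 'k::field) mpoly set) (card C) r d"
    and "linear_resolution (supp_ideal (\<lambda>A. P (C \<union> A)) :: ('v, 'k) mpoly set) 1 s e"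
  shows "\<exists>r d. linear_resolution (supp_ideal (\<lambda>A. P A \<or> C \<subseteq> A) :: ('v, 'k) mpoly set) (card C) r d"
  unfolding supp_ideal_insert[OF assms(1)]
proof (rule mapping_cone)
  show "linear_resolution {f. single (sqfree_mono C) 1 * f \<in> (supp_ideal P :: ('v, 'k) mpoly set)} 1 s e"
    using assms(3) by (simp add: single_times_in_supp_ideal_iff)
  show "homogeneous (card C) (single (sqfree_mono C) (1 :: 'k))"
    using homogeneous_single[of "sqfree_mono C"] by simp
qed (use assms in \<open>auto intro: ideal_supp_ideal\<close>)

text \<open>This is the Koszul resolution. A new variable is a nonzerodivisor modulo the previous
  ones, so the colon ideal is the ideal already resolved, and one resolution serves as both
  complexes of the cone.\<close>

lemma linear_resolution_variables:
  "\<exists>r d. linear_resolution (supp_ideal (\<lambda>A. A \<inter> V \<noteq> {}) :: ('v::finite, 'k::field) mpoly set) 1 r d"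
  using finite[of V]
proof (induction rule: finite_induct)
  case empty
  then show ?case using linear_resolution_zero by auto
next
  case (insert v V)
  then obtain r d where rd: "linear_resolution (supp_ideal (\<lambda>A. A \<inter> V \<noteq> {}) :: ('v, 'k) mpoly set) 1 r d"
    by blast
  have eq: "(\<lambda>A. ({v} \<union> A) \<inter> V \<noteq> {}) = (\<lambda>A. A \<inter> V \<noteq> {})" using insert(2) by auto
  have eq2: "(\<lambda>A. A \<inter> insert v V \<noteq> {}) = (\<lambda>A. A \<inter> V \<noteq> {} \<or> {v} \<subseteq> A)" by auto
  show ?case unfolding eq2
    using mapping_cone_supp_ideal[of "\<lambda>A. A \<inter> V \<noteq> {}" "{v}" r d r d, unfolded eq] rd
    by (auto simp: mono_def)
qed

context standard_graph
begin

text \<open>Stated for all sets of minimal covers closed downwards, because the induction removes a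
  cover with maximal index set and the rest is again closed downwards. The cone stays linear since
  every minimal cover has degree \<open>CARD('n)\<close>.\<close>

lemma linear_resolution_covers:
  assumes "U \<subseteq> minimal_covers E"
    and "\<And>C D. C \<in> U \<Longrightarrow> D \<in> minimal_covers E \<Longrightarrow> y_index D \<subset> y_index C \<Longrightarrow> D \<in> U"
  shows "\<exists>r d. linear_resolution (supp_ideal (\<lambda>A. \<exists>C\<in>U. C \<subseteq> A) :: ('n + 'n, 'k::field) mpoly set) CARD('n) r d"
  using finite[of U] assms
proof (induction U rule: finite_psubset_induct)
  case (psubset U)
  show ?case
  proof (cases "U = {}")
    case True
    then show ?thesis using linear_resolution_zero by auto
  next
    case False
    obtain C where C: "C \<in> U" and max: "\<And>D. D \<in> U \<Longrightarrow> \<not> y_index C \<subset> y_index D"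
    proof -
      have "finite (y_index ` U)" "y_index ` U \<noteq> {}" using False by auto
      from finite_has_maximal[OF this] show ?thesis using that by fastforce
    qed
    let ?U = "U - {C}"
    have "\<exists>r d. linear_resolution (supp_ideal (\<lambda>A. \<exists>C\<in>?U. C \<subseteq> A) :: ('n + 'n, 'k) mpoly set) CARD('n) r d"
      using C max psubset.prems by (intro psubset.IH) blast+
    then obtain r d where rd: "linear_resolution (supp_ideal (\<lambda>A. \<exists>C\<in>?U. C \<subseteq> A) :: ('n + 'n, 'k) mpoly set) CARD('n) r d"
      by blast
    have eq: "(\<exists>D\<in>?U. D \<subseteq> C \<union> A) \<longleftrightarrow> A \<inter> exchange_set E C \<noteq> {}" for A
      using C max psubset.prems by (intro linear_quotient) blast+
    obtain s e where se: "linear_resolution (supp_ideal (\<lambda>A. \<exists>D\<in>?U. D \<subseteq> C \<union> A) :: ('n + 'n, 'k) mpoly set) 1 s e"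
      unfolding eq using linear_resolution_variables by blast
    have card: "CARD('n) = card C" using C psubset.prems card_minimal_cover[of C] by auto
    have "mono (\<lambda>A. \<exists>C\<in>?U. C \<subseteq> A)" by (intro monoI le_boolI) (meson order_trans)
    from mapping_cone_supp_ideal[OF this rd[unfolded card] se]
    have "\<exists>r d. linear_resolution (supp_ideal (\<lambda>A. (\<exists>C\<in>?U. C \<subseteq> A) \<or> C \<subseteq> A) :: ('n + 'n, 'k) mpoly set) CARD('n) r d"
      unfolding card .
    moreover have "(\<lambda>A. (\<exists>C\<in>?U. C \<subseteq> A) \<or> C \<subseteq> A) = (\<lambda>A. \<exists>C\<in>U. C \<subseteq> A)"
      using C unfolding fun_eq_iff by blast
    ultimately show ?thesis by simp
  qed
qed

lemma cover_ideal_resolution_exists: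
  "\<exists>b a g d. minimal_graded_free_resolution (cover_ideal E :: ('n + 'n, 'k::field) mpoly set) b a g d"
proof -
  obtain r d where lin: "linear_resolution (cover_ideal E :: ('n + 'n, 'k) mpoly set) CARD('n) r d"
    using linear_resolution_covers[of "minimal_covers E"]
    unfolding cover_ideal_def Idl_sqfree by blast
  \<comment> \<open>Basis degrees of a linear resolution: 0 in step 0, the degree of the generators
    in step 1, and one more in each later step.\<close>
  define a where "a i j = (if i = 0 then 0 else CARD('n) + i - 1)" for i j :: nat
  have r0: "r 0 = 1" using lin by (simp add: linear_resolution_def)
  have hom: "homogeneous (if i = 0 then CARD('n) else 1) (d i j k)" if "j < r i" "k < r (Suc i)" for i j k
    using lin that by (simp add: linear_resolution_def)
  have irr: "f \<in> irrelevant_ideal" if "homogeneous t f" "t > 0" for t and f :: "('n + 'n, 'k) mpoly"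
    using that by (auto simp: irrelevant_ideal_eq supp_ideal_def homogeneous_def mdeg_def)
  have "minimal_graded_free_resolution (cover_ideal E) r a (\<lambda>_. 1) d"
    unfolding minimal_graded_free_resolution_def
  proof (intro conjI allI impI ballI)
    show "\<exists>p. \<forall>i>p. r i = 0" using lin by (simp add: linear_resolution_def)
    show "homogeneous (a 0 j) 1" for j by (simp add: homogeneous_def a_def mdeg_def)
    show "a i j + mdeg m = a (Suc i) k" if "j < r i" "k < r (Suc i)" "m \<in> keys (d i j k)" for i j k m
      using hom[OF that(1,2)] that(3) by (cases i) (auto simp: a_def homogeneous_def)
    show "\<exists>v\<in>free_module (r 0). f - (\<Sum>j<r 0. 1 * v j) \<in> cover_ideal E" for f
      by (rule bexI[of _ "\<lambda>j. if j = 0 then f else 0"]) (simp_all add: r0 free_module_def cover_ideal_eq)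
    show "{v \<in> free_module (r 0). (\<Sum>j<r 0. 1 * v j) \<in> cover_ideal E} = matrix_map (r 0) (r 1) (d 0) ` free_module (r 1)"
      using lin by (simp add: linear_resolution_def)
    show "{v \<in> free_module (r (Suc i)). matrix_map (r i) (r (Suc i)) (d i) v = (\<lambda>_. 0)}
       = matrix_map (r (Suc i)) (r (Suc (Suc i))) (d (Suc i)) ` free_module (r (Suc (Suc i)))" for i
      using lin by (simp add: linear_resolution_def)
    show "d i j k \<in> irrelevant_ideal" if "j < r i" "k < r (Suc i)" for i j k
      using irr[OF hom[OF that]] by (simp split: if_splits)
  qed
  then show ?thesis by blast
qed

end

section \<open>The alternating sum of the Betti numbers\<close>

text \<open>Gaussian elimination: a vector with nonzero coordinate \<open>m\<close> serves as pivot
  and the others are reduced by it. Both the comparison of ranks and the bound on chains of primes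
  rest on this.\<close>

lemma linear_dependence:
  fixes A :: "'x \<Rightarrow> 'm \<Rightarrow> 'k::field"
  assumes "finite M" "finite S" "card M < card S"
  shows "\<exists>c. (\<exists>x\<in>S. c x \<noteq> 0) \<and> (\<forall>m\<in>M. (\<Sum>x\<in>S. c x * A x m) = 0)"
  using assms
proof (induction M arbitrary: S A rule: finite_induct)
  case empty
  then show ?case by (intro exI[of _ "\<lambda>_. 1"]) (auto simp: card_gt_0_iff)
next
  case (insert m M)
  show ?case
  proof (cases "\<forall>x\<in>S. A x m = 0")
    case True
    obtain c where "\<exists>x\<in>S. c x \<noteq> 0" "\<forall>m\<in>M. (\<Sum>x\<in>S. c x * A x m) = 0"
      using insert.IH[of S A] insert.prems insert.hyps by auto
    then show ?thesis using True by (intro exI[of _ c]) auto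
  next
    case False
    then obtain z where z: "z \<in> S" "A z m \<noteq> 0" by blast
    define A' where "A' x l = A x l - A x m / A z m * A z l" for x l
    have "card M < card (S - {z})" using insert z by (simp add: card_Diff_singleton)
    then obtain c where c: "\<exists>x\<in>S - {z}. c x \<noteq> 0" "\<forall>l\<in>M. (\<Sum>x\<in>S - {z}. c x * A' x l) = 0"
      using insert.IH[of "S - {z}" A'] insert.prems by auto
    \<comment> \<open>The coefficient of the pivot that turns a relation among the reduced vectors
      into one among the original vectors.\<close>
    define c' where "c' = c(z := - (\<Sum>x\<in>S - {z}. c x * A x m / A z m))"
    have sum_c': "(\<Sum>x\<in>S. c' x * A x l) = (\<Sum>x\<in>S - {z}. c x * A' x l)" for l
    proof -
      have "(\<Sum>x\<in>S. c' x * A x l) = c' z * A z l + (\<Sum>x\<in>S - {z}. c x * A x l)"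
        using z insert.prems by (subst sum.remove[of _ z]) (auto simp: c'_def intro!: sum.cong)
      also have "c' z * A z l = (\<Sum>x\<in>S - {z}. - (c x * A x m / A z m * A z l))"
        by (simp add: c'_def sum_distrib_right sum_negf)
      finally show ?thesis by (simp add: A'_def algebra_simps sum_subtractf sum_negf)
    qed
    have "A' x m = 0" for x using z by (simp add: A'_def)
    then have "\<forall>l\<in>insert m M. (\<Sum>x\<in>S. c' x * A x l) = 0" using c(2) by (simp add: sum_c')
    moreover have "\<exists>x\<in>S. c' x \<noteq> 0" using c(1) by (auto simp: c'_def)
    ultimately show ?thesis by blast
  qed
qed

text \<open>With \<open>d h + h d = 1\<close>, the map \<open>d + h\<close> from the even to the odd part is injective: its square
  is \<open>1 + h\<^sup>2\<close>, and \<open>h\<^sup>2\<close> raises the degree. The same holds from odd to even.\<close>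

lemma contractible_rank_le:
  fixes dm hm :: "nat \<Rightarrow> nat \<Rightarrow> nat \<Rightarrow> 'k::field" and b :: "nat \<Rightarrow> nat"
  defines "d \<equiv> \<lambda>i. matrix_map (b i) (b (Suc i)) (dm i)"
    and "h \<equiv> \<lambda>i. matrix_map (b (Suc i)) (b i) (hm i)"
  assumes fin: "\<And>i. i > p \<Longrightarrow> b i = 0"
    and dd: "\<And>i y. d i (d (Suc i) y) = (\<lambda>_. 0)"
    and h0: "\<And>w. w \<in> free_module (b 0) \<Longrightarrow> d 0 (h 0 w) = w"
    and hS: "\<And>i w. w \<in> free_module (b (Suc i)) \<Longrightarrow> (\<lambda>j. d (Suc i) (h (Suc i) w) j + h i (d i w) j) = w"
  shows "(\<Sum>i | i \<le> p \<and> even i = \<pi>. b i) \<le> (\<Sum>i | i \<le> p \<and> even i \<noteq> \<pi>. b i)"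
proof (rule ccontr)
  define S where "S = Sigma {i. i \<le> p \<and> even i = \<pi>} (\<lambda>i. {..<b i})"
  define M where "M = Sigma {i. i \<le> p \<and> even i \<noteq> \<pi>} (\<lambda>i. {..<b i})"
  \<comment> \<open>The matrix of \<open>d + h\<close> from the part of parity \<open>\<pi>\<close>
    to the other part; \<open>x\<close> indexes the source and \<open>m\<close> the target.\<close>
  define A where "A x m = (case x of (i, k) \<Rightarrow> case m of (i', j) \<Rightarrow>
    (if i' = Suc i then hm i j k else 0) + (if i = Suc i' then dm i' j k else 0))" for x m
  assume "\<not> ?thesis"
  then have "card M < card S" by (simp add: S_def M_def)
  moreover have "finite S" "finite M" by (simp_all add: S_def M_def)
  ultimately obtain c where c: "\<exists>x\<in>S. c x \<noteq> 0" "\<And>m. m \<in> M \<Longrightarrow> (\<Sum>x\<in>S. c x * A x m) = 0"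
    using linear_dependence[of M S A] by blast
  define C where "C i = (\<lambda>k. if even i = \<pi> \<and> k < b i then c (i, k) else 0)" for i
  have C_free: "C i \<in> free_module (b i)" for i by (simp add: C_def free_module_def)
  \<comment> \<open>The component in step \<open>i'\<close> of the fact that \<open>d + h\<close>
    kills \<open>C\<close>; step 0 receives nothing from \<open>h\<close>.\<close>
  have relation: "(case i' of 0 \<Rightarrow> 0 | Suc i \<Rightarrow> h i (C i) j) + d i' (C (Suc i')) j = 0" if i': "even i' \<noteq> \<pi>" for i' j
  proof (cases "i' \<le> p \<and> j < b i'")
    case True
    have "0 = (\<Sum>x\<in>S. c x * A x (i', j))" using c(2)[of "(i', j)"] True i' by (simp add: M_def)
    also have "\<dots> = (\<Sum>i | i \<le> p \<and> even i = \<pi>. \<Sum>k<b i. C i k * A (i, k) (i', j))"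
    proof -
      have "(\<Sum>i | i \<le> p \<and> even i = \<pi>. \<Sum>k<b i. C i k * A (i, k) (i', j)) = (\<Sum>(i, k)\<in>S. C i k * A (i, k) (i', j))"
        unfolding S_def by (rule sum.Sigma) auto
      also have "\<dots> = (\<Sum>x\<in>S. c x * A x (i', j))" by (rule sum.cong) (auto simp: S_def C_def)
      finally show ?thesis ..
    qed
    \<comment> \<open>The range reaches \<open>Suc p\<close> so that the source
      \<open>Suc i'\<close> of \<open>d i'\<close> occurs even for \<open>i' = p\<close>; the added
      terms vanish.\<close>
    also have "\<dots> = (\<Sum>i\<le>Suc p. \<Sum>k<b i. C i k * A (i, k) (i', j))"
    proof (rule sum.mono_neutral_left)
      show "\<forall>i\<in>{..Suc p} - {i. i \<le> p \<and> even i = \<pi>}. (\<Sum>k<b i. C i k * A (i, k) (i', j)) = 0"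
      proof
        fix i assume "i \<in> {..Suc p} - {i. i \<le> p \<and> even i = \<pi>}"
        then have "C i = (\<lambda>_. 0)" using fin[of i] unfolding C_def by (cases "i \<le> p") auto
        then show "(\<Sum>k<b i. C i k * A (i, k) (i', j)) = 0" by simp
      qed
    qed auto
    also have "\<dots> = (\<Sum>i\<le>Suc p. (if i' = Suc i then h i (C i) j else 0) + (if i = Suc i' then d i' (C i) j else 0))"
      using True by (intro sum.cong)
        (auto simp: A_def h_def d_def matrix_map_def mult.commute intro!: sum.neutral sum.cong)
    also have "\<dots> = (case i' of 0 \<Rightarrow> 0 | Suc i \<Rightarrow> h i (C i) j) + d i' (C (Suc i')) j"
      using True by (cases i') (auto simp: sum.distrib)
    finally show ?thesis by simp
  next
    case False
    then have "j \<ge> b i'" using fin[of i'] by (cases "i' \<le> p") auto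
    then show ?thesis by (cases i') (auto simp: h_def d_def matrix_map_def)
  qed
  have d0 [simp]: "d i (\<lambda>_. 0) = (\<lambda>_. 0)" "h i (\<lambda>_. 0) = (\<lambda>_. 0)" for i by (simp_all add: d_def h_def)
  have d_uminus: "d i (\<lambda>j. - v j) = (\<lambda>j. - d i v j)" for i v
    using matrix_map_diff[of "b i" "b (Suc i)" "dm i" "\<lambda>_. 0" v] by (simp add: d_def)
  \<comment> \<open>By \<open>relation\<close>, \<open>h i (C i)\<close> is a boundary up to sign,
    so \<open>d\<close> kills it and the homotopy identity leaves only \<open>h d\<close> applied to
    \<open>C i\<close>. Below, \<open>d\<close> of \<open>C i\<close> vanishes by induction, being
    the negative of \<open>h\<close> of the component two steps lower.\<close>
  have dh: "d i (h i (C i)) = (\<lambda>_. 0)" if "even i = \<pi>" for i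
  proof -
    have "h i (C i) j = - d (Suc i) (C (Suc (Suc i))) j" for j
      using relation[of "Suc i" j] that by (simp add: eq_neg_iff_add_eq_0)
    then have "h i (C i) = (\<lambda>j. - d (Suc i) (C (Suc (Suc i))) j)" by blast
    then show ?thesis by (simp add: d_uminus dd)
  qed
  have "C i = (\<lambda>_. 0)" for i
  proof (induction i rule: less_induct)
    case (less i)
    show ?case
    proof (cases "even i = \<pi>")
      case False
      then show ?thesis by (auto simp: C_def)
    next
      case True
      show ?thesis
      proof (cases i)
        case 0
        then show ?thesis using h0[OF C_free[of 0]] dh[OF True] by simp
      next
        case (Suc n)
        have "d n (C i) j = 0" for j
          using relation[of n j] True less.IH Suc by (cases n) auto
        then have "d n (C i) = (\<lambda>_. 0)" by (rule HOL.ext)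
        then have "h n (d n (C i)) = (\<lambda>_. 0)" by simp
        then show ?thesis using hS[of "C i" n] C_free[of i] dh[OF True] Suc by simp
      qed
    qed
  qed
  then have "c x = 0" if "x \<in> S" for x
  proof -
    obtain i k where x: "x = (i, k)" by force
    have "C i k = 0" using \<open>\<And>i. C i = (\<lambda>_. 0)\<close> by simp
    then show ?thesis using that x by (simp add: S_def C_def)
  qed
  then show False using c(1) by blast
qed

lemma alternating_sum_split:
  "(\<Sum>i\<le>p. (-1) ^ i * int (b i)) = int (\<Sum>i | i \<le> p \<and> even i. b i) - int (\<Sum>i | i \<le> p \<and> \<not> even i. b i)"
proof -
  have "(\<Sum>i\<le>p. (-1) ^ i * int (b i))
    = (\<Sum>i | i \<le> p \<and> even i. (-1) ^ i * int (b i)) + (\<Sum>i | i \<le> p \<and> \<not> even i. (-1) ^ i * int (b i))"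
    by (subst sum.union_disjoint[symmetric]) (auto intro!: sum.cong)
  also have "(\<Sum>i | i \<le> p \<and> even i. (-1) ^ i * int (b i)) = (\<Sum>i | i \<le> p \<and> even i. int (b i))"
    by (rule sum.cong) auto
  also have "(\<Sum>i | i \<le> p \<and> \<not> even i. (-1) ^ i * int (b i)) = (\<Sum>i | i \<le> p \<and> \<not> even i. - int (b i))"
    by (rule sum.cong) auto
  finally show ?thesis by (simp add: sum_negf)
qed

text \<open>The value of the polynomial at the point with all coordinates 1.\<close>

definition coeff_sum :: "('a, 'k::field) mpoly \<Rightarrow> 'k" where
  "coeff_sum f = (\<Sum>m\<in>keys f. lookup f m)"

lemma coeff_sum_superset: "finite A \<Longrightarrow> keys f \<subseteq> A \<Longrightarrow> coeff_sum f = (\<Sum>m\<in>A. lookup f m)"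
  unfolding coeff_sum_def by (rule sum.mono_neutral_left) (auto simp: in_keys_iff)

lemma coeff_sum_single [simp]: "coeff_sum (single m c) = c"
  by (simp add: coeff_sum_superset[of "{m}"])

lemma coeff_sum_0 [simp]: "coeff_sum 0 = 0"
  by (simp add: coeff_sum_def)

lemma coeff_sum_add: "coeff_sum (f + g) = coeff_sum f + coeff_sum g"
proof -
  have "keys (f + g) \<subseteq> keys f \<union> keys g" by (rule Poly_Mapping.keys_add)
  then show ?thesis
    by (simp add: coeff_sum_superset[of "keys f \<union> keys g"] lookup_add sum.distrib)
qed

lemma coeff_sum_sum: "coeff_sum (sum f A) = (\<Sum>i\<in>A. coeff_sum (f i))"
  by (induction A rule: infinite_finite_induct) (auto simp: coeff_sum_add)

lemma coeff_sum_times: "coeff_sum (f * g) = coeff_sum f * coeff_sum g"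
proof -
  have "f * g = (\<Sum>m\<in>keys f. \<Sum>l\<in>keys g. single (m + l) (lookup f m * lookup g l))"
    by (subst poly_mapping_expand[of f], subst poly_mapping_expand[of g]) (simp add: sum_product mult_single)
  then show ?thesis by (simp add: coeff_sum_sum) (simp add: coeff_sum_def sum_product)
qed

lemma matrix_map_scale: "matrix_map r c A (\<lambda>k. u * v k) = (\<lambda>j. u * matrix_map r c A v j)"
  by (auto simp: matrix_map_def sum_distrib_left mult.left_commute)

lemma matrix_map_diagonal:
  "v \<in> free_module r \<Longrightarrow> matrix_map r r (\<lambda>j k. if j = k then u else 0) v = (\<lambda>j. u * v j)"
  unfolding matrix_map_def by (rule HOL.ext) (auto simp: free_module_def if_distrib[of "\<lambda>x. x * _"] cong: if_cong)

lemma matrix_map_expand: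
  assumes "\<And>k. k < c \<Longrightarrow> matrix_map r s A (\<lambda>j. if j < s then B j k else 0) = (\<lambda>j. if j < r then M j k else 0)"
  shows "matrix_map r s A (matrix_map s c B y) = matrix_map r c M y"
  unfolding matrix_map_comp
proof (rule fun_cong[of _ _ y], rule matrix_map_cong)
  fix j k assume "j < r" "k < c"
  then show "(\<Sum>l<s. A j l * B l k) = M j k"
    using fun_cong[OF assms[of k], of j] by (simp add: matrix_map_def)
qed

lemma matrix_map_entries:
  assumes "\<And>y. y \<in> free_module c \<Longrightarrow> matrix_map r c A y = matrix_map r c B y" "j < r" "k < c"
  shows "A j k = B j k"
proof -
  have "(\<lambda>l. if l = k then 1 else 0) \<in> free_module c" using assms(3) by (simp add: free_module_def)
  from fun_cong[OF assms(1)[OF this], of j] show ?thesis using assms(2,3) by (simp add: matrix_map_unit)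
qed

text \<open>Multiplication by \<open>u\<close> is zero on the quotient by \<open>I\<close>, so on
  the resolution it lifts the zero map. The homotopy is built step by step: the values of
  \<open>u - h d\<close> are cycles and hence boundaries.\<close>

lemma resolution_homotopy:
  fixes I :: "('v::finite, 'k::field) mpoly set"
  assumes res: "minimal_graded_free_resolution I b a g d"
    and I: "ideal I polyring" and u: "u \<in> I"
  defines "D \<equiv> \<lambda>i. matrix_map (b i) (b (Suc i)) (d i)"
  shows "\<exists>h. (\<forall>y\<in>free_module (b 0). D 0 (matrix_map (b 1) (b 0) (h 0) y) = (\<lambda>j. u * y j)) \<and>
    (\<forall>i. \<forall>y\<in>free_module (b (Suc i)). D (Suc i) (matrix_map (b (Suc (Suc i))) (b (Suc i)) (h (Suc i)) y)
       = (\<lambda>j. u * y j - matrix_map (b (Suc i)) (b i) (h i) (D i y) j))"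
proof -
  have ker0: "{v \<in> free_module (b 0). (\<Sum>j<b 0. g j * v j) \<in> I} = D 0 ` free_module (b (Suc 0))"
    using res unfolding minimal_graded_free_resolution_def D_def One_nat_def by blast
  have ker: "{v \<in> free_module (b (Suc i)). D i v = (\<lambda>_. 0)} = D (Suc i) ` free_module (b (Suc (Suc i)))" for i
    using res unfolding minimal_graded_free_resolution_def D_def by blast
  \<comment> \<open>\<open>good\<close> says that \<open>d\<close> kills \<open>u - h d\<close>, so
    that the next \<open>h\<close> exists; \<open>compat\<close> is the homotopy identity. The
    identity in step 0 has no preceding map and is kept in \<open>good\<close>.\<close>
  define good where "good i h \<longleftrightarrow>
     (\<forall>y\<in>free_module (b (Suc i)). D i (matrix_map (b (Suc i)) (b i) h (D i y)) = (\<lambda>j. u * D i y j)) \<and>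
     (i = 0 \<longrightarrow> (\<forall>y\<in>free_module (b 0). D 0 (matrix_map (b 1) (b 0) h y) = (\<lambda>j. u * y j)))" for i h
  define compat where "compat i h h' \<longleftrightarrow>
     (\<forall>y\<in>free_module (b (Suc i)). D (Suc i) (matrix_map (b (Suc (Suc i))) (b (Suc i)) h' y)
       = (\<lambda>j. u * y j - matrix_map (b (Suc i)) (b i) h (D i y) j))" for i h h'
  have "\<exists>h. \<forall>i. good i (h i) \<and> compat i (h i) (h (Suc i))"
  proof (rule dependent_nat_choice)
    have "\<exists>v. D 0 v = (\<lambda>j. if j = k then u else 0)" if k: "k < b 0" for k
    proof -
      have "(\<Sum>j<b 0. g j * (if j = k then u else 0)) = g k * u"
        using k by (simp add: mult_delta_right)
      also have "\<dots> \<in> I" using I u by (simp add: ideal_polyring_iff)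
      finally have "(\<lambda>j. if j = k then u else 0) \<in> D 0 ` free_module (b (Suc 0))"
        unfolding ker0[symmetric] using k by (simp add: free_module_def)
      then show ?thesis by (elim imageE) (rule exI, erule sym)
    qed
    then obtain V where V: "\<And>k. k < b 0 \<Longrightarrow> D 0 (V k) = (\<lambda>j. if j = k then u else 0)" by metis
    define h where "h j k = V k j" for j k
    have "D 0 (matrix_map (b 1) (b 0) h y) = (\<lambda>j. u * y j)" if y: "y \<in> free_module (b 0)" for y
    proof -
      have "D 0 (matrix_map (b (Suc 0)) (b 0) h y) = matrix_map (b 0) (b 0) (\<lambda>j k. if j = k then u else 0) y"
        unfolding D_def
      proof (rule matrix_map_expand)
        fix k assume k: "k < b 0"
        have "matrix_map (b 0) (b (Suc 0)) (d 0) (\<lambda>j. if j < b (Suc 0) then h j k else 0) = D 0 (V k)"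
          unfolding h_def D_def by (rule matrix_map_restrict)
        then show "matrix_map (b 0) (b (Suc 0)) (d 0) (\<lambda>j. if j < b (Suc 0) then h j k else 0)
            = (\<lambda>j. if j < b 0 then if j = k then u else 0 else 0)"
          using V[OF k] k by auto
      qed
      then show ?thesis using matrix_map_diagonal[OF y] by simp
    qed
    moreover have "D 0 y \<in> free_module (b 0)" for y by (simp add: D_def)
    ultimately show "\<exists>h. good 0 h" by (intro exI[of _ h]) (simp add: good_def)
  next
    fix h i assume h: "good i h"
    let ?H = "matrix_map (b (Suc i)) (b i) h"
    have "\<exists>v. D (Suc i) v = (\<lambda>j. u * y j - ?H (D i y) j)" if y: "y \<in> free_module (b (Suc i))" for y
    proof -
      have "D i (\<lambda>j. u * y j - ?H (D i y) j) = (\<lambda>j. u * D i y j - D i (?H (D i y)) j)"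
        unfolding D_def matrix_map_diff matrix_map_scale ..
      also have "\<dots> = (\<lambda>_. 0)" using h y by (simp add: good_def)
      finally have "(\<lambda>j. u * y j - ?H (D i y) j) \<in> D (Suc i) ` free_module (b (Suc (Suc i)))"
        unfolding ker[symmetric] using y matrix_map_in_free[of "b (Suc i)" "b i" h] by (simp add: free_module_def)
      then show ?thesis by (elim imageE) (rule exI, erule sym)
    qed
    then obtain V where V: "\<And>y. y \<in> free_module (b (Suc i)) \<Longrightarrow> D (Suc i) (V y) = (\<lambda>j. u * y j - ?H (D i y) j)"
      by metis
    define e where "e k = (\<lambda>l. if l = k then 1 else 0 :: ('v, 'k) mpoly)" for k :: nat
    define h' where "h' j k = V (e k) j" for j k
    have compat: "compat i h h'"
      unfolding compat_def
    proof
      fix y :: "nat \<Rightarrow> ('v, 'k) mpoly" assume y: "y \<in> free_module (b (Suc i))"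
      define N where "N j k = (if j = k then u else 0) - (\<Sum>l<b i. h j l * d i l k)" for j k
      have "D (Suc i) (matrix_map (b (Suc (Suc i))) (b (Suc i)) h' y) = matrix_map (b (Suc i)) (b (Suc i)) N y"
        unfolding D_def
      proof (rule matrix_map_expand)
        fix k assume k: "k < b (Suc i)"
        have "matrix_map (b (Suc i)) (b (Suc (Suc i))) (d (Suc i)) (\<lambda>j. if j < b (Suc (Suc i)) then h' j k else 0)
           = D (Suc i) (V (e k))" unfolding h'_def D_def by (rule matrix_map_restrict)
        also have "\<dots> = (\<lambda>j. u * e k j - ?H (D i (e k)) j)"
          using k by (intro V) (simp add: e_def free_module_def)
        also have "?H (D i (e k)) = (\<lambda>j. if j < b (Suc i) then \<Sum>l<b i. h j l * d i l k else 0)"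
          unfolding D_def matrix_map_comp e_def using k by (rule matrix_map_unit)
        finally show "matrix_map (b (Suc i)) (b (Suc (Suc i))) (d (Suc i)) (\<lambda>j. if j < b (Suc (Suc i)) then h' j k else 0)
           = (\<lambda>j. if j < b (Suc i) then N j k else 0)" using k by (auto simp: N_def e_def fun_eq_iff)
      qed
      also have "\<dots> = (\<lambda>j. matrix_map (b (Suc i)) (b (Suc i)) (\<lambda>j k. if j = k then u else 0) y j - ?H (D i y) j)"
        unfolding D_def matrix_map_comp
        by (rule HOL.ext) (simp add: matrix_map_def N_def algebra_simps sum_subtractf)
      finally show "D (Suc i) (matrix_map (b (Suc (Suc i))) (b (Suc i)) h' y) = (\<lambda>j. u * y j - ?H (D i y) j)"
        unfolding matrix_map_diagonal[OF y] .
    qed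
    have "good (Suc i) h'"
      unfolding good_def
    proof (intro conjI ballI)
      fix y :: "nat \<Rightarrow> ('v, 'k) mpoly" assume "y \<in> free_module (b (Suc (Suc i)))"
      then have "D (Suc i) y \<in> {v \<in> free_module (b (Suc i)). D i v = (\<lambda>_. 0)}" unfolding ker by simp
      then show "D (Suc i) (matrix_map (b (Suc (Suc i))) (b (Suc i)) h' (D (Suc i) y)) = (\<lambda>j. u * D (Suc i) y j)"
        using compat by (simp add: compat_def)
    qed simp
    then show "\<exists>h'. good (Suc i) h' \<and> compat i h h'" using compat by blast
  qed
  then obtain h where "\<forall>i. good i (h i) \<and> compat i (h i) (h (Suc i))" by blast
  then show ?thesis by (intro exI[of _ h]) (simp add: good_def compat_def)
qed

text \<open>Exactness need not survive an evaluation, but identities between matrix entries do. The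
  homotopy identity is therefore rewritten entrywise before all variables are set to 1, where
  \<open>u\<close> becomes 1.\<close>

lemma resolution_alternating_sum:
  fixes I :: "('v::finite, 'k::field) mpoly set"
  assumes res: "minimal_graded_free_resolution I b a g d"
    and I: "ideal I polyring" and u: "u \<in> I" "coeff_sum u = 1"
    and p: "\<And>i. i > p \<Longrightarrow> b i = 0"
  shows "(\<Sum>i\<le>p. (-1) ^ i * int (b i)) = 0"
proof -
  define D where "D i = matrix_map (b i) (b (Suc i)) (d i)" for i
  obtain h where h0: "\<And>y. y \<in> free_module (b 0) \<Longrightarrow> D 0 (matrix_map (b 1) (b 0) (h 0) y) = (\<lambda>j. u * y j)"
    and hS: "\<And>i y. y \<in> free_module (b (Suc i)) \<Longrightarrow> D (Suc i) (matrix_map (b (Suc (Suc i))) (b (Suc i)) (h (Suc i)) y)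
       = (\<lambda>j. u * y j - matrix_map (b (Suc i)) (b i) (h i) (D i y) j)"
    using resolution_homotopy[OF res I u(1)] unfolding D_def by blast
  have ker: "{v \<in> free_module (b (Suc i)). D i v = (\<lambda>_. 0)} = D (Suc i) ` free_module (b (Suc (Suc i)))" for i
    using res unfolding minimal_graded_free_resolution_def D_def by blast

  have e0: "(\<Sum>l<b 1. d 0 j l * h 0 l k) = (if j = k then u else 0)" if "j < b 0" "k < b 0" for j k
    using matrix_map_entries[of "b 0" "b 0" "\<lambda>j k. \<Sum>l<b 1. d 0 j l * h 0 l k" "\<lambda>j k. if j = k then u else 0" j k]
      h0 that by (simp add: matrix_map_diagonal D_def matrix_map_comp)
  have eS: "(\<Sum>l<b (Suc (Suc i)). d (Suc i) j l * h (Suc i) l k) + (\<Sum>l<b i. h i j l * d i l k) = (if j = k then u else 0)"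
    if "j < b (Suc i)" "k < b (Suc i)" for i j k
  proof -
    have "(\<Sum>l<b (Suc (Suc i)). d (Suc i) j l * h (Suc i) l k) = (if j = k then u else 0) - (\<Sum>l<b i. h i j l * d i l k)"
    proof (rule matrix_map_entries[OF _ that])
      fix y :: "nat \<Rightarrow> ('v, 'k) mpoly" assume y: "y \<in> free_module (b (Suc i))"
      have "matrix_map (b (Suc i)) (b (Suc i)) (\<lambda>j k. (if j = k then u else 0) - (\<Sum>l<b i. h i j l * d i l k)) y
         = (\<lambda>j. matrix_map (b (Suc i)) (b (Suc i)) (\<lambda>j k. if j = k then u else 0) y j
             - matrix_map (b (Suc i)) (b i) (h i) (D i y) j)"
        unfolding D_def matrix_map_comp by (rule HOL.ext) (simp add: matrix_map_def algebra_simps sum_subtractf)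
      then show "matrix_map (b (Suc i)) (b (Suc i)) (\<lambda>j k. \<Sum>l<b (Suc (Suc i)). d (Suc i) j l * h (Suc i) l k) y
         = matrix_map (b (Suc i)) (b (Suc i)) (\<lambda>j k. (if j = k then u else 0) - (\<Sum>l<b i. h i j l * d i l k)) y"
        using hS[OF y] unfolding matrix_map_diagonal[OF y] by (simp add: D_def matrix_map_comp)
    qed
    then show ?thesis by simp
  qed
  have edd: "(\<Sum>l<b (Suc i). d i j l * d (Suc i) l k) = 0" if "j < b i" "k < b (Suc (Suc i))" for i j k
  proof (rule matrix_map_entries[OF _ that])
    fix y :: "nat \<Rightarrow> ('v, 'k) mpoly" assume "y \<in> free_module (b (Suc (Suc i)))"
    then have "D i (D (Suc i) y) = (\<lambda>_. 0)" using ker by blast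
    then show "matrix_map (b i) (b (Suc (Suc i))) (\<lambda>j k. \<Sum>l<b (Suc i). d i j l * d (Suc i) l k) y
        = matrix_map (b i) (b (Suc (Suc i))) (\<lambda>_ _. 0) y"
      by (simp add: D_def matrix_map_comp) (simp add: matrix_map_def fun_eq_iff)
  qed

  define dm where "dm i j k = coeff_sum (d i j k)" for i j k
  define hm where "hm i j k = coeff_sum (h i j k)" for i j k
  have f0: "(\<Sum>l<b (Suc 0). dm 0 j l * hm 0 l k) = (if j = k then 1 else 0)" if "j < b 0" "k < b 0" for j k
    using arg_cong[OF e0[OF that], of coeff_sum] u(2)
    by (simp add: dm_def hm_def coeff_sum_sum coeff_sum_times split: if_splits)
  have fS: "(\<Sum>l<b (Suc (Suc i)). dm (Suc i) j l * hm (Suc i) l k) + (\<Sum>l<b i. hm i j l * dm i l k) = (if j = k then 1 else 0)"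
    if "j < b (Suc i)" "k < b (Suc i)" for i j k
    using arg_cong[OF eS[OF that], of coeff_sum] u(2)
    by (simp add: dm_def hm_def coeff_sum_add coeff_sum_sum coeff_sum_times split: if_splits)
  have fdd: "(\<Sum>l<b (Suc i). dm i j l * dm (Suc i) l k) = 0" if "j < b i" "k < b (Suc (Suc i))" for i j k
    using arg_cong[OF edd[OF that], of coeff_sum]
    by (simp add: dm_def coeff_sum_sum coeff_sum_times)

  have le: "(\<Sum>i | i \<le> p \<and> even i = \<pi>. b i) \<le> (\<Sum>i | i \<le> p \<and> even i \<noteq> \<pi>. b i)" for \<pi>
  proof (rule contractible_rank_le[of p b dm hm])
    show "b i = 0" if "i > p" for i using p that .
    show "matrix_map (b i) (b (Suc i)) (dm i) (matrix_map (b (Suc i)) (b (Suc (Suc i))) (dm (Suc i)) y) = (\<lambda>_. 0)" for i y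
      unfolding matrix_map_comp using fdd by (auto simp: matrix_map_def)
    show "matrix_map (b 0) (b (Suc 0)) (dm 0) (matrix_map (b (Suc 0)) (b 0) (hm 0) w) = w"
      if w: "w \<in> free_module (b 0)" for w
    proof -
      have "matrix_map (b 0) (b 0) (\<lambda>j k. \<Sum>l<b (Suc 0). dm 0 j l * hm 0 l k) w
          = matrix_map (b 0) (b 0) (\<lambda>j k. if j = k then 1 else 0) w"
        by (rule fun_cong[of _ _ w], rule matrix_map_cong, rule f0)
      then show ?thesis unfolding matrix_map_comp matrix_map_diagonal[OF w] by simp
    qed
    show "(\<lambda>j. matrix_map (b (Suc i)) (b (Suc (Suc i))) (dm (Suc i)) (matrix_map (b (Suc (Suc i))) (b (Suc i)) (hm (Suc i)) w) j
        + matrix_map (b (Suc i)) (b i) (hm i) (matrix_map (b i) (b (Suc i)) (dm i) w) j) = w"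
      if w: "w \<in> free_module (b (Suc i))" for i w
    proof -
      have "(\<lambda>j. matrix_map (b (Suc i)) (b (Suc (Suc i))) (dm (Suc i)) (matrix_map (b (Suc (Suc i))) (b (Suc i)) (hm (Suc i)) w) j
        + matrix_map (b (Suc i)) (b i) (hm i) (matrix_map (b i) (b (Suc i)) (dm i) w) j)
        = matrix_map (b (Suc i)) (b (Suc i)) (\<lambda>j k. (\<Sum>l<b (Suc (Suc i)). dm (Suc i) j l * hm (Suc i) l k)
            + (\<Sum>l<b i. hm i j l * dm i l k)) w"
        unfolding matrix_map_comp by (rule HOL.ext) (simp add: matrix_map_def distrib_right sum.distrib)
      also have "\<dots> = matrix_map (b (Suc i)) (b (Suc i)) (\<lambda>j k. if j = k then 1 else 0) w"
        by (rule fun_cong[of _ _ w], rule matrix_map_cong, rule fS)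
      finally show ?thesis unfolding matrix_map_diagonal[OF w] by simp
    qed
  qed
  have "(\<Sum>i | i \<le> p \<and> even i. b i) = (\<Sum>i | i \<le> p \<and> \<not> even i. b i)"
    using le[of True] le[of False] by simp
  then show ?thesis by (simp only: alternating_sum_split)
qed

text \<open>The augmentation is given by arbitrary forms \<open>g j\<close>. Since 1 is reached
  modulo the ideal, some \<open>g k\<close> is a nonzero constant; any further generator would be a
  multiple of it, which minimality forbids.\<close>

lemma resolution_rank_0:
  fixes P :: "'v::finite set \<Rightarrow> bool"
  assumes res: "minimal_graded_free_resolution (supp_ideal P :: ('v, 'k::field) mpoly set) b a g d"
    and P: "mono P" "\<not> P {}"
  shows "b 0 = 1"
proof -
  let ?I = "supp_ideal P :: ('v, 'k) mpoly set"
  have lookup0: "lookup f 0 = 0" if "f \<in> ?I" for f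
  proof (rule ccontr)
    assume "lookup f 0 \<noteq> 0"
    then have "P (keys (0 :: 'v \<Rightarrow>\<^sub>0 nat))"
      using that by (simp add: supp_ideal_def in_keys_iff del: keys_zero)
    then show False using P(2) by simp
  qed
  have irr0: "lookup f 0 = 0" if "f \<in> irrelevant_ideal" for f :: "('v, 'k) mpoly"
    using that by (auto simp: irrelevant_ideal_eq supp_ideal_def in_keys_iff)
  have "\<forall>f. \<exists>v\<in>free_module (b 0). f - (\<Sum>j<b 0. g j * v j) \<in> ?I"
    using res unfolding minimal_graded_free_resolution_def by (elim conjE)
  then obtain v where "1 - (\<Sum>j<b 0. g j * v j) \<in> ?I" by blast
  then have "(\<Sum>j<b 0. lookup (g j * v j) 0) = 1"
    using lookup0[of "1 - (\<Sum>j<b 0. g j * v j)"] by (simp add: lookup_minus lookup_sum)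
  moreover have "(\<Sum>j<b 0. lookup (g j * v j) 0) = 0" if "\<forall>j<b 0. lookup (g j * v j) 0 = 0"
    by (rule sum.neutral) (use that in simp)
  ultimately have "\<exists>j<b 0. lookup (g j * v j) 0 \<noteq> 0" using zero_neq_one by metis
  then obtain k where k: "k < b 0" "lookup (g k * v k) 0 \<noteq> 0" by blast
  then have "0 \<in> keys (g k * v k)" by (simp add: in_keys_iff)
  then obtain m l where "0 = m + l" "m \<in> keys (g k)" using keys_mult[of "g k" "v k"] by blast
  then have "0 \<in> keys (g k)"
    using mdeg_add[of m l] mdeg_eq_0_iff[of m] mdeg_eq_0_iff[of "m + l"] by simp
  moreover have "homogeneous (a 0 k) (g k)"
    using res k(1) by (simp add: minimal_graded_free_resolution_def)
  ultimately have "keys (g k) = {0}"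
    by (auto simp: homogeneous_def) (metis mdeg_eq_0_iff)
  then obtain c where c: "g k = single 0 c" "c \<noteq> 0"
    using poly_mapping_expand[of "g k"] by (auto simp: in_keys_iff)
  have "b 0 \<le> 1"
  proof (rule ccontr)
    assume "\<not> b 0 \<le> 1"
    then obtain l where l: "l < b 0" "l \<noteq> k" using that[of 0] that[of 1] by (cases "k = 0") auto
    \<comment> \<open>A syzygy of the \<open>g j\<close> with entry 1 at place \<open>l\<close>. It
      must come from \<open>d 0\<close>, whose entries lie in the irrelevant ideal.\<close>
    define w where "w j = (if j = l then 1 else 0) - (if j = k then single 0 (1 / c) * g l else 0)" for j
    have "(\<Sum>j<b 0. g j * w j) = g l - g k * (single 0 (1 / c) * g l)"
      using k l by (simp add: w_def right_diff_distrib sum_subtractf mult_delta_right)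
    also have "\<dots> = 0" using c by (simp add: mult_single flip: mult.assoc)
    finally have "w \<in> {v \<in> free_module (b 0). (\<Sum>j<b 0. g j * v j) \<in> ?I}"
      using k l by (simp add: free_module_def w_def)
    also have "\<dots> = matrix_map (b 0) (b 1) (d 0) ` free_module (b 1)"
      using res unfolding minimal_graded_free_resolution_def by blast
    finally obtain y where y: "w = matrix_map (b 0) (b 1) (d 0) y" by blast
    have "w l = (\<Sum>j<b 1. d 0 l j * y j)" using fun_cong[OF y, of l] l by (simp add: matrix_map_def)
    also have "\<dots> \<in> irrelevant_ideal"
      unfolding irrelevant_ideal_eq
    proof (intro supp_ideal_sum supp_ideal_times(2))
      fix j assume "j \<in> {..<b 1}"
      then show "d 0 l j \<in> supp_ideal (\<lambda>A. A \<noteq> {})"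
        using res l unfolding minimal_graded_free_resolution_def irrelevant_ideal_eq by simp
    qed (auto simp: mono_def)
    finally have "lookup (w l) 0 = 0" by (rule irr0)
    then show False using l by (simp add: w_def)
  qed
  then show ?thesis using k by simp
qed

lemma betti_alternating_sum:
  fixes P :: "'v::finite set \<Rightarrow> bool"
  defines "I \<equiv> (supp_ideal P :: ('v, 'k::field) mpoly set)"
  assumes P: "mono P" "\<not> P {}" "P UNIV"
    and ex: "\<exists>b a g d. minimal_graded_free_resolution I b a g d"
  shows "(\<Sum>i | i \<ge> 1 \<and> betti I i \<noteq> 0. (-1) ^ i * int (betti I i)) = -1"
proof -
  define b where "b = betti I"
  have "\<exists>a g d. minimal_graded_free_resolution I b a g d"
    unfolding b_def betti_def by (rule someI_ex[OF ex])
  then obtain a g d where res: "minimal_graded_free_resolution I b a g d" by blast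
  have "\<exists>p. \<forall>i>p. b i = 0"
    using res unfolding minimal_graded_free_resolution_def by (elim conjE)
  then obtain p where p: "\<And>i. i > p \<Longrightarrow> b i = 0" by blast
  have "(\<Sum>i\<le>p. (-1) ^ i * int (b i)) = 0"
  proof (rule resolution_alternating_sum[OF res])
    show "ideal I polyring" unfolding I_def using P(1) by (rule ideal_supp_ideal)
    \<comment> \<open>The product of all variables lies in the ideal and has coefficient sum
      1.\<close>
    show "single (sqfree_mono UNIV) 1 \<in> I" using P(3) by (simp add: I_def supp_ideal_def)
    show "b i = 0" if "i > p" for i using p that .
  qed simp
  then have "0 = (\<Sum>i\<le>p. (-1) ^ i * int (b i))" ..
  also have "\<dots> = int (b 0) + (\<Sum>i\<in>{..p} - {0}. (-1) ^ i * int (b i))"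
    by (subst sum.remove[of _ 0]) auto
  also have "(\<Sum>i\<in>{..p} - {0}. (-1) ^ i * int (b i)) = (\<Sum>i | i \<ge> 1 \<and> b i \<noteq> 0. (-1) ^ i * int (b i))"
  proof (rule sum.mono_neutral_right)
    show "{i. i \<ge> 1 \<and> b i \<noteq> 0} \<subseteq> {..p} - {0}"
    proof
      fix i assume "i \<in> {i. i \<ge> 1 \<and> b i \<noteq> 0}"
      then show "i \<in> {..p} - {0}" using p[of i] by (cases "i \<le> p") auto
    qed
  qed auto
  finally show ?thesis
    using resolution_rank_0[OF res[unfolded I_def] P(1,2)] by (simp add: b_def)
qed

section \<open>Krull dimension of the quotient by the cover ideal\<close>

lemma quot_simps:
  assumes "ideal I (polyring :: ('v, 'k::field) mpoly ring)"
  shows "carrier (polyring Quot I) = range (\<lambda>f. I +>\<^bsub>polyring\<^esub> f)"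
    and "(I +>\<^bsub>polyring\<^esub> f) \<otimes>\<^bsub>polyring Quot I\<^esub> (I +>\<^bsub>polyring\<^esub> g) = I +>\<^bsub>polyring\<^esub> (f * g)"
    and "(I +>\<^bsub>polyring\<^esub> f) \<oplus>\<^bsub>polyring Quot I\<^esub> (I +>\<^bsub>polyring\<^esub> g) = I +>\<^bsub>polyring\<^esub> (f + g)"
    and "\<one>\<^bsub>polyring Quot I\<^esub> = I +>\<^bsub>polyring\<^esub> 1"
    and "\<zero>\<^bsub>polyring Quot I\<^esub> = I +>\<^bsub>polyring\<^esub> 0"
    and "I +>\<^bsub>polyring\<^esub> f = I +>\<^bsub>polyring\<^esub> g \<longleftrightarrow> f - g \<in> I"
proof -
  interpret ideal I "polyring :: ('v, 'k) mpoly ring" by (rule assms)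
  note hom = rcos_ring_hom
  show "carrier (polyring Quot I) = range (\<lambda>f. I +>\<^bsub>polyring\<^esub> f)"
    by (auto simp: FactRing_def A_RCOSETS_def')
  show "(I +>\<^bsub>polyring\<^esub> f) \<otimes>\<^bsub>polyring Quot I\<^esub> (I +>\<^bsub>polyring\<^esub> g) = I +>\<^bsub>polyring\<^esub> (f * g)"
    using ring_hom_mult[OF hom, of f g] by simp
  show "(I +>\<^bsub>polyring\<^esub> f) \<oplus>\<^bsub>polyring Quot I\<^esub> (I +>\<^bsub>polyring\<^esub> g) = I +>\<^bsub>polyring\<^esub> (f + g)"
    using ring_hom_add[OF hom, of f g] by simp
  show "\<one>\<^bsub>polyring Quot I\<^esub> = I +>\<^bsub>polyring\<^esub> 1" using ring_hom_one[OF hom] by simp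
  show "\<zero>\<^bsub>polyring Quot I\<^esub> = I +>\<^bsub>polyring\<^esub> 0"
    using ring_hom_zero[OF hom ring_polyring quotient_is_ring] by simp
  show "I +>\<^bsub>polyring\<^esub> f = I +>\<^bsub>polyring\<^esub> g \<longleftrightarrow> f - g \<in> I"
    using quotient_eq_iff_same_a_r_cos[OF is_ideal, of f g] by (simp add: a_minus_def)
qed

lemma quot_coset_zero_iff:
  assumes "ideal I (polyring :: ('v, 'k::field) mpoly ring)"
  shows "I +>\<^bsub>polyring\<^esub> f = I +>\<^bsub>polyring\<^esub> 0 \<longleftrightarrow> f \<in> I"
  using quot_simps(6)[OF assms, of f 0] by simp

lemma primeideal_polyring_iff:
  "primeideal P (polyring :: ('v, 'k::field) mpoly ring) \<longleftrightarrow>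
     ideal P polyring \<and> 1 \<notin> P \<and> (\<forall>f g. f * g \<in> P \<longrightarrow> f \<in> P \<or> g \<in> P)" (is "?L \<longleftrightarrow> ?R")
proof
  assume ?L
  then interpret primeideal P "polyring :: ('v, 'k) mpoly ring" .
  show ?R using is_ideal I_notcarr I_prime one_imp_carrier by auto
next
  assume R: ?R
  then show ?L by (intro primeidealI cring_polyring) auto
qed

section \<open>Chains of primes in a quotient and above the ideal\<close>

lemma prime_chain_pullback:
  assumes I: "ideal I (polyring :: ('v, 'k::field) mpoly ring)"
    and Q: "prime_chain (polyring Quot I) k Q"
  shows "\<exists>P. prime_chain polyring k P \<and> I \<subseteq> P 0"
proof (intro exI conjI)
  let ?p = "\<lambda>f. I +>\<^bsub>polyring\<^esub> f"
  let ?P = "\<lambda>i. {f. ?p f \<in> Q i}"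
  have prime: "primeideal (Q i) (polyring Quot I)" if "i \<le> k" for i
    using Q that by (simp add: prime_chain_def)
  have "primeideal (?P i) polyring" if "i \<le> k" for i
    using ring_hom_ring.primeideal_vimage[OF ideal.rcos_ring_hom_ring[OF I] cring_polyring prime[OF that]]
    by simp
  moreover have "?P i \<subset> ?P (Suc i)" if i: "i < k" for i
  proof -
    have sub: "Q i \<subset> Q (Suc i)" using Q i by (simp add: prime_chain_def)
    then obtain z where z: "z \<in> Q (Suc i)" "z \<notin> Q i" by blast
    interpret primeideal "Q (Suc i)" "polyring Quot I" using i by (intro prime) simp
    obtain f where "z = ?p f" using z(1) Icarr quot_simps(1)[OF I] by auto
    then show ?thesis using sub z by blast
  qed
  ultimately show "prime_chain polyring k ?P" by (simp add: prime_chain_def)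
  interpret primeideal "Q 0" "polyring Quot I" by (intro prime) simp
  have "?p 0 \<in> Q 0" using additive_subgroup.zero_closed[OF is_additive_subgroup] quot_simps(5)[OF I] by simp
  moreover have "?p f = ?p 0" if "f \<in> I" for f using that quot_coset_zero_iff[OF I] by blast
  ultimately show "I \<subseteq> ?P 0" by auto
qed

lemma prime_chain_pushforward:
  assumes I: "ideal I (polyring :: ('v, 'k::field) mpoly ring)"
    and P: "prime_chain polyring k P" "I \<subseteq> P 0"
  shows "\<exists>Q. prime_chain (polyring Quot I) k Q"
proof
  let ?p = "\<lambda>f. I +>\<^bsub>polyring\<^esub> f"
  let ?Q = "\<lambda>i. ?p ` P i"
  have sub: "I \<subseteq> P i" if "i \<le> k" for i
    using that
  proof (induction i)
    case (Suc i)
    then have "P i \<subset> P (Suc i)" using P(1) by (simp add: prime_chain_def)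
    then show ?case using Suc by auto
  qed (use P in simp)
  have prime: "primeideal (P i) polyring" if "i \<le> k" for i
    using P that by (simp add: prime_chain_def)
  have mem: "?p f \<in> ?Q i \<longleftrightarrow> f \<in> P i" if i: "i \<le> k" for i f
  proof
    assume "?p f \<in> ?Q i"
    then obtain g where g: "g \<in> P i" "?p f = ?p g" by blast
    then have "f - g \<in> P i" using sub[OF i] quot_simps(6)[OF I] by blast
    then have "(f - g) + g \<in> P i" using g(1) prime[OF i] unfolding primeideal_polyring_iff ideal_polyring_iff by blast
    then show "f \<in> P i" by simp
  qed simp
  have "primeideal (?Q i) (polyring Quot I)" if i: "i \<le> k" for i
  proof (rule primeidealI)
    have P': "ideal (P i) polyring" "1 \<notin> P i" "\<And>f g. f * g \<in> P i \<Longrightarrow> f \<in> P i \<or> g \<in> P i"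
      using prime[OF i] by (auto simp: primeideal_polyring_iff)
    interpret Q: ring "polyring Quot I" by (rule ideal.quotient_is_ring[OF I])
    show "cring (polyring Quot I)" by (rule ideal.quotient_is_cring[OF I cring_polyring])
    show "ideal (?Q i) (polyring Quot I)"
    proof (rule idealI[OF Q.ring_axioms])
      show "subgroup (?Q i) (add_monoid (polyring Quot I))"
      proof (rule Q.add.subgroupI)
        show "?Q i \<subseteq> carrier (polyring Quot I)" by (auto simp: quot_simps(1)[OF I])
        show "?Q i \<noteq> {}" using P'(1) by (auto simp: ideal_polyring_iff)
        show "x \<oplus>\<^bsub>polyring Quot I\<^esub> y \<in> ?Q i" if "x \<in> ?Q i" "y \<in> ?Q i" for x y
          using that P'(1) by (auto simp: quot_simps(3)[OF I] ideal_polyring_iff)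
        show "\<ominus>\<^bsub>polyring Quot I\<^esub> x \<in> ?Q i" if x: "x \<in> ?Q i" for x
        proof -
          obtain f where f: "x = ?p f" "f \<in> P i" using x by blast
          have "- f \<in> P i" using P'(1) f(2) unfolding ideal_polyring_iff by (metis mult_minus1)
          moreover have "?p (- f) \<oplus>\<^bsub>polyring Quot I\<^esub> ?p f = \<zero>\<^bsub>polyring Quot I\<^esub>"
            by (simp add: quot_simps[OF I])
          then have "\<ominus>\<^bsub>polyring Quot I\<^esub> ?p f = ?p (- f)"
            by (intro Q.minus_equality) (auto simp: quot_simps(1)[OF I])
          ultimately show ?thesis using f(1) by auto
        qed
      qed
    qed (use P'(1) in \<open>auto simp: quot_simps[OF I] ideal_polyring_iff mult.commute\<close>)
    show "carrier (polyring Quot I) \<noteq> ?Q i"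
      using mem[OF i, of 1] P'(2) by (auto simp: quot_simps(1)[OF I])
    show "x \<in> ?Q i \<or> y \<in> ?Q i"
      if xy: "x \<in> carrier (polyring Quot I)" "y \<in> carrier (polyring Quot I)" "x \<otimes>\<^bsub>polyring Quot I\<^esub> y \<in> ?Q i" for x y
    proof -
      obtain f g where fg: "x = ?p f" "y = ?p g" using xy by (auto simp: quot_simps(1)[OF I])
      then have "f * g \<in> P i" using xy(3) mem[OF i] by (simp add: quot_simps(2)[OF I])
      then show ?thesis using P'(3) fg by blast
    qed
  qed
  moreover have "?Q i \<subset> ?Q (Suc i)" if i: "i < k" for i
  proof -
    have sub: "P i \<subset> P (Suc i)" using P i by (simp add: prime_chain_def)
    then obtain f where f: "f \<in> P (Suc i)" "f \<notin> P i" by blast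
    have "?p f \<notin> ?Q i" using mem[of i f] i f(2) by simp
    moreover have "?p f \<in> ?Q (Suc i)" using f(1) by simp
    moreover have "?Q i \<subseteq> ?Q (Suc i)" using sub by (intro image_mono) simp
    ultimately show ?thesis by blast
  qed
  ultimately show "prime_chain (polyring Quot I) k ?Q" by (simp add: prime_chain_def)
qed

text \<open>The lowest term of a polynomial relation in \<open>a 0, a 1, \<dots>\<close>, with respect to the
  lexicographic order, cannot be cancelled along the chain.\<close>

lemma prime_chain_independent:
  fixes a :: "nat \<Rightarrow> ('v, 'k::field) mpoly"
  assumes "prime_chain polyring k P"
    and "\<And>i. i < k \<Longrightarrow> a i \<in> P (Suc i) - P i"
    and "\<exists>es\<in>{es. set es \<subseteq> {..<t} \<and> length es = k}. c es \<noteq> 0"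
  shows "(\<Sum>es | set es \<subseteq> {..<t} \<and> length es = k. Const (c es) * (\<Prod>i<k. a i ^ (es ! i))) \<notin> P 0"
  using assms
proof (induction k arbitrary: P a c)
  case 0
  have P: "ideal (P 0) polyring" "1 \<notin> P 0"
    using 0(1) by (auto simp: prime_chain_def primeideal_polyring_iff)
  have "{es :: nat list. set es \<subseteq> {..<t} \<and> length es = 0} = {[]}" by auto
  moreover have "Const (c []) \<notin> P 0"
  proof
    assume "Const (c []) \<in> P 0"
    then have "Const (1 / c []) * Const (c []) \<in> P 0" using P(1) by (simp add: ideal_polyring_iff)
    moreover have "c [] \<noteq> 0" using 0(3) by auto
    ultimately show False using P(2) by (simp add: Const_def mult_single)
  qed
  ultimately show ?case by simp
next
  case (Suc k)
  let ?L = "{es. set es \<subseteq> {..<t} \<and> length es = k}"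
  have fin: "finite ?L" by (rule finite_lists_length_eq) simp
  define G where "G e = (\<Sum>es\<in>?L. Const (c (e # es)) * (\<Prod>i<k. a (Suc i) ^ (es ! i)))" for e
  have P0: "ideal (P 0) polyring" "1 \<notin> P 0" "\<And>f g. f * g \<in> P 0 \<Longrightarrow> f \<in> P 0 \<or> g \<in> P 0"
    and P1: "ideal (P 1) polyring" and sub: "P 0 \<subset> P 1"
    using Suc.prems(1) by (auto simp: prime_chain_def primeideal_polyring_iff)
  have a0: "a 0 \<in> P 1" "a 0 \<notin> P 0" using Suc.prems(2)[of 0] by auto
  have "(\<Sum>es | set es \<subseteq> {..<t} \<and> length es = Suc k. Const (c es) * (\<Prod>i<Suc k. a i ^ (es ! i)))
    = (\<Sum>(e, es)\<in>{..<t} \<times> ?L. Const (c (e # es)) * (\<Prod>i<Suc k. a i ^ ((e # es) ! i)))"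
    by (rule sum.reindex_bij_witness[of _ "\<lambda>(e, es). e # es" "\<lambda>es. (hd es, tl es)"])
      (auto simp: length_Suc_conv)
  also have "\<dots> = (\<Sum>e<t. \<Sum>es\<in>?L. a 0 ^ e * (Const (c (e # es)) * (\<Prod>i<k. a (Suc i) ^ (es ! i))))"
    by (subst sum.cartesian_product) (auto simp: prod.lessThan_Suc_shift mult.left_commute simp del: prod.lessThan_Suc intro!: sum.cong)
  also have "\<dots> = (\<Sum>e<t. a 0 ^ e * G e)" by (simp add: G_def sum_distrib_left)
  finally have total: "(\<Sum>es | set es \<subseteq> {..<t} \<and> length es = Suc k. Const (c es) * (\<Prod>i<Suc k. a i ^ (es ! i)))
    = (\<Sum>e<t. a 0 ^ e * G e)" .
  \<comment> \<open>The lowest exponent of \<open>a 0\<close> that occurs. The cofactor of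
    \<open>a 0 ^ j\<close> is \<open>G j\<close> modulo \<open>a 0\<close>, and \<open>G j\<close>
    lies outside \<open>P 1\<close> by induction, while \<open>a 0\<close> lies in it.\<close>
  define j where "j = (LEAST e. e < t \<and> (\<exists>es\<in>?L. c (e # es) \<noteq> 0))"
  obtain es0 where "set es0 \<subseteq> {..<t}" "length es0 = Suc k" "c es0 \<noteq> 0" using Suc.prems(3) by blast
  then have "\<exists>e. e < t \<and> (\<exists>es\<in>?L. c (e # es) \<noteq> 0)"
    by (cases es0) auto
  then have "j < t \<and> (\<exists>es\<in>?L. c (j # es) \<noteq> 0)" unfolding j_def by (rule LeastI_ex)
  then have j: "j < t" "\<exists>es\<in>?L. c (j # es) \<noteq> 0" by blast+
  have below: "G e = 0" if "e < j" for e
    unfolding G_def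
  proof (rule sum.neutral, rule ballI)
    fix es assume "es \<in> ?L"
    then have "c (e # es) = 0" using not_less_Least[of e "\<lambda>e. e < t \<and> (\<exists>es\<in>?L. c (e # es) \<noteq> 0)"] that j(1)
      unfolding j_def[symmetric] by force
    then show "Const (c (e # es)) * (\<Prod>i<k. a (Suc i) ^ (es ! i)) = 0" by (simp add: Const_def)
  qed
  define R where "R = (\<Sum>e\<in>{Suc j..<t}. a 0 ^ (e - Suc j) * G e)"
  have "(\<Sum>e<t. a 0 ^ e * G e) = (\<Sum>e\<in>{j..<t}. a 0 ^ e * G e)"
    by (rule sum.mono_neutral_right) (auto simp: below)
  also have "\<dots> = a 0 ^ j * G j + (\<Sum>e\<in>{Suc j..<t}. a 0 ^ e * G e)"
    using j(1) by (simp add: sum.atLeast_Suc_lessThan)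
  also have "(\<Sum>e\<in>{Suc j..<t}. a 0 ^ e * G e) = a 0 ^ j * (a 0 * R)"
    unfolding R_def sum_distrib_left
    by (rule sum.cong) (auto simp: mult.assoc[symmetric] power_add[symmetric] power_Suc2[symmetric] simp del: power_Suc)
  finally have factored: "(\<Sum>e<t. a 0 ^ e * G e) = a 0 ^ j * (G j + a 0 * R)" by (simp add: distrib_left)
  have "prime_chain polyring k (\<lambda>i. P (Suc i))" using Suc.prems(1) by (simp add: prime_chain_def)
  then have GP: "G j \<notin> P 1"
    unfolding G_def using Suc.IH[of "\<lambda>i. P (Suc i)" "\<lambda>i. a (Suc i)" "\<lambda>es. c (j # es)"] Suc.prems(2) j(2) by simp
  have pow: "a 0 ^ e \<notin> P 0" for e
    by (induction e) (use P0 a0 in auto)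
  show ?case
    unfolding total factored
  proof
    assume "a 0 ^ j * (G j + a 0 * R) \<in> P 0"
    then have "G j + a 0 * R \<in> P 1" using P0(3) pow sub by blast
    moreover have "- R * a 0 \<in> P 1" using P1 a0(1) by (simp only: ideal_polyring_iff)
    ultimately have "(G j + a 0 * R) + (- R * a 0) \<in> P 1" using P1 by (simp only: ideal_polyring_iff)
    then show False using GP by (simp add: mult.commute)
  qed
qed

section \<open>Upper bound for the length of prime chains by counting monomials\<close>

lemma card_bounded_monomials:
  fixes A :: "'v::finite set"
  shows "finite {m :: 'v \<Rightarrow>\<^sub>0 nat. mdeg m \<le> l \<and> keys m \<subseteq> A}"
    and "card {m :: 'v \<Rightarrow>\<^sub>0 nat. mdeg m \<le> l \<and> keys m \<subseteq> A} \<le> (l + 1) ^ card A"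
proof -
  let ?M = "{m :: 'v \<Rightarrow>\<^sub>0 nat. mdeg m \<le> l \<and> keys m \<subseteq> A}"
  let ?F = "\<Pi>\<^sub>E v\<in>A. {..l}"
  have inj: "inj_on (\<lambda>m. restrict (lookup m) A) ?M"
  proof (rule inj_onI)
    fix m m' :: "'v \<Rightarrow>\<^sub>0 nat" assume m: "m \<in> ?M" "m' \<in> ?M" "restrict (lookup m) A = restrict (lookup m') A"
    show "m = m'"
    proof (rule poly_mapping_eqI)
      fix v show "lookup m v = lookup m' v"
      proof (cases "v \<in> A")
        case True
        have "restrict (lookup m) A v = restrict (lookup m') A v" by (simp only: m(3))
        then show ?thesis using True by simp
      next
        case False
        then have "v \<notin> keys m" "v \<notin> keys m'" using m(1,2) by auto
        then show ?thesis by (simp add: in_keys_iff)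
      qed
    qed
  qed
  have sub: "(\<lambda>m. restrict (lookup m) A) ` ?M \<subseteq> ?F"
  proof -
    have "lookup m v \<le> mdeg m" for m :: "'v \<Rightarrow>\<^sub>0 nat" and v
      unfolding mdeg_eq_sum by (rule member_le_sum) auto
    then have "lookup m v \<le> l" if "m \<in> ?M" for m v using that order_trans by blast
    then show ?thesis by auto
  qed
  have fin: "finite ?F" by (intro finite_PiE) auto
  show "finite ?M" using inj sub fin by (meson finite_imageD finite_subset)
  have "card ?M \<le> card ?F" using inj sub fin by (intro card_inj_on_le) auto
  then show "card ?M \<le> (l + 1) ^ card A" by (simp add: card_PiE)
qed

lemma mdeg_bound_times:
  fixes f g :: "('v::finite, 'k::field) mpoly"
  assumes "\<forall>m\<in>keys f. mdeg m \<le> s" "\<forall>m\<in>keys g. mdeg m \<le> t"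
  shows "\<forall>m\<in>keys (f * g). mdeg m \<le> s + t"
  using keys_mult[of f g] assms by (fastforce simp: mdeg_add intro: add_mono)

lemma mdeg_bound_power:
  fixes f :: "('v::finite, 'k::field) mpoly"
  assumes "\<forall>m\<in>keys f. mdeg m \<le> s"
  shows "\<forall>m\<in>keys (f ^ e). mdeg m \<le> e * s"
proof (induction e)
  case (Suc e)
  show ?case using mdeg_bound_times[OF assms Suc] by simp
qed (simp add: mdeg_def)

lemma mdeg_bound_prod:
  fixes f :: "nat \<Rightarrow> ('v::finite, 'k::field) mpoly"
  assumes "\<And>i. i < k \<Longrightarrow> \<forall>m\<in>keys (f i). mdeg m \<le> s"
  shows "\<forall>m\<in>keys (\<Prod>i<k. f i). mdeg m \<le> k * s"
  using assms
proof (induction k)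
  case (Suc k)
  have "\<forall>m\<in>keys (\<Prod>i<k. f i). mdeg m \<le> k * s" by (intro Suc.IH Suc.prems) simp
  then have "\<forall>m\<in>keys ((\<Prod>i<k. f i) * f k). mdeg m \<le> k * s + s"
    by (rule mdeg_bound_times) (intro Suc.prems lessI)
  then show ?case by (simp add: add.commute)
qed (simp add: mdeg_def)

lemma lookup_Const_times: "lookup (Const c * f) m = c * lookup f m"
  using lookup_single_times[of 0 c f m] by (simp add: Const_def)

text \<open>A chain of length \<open>n + 1\<close> with \<open>n = CARD('v) - 2\<close> gives
  \<open>t^(n+1)\<close> products of powers of the \<open>a i\<close> with exponents below
  \<open>t\<close>. Their degrees are linear in \<open>t\<close>, and a monomial outside the ideal
  avoids some edge, so only of the order of \<open>t^n\<close> such monomials are available. For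
  suitable \<open>t\<close> a nontrivial combination of the products lies in the ideal, which
  \<open>prime_chain_independent\<close> excludes.\<close>

lemma prime_chain_length:
  fixes E :: "'v::finite set set"
  assumes simple: "simple_graph E"
    and P: "prime_chain (polyring :: ('v, 'k::field) mpoly ring) k P" "supp_ideal (vertex_cover E) \<subseteq> P 0"
  shows "k \<le> CARD('v) - 2"
proof (rule ccontr)
  define n where "n = CARD('v) - 2"
  assume "\<not> k \<le> CARD('v) - 2"
  then have nk: "Suc n \<le> k" by (simp add: n_def)
  then have chain: "prime_chain polyring (Suc n) P" using P(1) by (simp add: prime_chain_def)
  have "\<exists>f. f \<in> P (Suc i) - P i" if "i < Suc n" for i
    using chain that by (fastforce simp: prime_chain_def)
  then have "\<forall>i. \<exists>f. i < Suc n \<longrightarrow> f \<in> P (Suc i) - P i" by blast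
  then obtain a where a: "\<And>i. i < Suc n \<Longrightarrow> a i \<in> P (Suc i) - P i" by (metis choice)
  define D where "D = Max (mdeg ` (\<Union>i<Suc n. keys (a i)) \<union> {0})"
  have D: "\<forall>m\<in>keys (a i). mdeg m \<le> D" if "i < Suc n" for i
    unfolding D_def using that by (intro ballI Max_ge) auto
  \<comment> \<open>\<open>L\<close> bounds the degrees of the products and
    \<open>L + 1 \<le> B * t\<close>; the choice of \<open>t\<close> makes
    \<open>card E * (B * t)^n\<close> smaller than \<open>t^(n+1)\<close>.\<close>
  define B where "B = Suc n * D + 1"
  define t where "t = card E * B ^ n + 1"
  define L where "L = Suc n * (t * D)"
  define S where "S = {es :: nat list. set es \<subseteq> {..<t} \<and> length es = Suc n}"
  define M where "M = {m :: 'v \<Rightarrow>\<^sub>0 nat. mdeg m \<le> L \<and> \<not> vertex_cover E (keys m)}"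
  define F where "F es = (\<Prod>i<Suc n. a i ^ (es ! i))" for es
  have finS: "finite S" unfolding S_def by (rule finite_lists_length_eq) simp
  have cardS: "card S = t ^ Suc n" by (simp add: S_def card_lists_length_eq del: power_Suc)
  have Msub: "M \<subseteq> (\<Union>e\<in>E. {m. mdeg m \<le> L \<and> keys m \<subseteq> - e})"
    by (auto simp: M_def vertex_cover_def)
  have finM: "finite M" by (rule finite_subset[OF Msub]) (auto intro: card_bounded_monomials)
  have "card M \<le> card (\<Union>e\<in>E. {m :: 'v \<Rightarrow>\<^sub>0 nat. mdeg m \<le> L \<and> keys m \<subseteq> - e})"
    using Msub by (rule card_mono[rotated]) (auto intro: card_bounded_monomials)
  also have "\<dots> \<le> (\<Sum>e\<in>E. card {m :: 'v \<Rightarrow>\<^sub>0 nat. mdeg m \<le> L \<and> keys m \<subseteq> - e})"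
    by (rule card_UN_le) simp
  also have "\<dots> \<le> (\<Sum>e\<in>E. (L + 1) ^ n)"
  proof (rule sum_mono)
    fix e assume "e \<in> E"
    then have "card (- e) = n" using simple
      by (simp add: n_def simple_graph_def Compl_eq_Diff_UNIV card_Diff_subset)
    then show "card {m :: 'v \<Rightarrow>\<^sub>0 nat. mdeg m \<le> L \<and> keys m \<subseteq> - e} \<le> (L + 1) ^ n"
      using card_bounded_monomials(2)[of L "- e"] by simp
  qed
  also have "\<dots> = card E * (L + 1) ^ n" by simp
  also have "\<dots> \<le> card E * (B * t) ^ n"
  proof -
    have "L + 1 \<le> B * t" by (simp add: L_def B_def t_def algebra_simps)
    then show ?thesis by (intro mult_left_mono power_mono) auto
  qed
  also have "\<dots> = (card E * B ^ n) * t ^ n" by (simp add: power_mult_distrib)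
  also have "\<dots> < t * t ^ n" by (rule mult_strict_right_mono) (simp_all add: t_def)
  finally have "card M < card S" by (simp add: cardS)
  from linear_dependence[OF finM finS this, of "\<lambda>es m. lookup (F es) m"]
  obtain c where c: "\<exists>es\<in>S. c es \<noteq> 0" "\<And>m. m \<in> M \<Longrightarrow> (\<Sum>es\<in>S. c es * lookup (F es) m) = 0" by blast
  have lookup_sum: "lookup (\<Sum>es\<in>S. Const (c es) * F es) m = (\<Sum>es\<in>S. c es * lookup (F es) m)" for m
    by (simp add: Poly_Mapping.lookup_sum lookup_Const_times)
  have "(\<Sum>es\<in>S. Const (c es) * F es) \<in> supp_ideal (vertex_cover E)"
    unfolding supp_ideal_def mem_Collect_eq
  proof
    fix m assume m: "m \<in> keys (\<Sum>es\<in>S. Const (c es) * F es)"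
    then have ne: "(\<Sum>es\<in>S. c es * lookup (F es) m) \<noteq> 0" by (simp add: in_keys_iff lookup_sum)
    then obtain es where es: "es \<in> S" "c es * lookup (F es) m \<noteq> 0" by (meson sum.neutral)
    then have "m \<in> keys (F es)" by (auto simp: in_keys_iff)
    moreover have "\<forall>m\<in>keys (F es). mdeg m \<le> Suc n * (t * D)"
      unfolding F_def
    proof (rule mdeg_bound_prod)
      fix i assume i: "i < Suc n"
      then have "es ! i < t" using es(1) unfolding S_def by (metis (mono_tags, lifting) lessThan_iff mem_Collect_eq nth_mem subsetD)
      then have "es ! i * D \<le> t * D" by (intro mult_right_mono) auto
      then show "\<forall>m\<in>keys (a i ^ (es ! i)). mdeg m \<le> t * D"
        using mdeg_bound_power[OF D[OF i], of "es ! i"] by (meson order_trans)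
    qed
    ultimately have "mdeg m \<le> L" by (simp add: L_def)
    then show "vertex_cover E (keys m)" using c(2)[of m] ne by (auto simp: M_def)
  qed
  then have "(\<Sum>es\<in>S. Const (c es) * F es) \<in> P 0" using P(2) by blast
  then show False
    using prime_chain_independent[OF chain a c(1)[unfolded S_def]] by (simp add: S_def F_def)
qed

text \<open>A linear order on the variables induces one on the exponent vectors, and with it the
  polynomial ring has no zero divisors. This makes \<open>primeideal_variables\<close> applicable to
  the vertex type \<open>'n + 'n\<close>.\<close>

instantiation sum :: (linorder, linorder) linorder
begin

definition less_eq_sum :: "'a + 'b \<Rightarrow> 'a + 'b \<Rightarrow> bool" where
  "less_eq_sum u v = (case (u, v) of (Inl a, Inl b) \<Rightarrow> a \<le> b | (Inl a, Inr b) \<Rightarrow> True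
     | (Inr a, Inl b) \<Rightarrow> False | (Inr a, Inr b) \<Rightarrow> a \<le> b)"

definition less_sum :: "'a + 'b \<Rightarrow> 'a + 'b \<Rightarrow> bool" where
  "less_sum u v \<longleftrightarrow> u \<le> v \<and> \<not> v \<le> u"

instance
  by standard (auto simp: less_eq_sum_def less_sum_def split: sum.splits)

end

text \<open>Modulo this ideal a polynomial equals its part without the variables in
  \<open>Z\<close>. A product of two such parts again avoids \<open>Z\<close>, so it lies in the
  ideal only if it is zero.\<close>

lemma primeideal_variables:
  fixes Z :: "'v::{finite, linorder} set"
  shows "primeideal (supp_ideal (\<lambda>A. A \<inter> Z \<noteq> {}) :: ('v, 'k::field) mpoly set) polyring"
  unfolding primeideal_polyring_iff
proof (intro conjI allI impI)
  let ?P = "supp_ideal (\<lambda>A. A \<inter> Z \<noteq> {}) :: ('v, 'k) mpoly set"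
  have mono: "mono (\<lambda>A. A \<inter> Z \<noteq> {})" by (auto simp: mono_def)
  then show "ideal ?P polyring" by (rule ideal_supp_ideal)
  show "1 \<notin> ?P" by (simp add: supp_ideal_def)
  have split: "\<exists>h. f - h \<in> ?P \<and> (\<forall>m\<in>keys h. keys m \<inter> Z = {})" for f :: "('v, 'k) mpoly"
  proof (intro exI conjI)
    let ?h = "\<Sum>m | m \<in> keys f \<and> keys m \<inter> Z = {}. single m (lookup f m)"
    show "\<forall>m\<in>keys ?h. keys m \<inter> Z = {}"
      using keys_sum[of "\<lambda>m. single m (lookup f m)"] by (auto split: if_splits dest!: subsetD)
    have "f = (\<Sum>m\<in>keys f. single m (lookup f m))" by (rule poly_mapping_expand)
    also have "\<dots> = (\<Sum>m | m \<in> keys f \<and> keys m \<inter> Z \<noteq> {}. single m (lookup f m)) + ?h"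
      by (subst sum.union_disjoint[symmetric]) (auto intro!: sum.cong)
    finally have "f - ?h = (\<Sum>m | m \<in> keys f \<and> keys m \<inter> Z \<noteq> {}. single m (lookup f m))"
      unfolding diff_eq_eq .
    also have "\<dots> \<in> ?P" by (rule supp_ideal_sum) (auto simp: supp_ideal_def)
    finally show "f - ?h \<in> ?P" .
  qed
  fix f g :: "('v, 'k) mpoly" assume fg: "f * g \<in> ?P"
  obtain f' g' where f': "f - f' \<in> ?P" "\<forall>m\<in>keys f'. keys m \<inter> Z = {}"
    and g': "g - g' \<in> ?P" "\<forall>m\<in>keys g'. keys m \<inter> Z = {}" using split by metis
  have "f * g - (f - f') * g - f' * (g - g') \<in> ?P"
    by (intro supp_ideal_diff fg supp_ideal_times(2)[OF mono f'(1)] supp_ideal_times(1)[OF mono g'(1)])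
  then have "f' * g' \<in> ?P" by (simp add: algebra_simps)
  moreover have "\<forall>m\<in>keys (f' * g'). keys m \<inter> Z = {}"
    using keys_mult[of f' g'] f'(2) g'(2) by (fastforce simp: keys_add_nat)
  ultimately have "keys (f' * g') = {}" unfolding supp_ideal_def by blast
  then have "f' = 0 \<or> g' = 0" by simp
  then show "f \<in> ?P \<or> g \<in> ?P" using f'(1) g'(1) by auto
qed

lemma krull_dim_cover_ideal:
  fixes E :: "'v::{finite, linorder} set set"
  assumes simple: "simple_graph E" and "E \<noteq> {}"
  shows "krull_dim (polyring Quot (cover_ideal E :: ('v, 'k::field) mpoly set)) = enat (CARD('v) - 2)"
proof -
  let ?I = "supp_ideal (vertex_cover E) :: ('v, 'k) mpoly set"
  let ?n = "CARD('v) - 2"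
  have I: "ideal ?I polyring" by (rule ideal_supp_ideal[OF vertex_cover_mono])
  obtain e where e: "e \<in> E" using assms(2) by blast
  have "card (- e) = ?n" using simple e
    by (simp add: simple_graph_def Compl_eq_Diff_UNIV card_Diff_subset)
  then obtain vs where vs: "set vs = - e" "distinct vs" "length vs = ?n"
    using finite_distinct_list[of "- e"] by (metis distinct_card finite)
  \<comment> \<open>Every cover meets \<open>e\<close>, so the prime generated by the two variables
    of \<open>e\<close> contains the cover ideal; the other variables are added one at a
    time.\<close>
  define P where "P i = (supp_ideal (\<lambda>A. A \<inter> (e \<union> set (take i vs)) \<noteq> {}) :: ('v, 'k) mpoly set)" for i
  have "P i \<subset> P (Suc i)" if i: "i < ?n" for i
  proof -
    have "set (take i vs) \<subseteq> set (take (Suc i) vs)" by (rule set_take_subset_set_take) simp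
    then have "P i \<subseteq> P (Suc i)" unfolding P_def supp_ideal_def by blast
    moreover have "vs ! i \<notin> e \<union> set (take i vs)"
      using vs i nth_mem[of i vs] by (auto simp: in_set_conv_nth nth_eq_iff_index_eq)
    then have "Var (vs ! i) \<notin> P i" by (simp add: P_def supp_ideal_def Var_def)
    moreover have "Var (vs ! i) \<in> P (Suc i)"
      using i vs by (simp add: P_def supp_ideal_def Var_def take_Suc_conv_app_nth)
    ultimately show ?thesis by blast
  qed
  then have "prime_chain polyring ?n P"
    unfolding prime_chain_def P_def using primeideal_variables by blast
  moreover have "?I \<subseteq> P 0" using e by (auto simp: P_def supp_ideal_def vertex_cover_def)
  ultimately have lower: "\<exists>Q. prime_chain (polyring Quot ?I) ?n Q"
    by (rule prime_chain_pushforward[OF I])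
  have upper: "k \<le> ?n" if "prime_chain (polyring Quot ?I) k Q" for k Q
    using prime_chain_pullback[OF I that] prime_chain_length[OF simple] by blast
  show ?thesis
    unfolding krull_dim_def cover_ideal_eq
  proof (rule antisym)
    show "Sup {enat k |k. \<exists>P. prime_chain (polyring Quot ?I) k P} \<le> enat ?n"
      by (rule Sup_least) (use upper in auto)
    show "enat ?n \<le> Sup {enat k |k. \<exists>P. prime_chain (polyring Quot ?I) k P}"
      by (rule Sup_upper) (use lower in auto)
  qed
qed

section \<open>Hilbert function and multiplicity\<close>

lemma subfield_constants:
  assumes I: "ideal I (polyring :: ('v, 'k::field) mpoly ring)" and "1 \<notin> I"
  shows "subfield {I +>\<^bsub>polyring\<^esub> Const c | c. True} (polyring Quot I)"
proof -
  let ?K = "ring_of_type_algebra :: 'k ring"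
  let ?h = "\<lambda>c :: 'k. I +>\<^bsub>polyring\<^esub> (Const c :: ('v, 'k) mpoly)"
  have K: "field ?K" by (rule field_from_type_algebra)
  have K_simps: "carrier ?K = UNIV" "x \<otimes>\<^bsub>?K\<^esub> y = x * y" "x \<oplus>\<^bsub>?K\<^esub> y = x + y" "\<one>\<^bsub>?K\<^esub> = 1" for x y :: 'k
    by (simp_all add: ring_of_type_algebra_def)
  have const: "Const (x * y) = Const x * (Const y :: ('v, 'k) mpoly)" "Const (x + y) = Const x + (Const y :: ('v, 'k) mpoly)"
    "Const 1 = (1 :: ('v, 'k) mpoly)" for x y :: 'k
    by (simp_all add: Const_def mult_single single_add)
  have "?h \<in> ring_hom ?K (polyring Quot I)"
    by (rule ring_hom_memI) (auto simp: K_simps quot_simps[OF I] const)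
  then have "ring_hom_ring ?K (polyring Quot I) ?h"
    by (intro ring_hom_ringI2 ideal.quotient_is_ring[OF I] ring_from_type_algebra)
  then have "subfield (?h ` carrier ?K) (polyring Quot I)"
  proof (rule ring_hom_ring.img_is_subfield)
    show "subfield (carrier ?K) ?K" by (rule field.carrier_is_subfield[OF K])
    show "\<one>\<^bsub>polyring Quot I\<^esub> \<noteq> \<zero>\<^bsub>polyring Quot I\<^esub>"
      using assms(2) by (simp add: quot_simps[OF I])
  qed
  moreover have "?h ` carrier ?K = {I +>\<^bsub>polyring\<^esub> Const c | c. True}" by (auto simp: K_simps)
  ultimately show ?thesis by simp
qed

text \<open>A monomial outside a monomial ideal is not congruent to a combination of other
  monomials, so each new one enlarges the space by a line.\<close>

lemma dimension_standard_monomials: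
  fixes P :: "'v::finite set \<Rightarrow> bool" and A :: "('v \<Rightarrow>\<^sub>0 nat) set"
  defines "I \<equiv> supp_ideal P :: ('v, 'k::field) mpoly set"
  assumes P: "mono P" and A: "finite A" "\<And>m. m \<in> A \<Longrightarrow> \<not> P (keys m)"
  shows "ring.dimension (polyring Quot I) (card A) {I +>\<^bsub>polyring\<^esub> Const c | c. True}
    {I +>\<^bsub>polyring\<^esub> f | f. keys f \<subseteq> A}"
  using A
proof (induction A rule: finite_induct)
  have I: "ideal I polyring" unfolding I_def by (rule ideal_supp_ideal[OF P])
  interpret ring "polyring Quot I" by (rule ideal.quotient_is_ring[OF I])
  let ?K = "{I +>\<^bsub>polyring\<^esub> Const c | c. True}"
  let ?E = "\<lambda>A. {I +>\<^bsub>polyring\<^esub> f | f. keys f \<subseteq> A}"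
  {
    case empty
    have "?E {} = {\<zero>\<^bsub>polyring Quot I\<^esub>}" by (auto simp: quot_simps[OF I])
    then show ?case using zero_dim[of ?K] by simp
  next
    case (insert m A)
    let ?v = "I +>\<^bsub>polyring\<^esub> single m 1"
    have v: "?v \<notin> ?E A"
    proof
      assume "?v \<in> ?E A"
      then obtain f where f: "keys f \<subseteq> A" "single m 1 - f \<in> I" by (auto simp: quot_simps[OF I])
      have "m \<notin> keys f" using f(1) insert.hyps by blast
      then have "m \<in> keys (single m 1 - f)" by (simp add: in_keys_iff lookup_minus)
      then show False using f(2) insert.prems unfolding I_def supp_ideal_def by blast
    qed
    have ext: "line_extension ?K ?v (?E A) = ?E (insert m A)"
    proof (intro equalityI subsetI)
      fix x assume "x \<in> line_extension ?K ?v (?E A)"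
      then obtain c f where x: "x = (I +>\<^bsub>polyring\<^esub> Const c) \<otimes>\<^bsub>polyring Quot I\<^esub> ?v \<oplus>\<^bsub>polyring Quot I\<^esub> (I +>\<^bsub>polyring\<^esub> f)"
        "keys f \<subseteq> A" unfolding line_extension_mem_iff by blast
      have "keys (Const c * single m 1 + f) \<subseteq> insert m A"
        using x(2) Poly_Mapping.keys_add[of "single m c" f] by (auto simp: Const_def mult_single split: if_splits)
      then show "x \<in> ?E (insert m A)" unfolding x(1) quot_simps[OF I] by blast
    next
      fix x assume "x \<in> ?E (insert m A)"
      then obtain f where f: "x = I +>\<^bsub>polyring\<^esub> f" "keys f \<subseteq> insert m A" by blast
      define g where "g = f - single m (lookup f m)"
      have "keys g \<subseteq> A"
      proof
        fix l assume l: "l \<in> keys g"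
        then have "l \<noteq> m" by (auto simp: g_def in_keys_iff lookup_minus)
        then have "l \<in> keys f" using l by (simp add: g_def in_keys_iff lookup_minus lookup_single_not_eq)
        then show "l \<in> A" using f(2) \<open>l \<noteq> m\<close> by blast
      qed
      moreover have "x = (I +>\<^bsub>polyring\<^esub> Const (lookup f m)) \<otimes>\<^bsub>polyring Quot I\<^esub> ?v \<oplus>\<^bsub>polyring Quot I\<^esub> (I +>\<^bsub>polyring\<^esub> g)"
        by (simp add: quot_simps(2,3)[OF I] f(1) g_def Const_def mult_single)
      ultimately show "x \<in> line_extension ?K ?v (?E A)" unfolding line_extension_mem_iff by blast
    qed
    have "dimension (card A) ?K (?E A)" using insert.prems by (intro insert.IH) simp
    moreover have "?v \<in> carrier (polyring Quot I)" by (simp add: quot_simps(1)[OF I])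
    ultimately have "dimension (Suc (card A)) ?K (line_extension ?K ?v (?E A))"
      by (intro Suc_dim v)
    then show ?case unfolding ext using insert.hyps by simp
  }
qed

lemma finite_mdeg: "finite {m :: 'v::finite \<Rightarrow>\<^sub>0 nat. mdeg m = t \<and> Q m}"
  by (rule finite_subset[OF _ card_bounded_monomials(1)[of t UNIV]]) auto

lemma hilbert_function_supp_ideal:
  fixes P :: "'v::finite set \<Rightarrow> bool"
  assumes P: "mono P" "\<not> P {}"
  shows "hilbert_function (supp_ideal P :: ('v, 'k::field) mpoly set) t = card {m. mdeg m = t \<and> \<not> P (keys m)}"
proof -
  let ?I = "supp_ideal P :: ('v, 'k) mpoly set"
  let ?A = "{m. mdeg m = t \<and> \<not> P (keys m)}"
  have I: "ideal ?I polyring" by (rule ideal_supp_ideal[OF P(1)])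
  interpret ring "polyring Quot ?I" by (rule ideal.quotient_is_ring[OF I])
  have "1 \<notin> ?I" using P(2) by (simp add: supp_ideal_def)
  note K = subfield_constants[OF I this]
  have "{?I +>\<^bsub>polyring\<^esub> f | f. homogeneous t f} = {?I +>\<^bsub>polyring\<^esub> f | f. keys f \<subseteq> ?A}"
  proof (intro equalityI subsetI)
    fix x assume "x \<in> {?I +>\<^bsub>polyring\<^esub> f | f. homogeneous t f}"
    then obtain f where f: "x = ?I +>\<^bsub>polyring\<^esub> f" "homogeneous t f" by blast
    define g where "g = (\<Sum>m | m \<in> keys f \<and> \<not> P (keys m). single m (lookup f m))"
    have "f = (\<Sum>m\<in>keys f. single m (lookup f m))" by (rule poly_mapping_expand)
    also have "\<dots> = (\<Sum>m | m \<in> keys f \<and> P (keys m). single m (lookup f m)) + g"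
      unfolding g_def by (subst sum.union_disjoint[symmetric]) (auto intro!: sum.cong)
    finally have "f - g = (\<Sum>m | m \<in> keys f \<and> P (keys m). single m (lookup f m))"
      unfolding diff_eq_eq .
    also have "\<dots> \<in> ?I" by (rule supp_ideal_sum) (auto simp: supp_ideal_def)
    finally have "x = ?I +>\<^bsub>polyring\<^esub> g" by (simp add: f(1) quot_simps(6)[OF I])
    moreover have "keys g \<subseteq> ?A"
    proof -
      have "keys g \<subseteq> {m. m \<in> keys f \<and> \<not> P (keys m)}"
        unfolding g_def by (rule order_trans[OF keys_sum]) (auto split: if_splits)
      then show ?thesis using f(2) by (auto simp: homogeneous_def)
    qed
    ultimately show "x \<in> {?I +>\<^bsub>polyring\<^esub> f | f. keys f \<subseteq> ?A}" by blast
  qed (auto simp: homogeneous_def)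
  then have "dimension (card ?A) {?I +>\<^bsub>polyring\<^esub> Const c | c. True} {?I +>\<^bsub>polyring\<^esub> f | f. homogeneous t f}"
    using dimension_standard_monomials[OF P(1) finite_mdeg[of t "\<lambda>m. \<not> P (keys m)"]] by simp
  then show ?thesis unfolding hilbert_function_def using dimI[OF K] by (simp add: over_def)
qed

text \<open>Division by the variable \<open>v\<close> either removes \<open>v\<close> from the
  support or keeps it; this is Pascal's rule for the count.\<close>

lemma card_monomials_support_Suc:
  fixes W :: "'v::finite set"
  assumes "v \<in> W"
  shows "card {m. mdeg m = Suc t \<and> keys m = W} = card {m. mdeg m = t \<and> keys m = W - {v}} + card {m. mdeg m = t \<and> keys m = W}"
proof -
  have one: "mdeg (single v 1) = 1" by (simp add: mdeg_def)
  have "{m. mdeg m = Suc t \<and> keys m = W} = (+) (single v 1) ` ({m. mdeg m = t \<and> keys m = W - {v}} \<union> {m. mdeg m = t \<and> keys m = W})"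
  proof (intro equalityI subsetI)
    fix m assume m: "m \<in> {m. mdeg m = Suc t \<and> keys m = W}"
    define m' where "m' = m - single v 1"
    have "lookup m v > 0" using m assms by (auto simp: in_keys_iff)
    then have eq: "m = single v 1 + m'"
      by (intro poly_mapping_eqI) (auto simp: m'_def lookup_add lookup_minus lookup_single when_def)
    have "mdeg m' = t" using m one unfolding eq by (simp add: mdeg_add)
    moreover have "W = insert v (keys m')" using m unfolding eq by (simp add: keys_add_nat)
    then have "keys m' = W - {v} \<or> keys m' = W" by auto
    ultimately show "m \<in> (+) (single v 1) ` ({m. mdeg m = t \<and> keys m = W - {v}} \<union> {m. mdeg m = t \<and> keys m = W})"
      unfolding eq by blast
  next
    fix m assume "m \<in> (+) (single v 1) ` ({m. mdeg m = t \<and> keys m = W - {v}} \<union> {m. mdeg m = t \<and> keys m = W})"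
    then obtain m' where m': "m = single v 1 + m'" "mdeg m' = t" "keys m' = W - {v} \<or> keys m' = W" by blast
    have "mdeg m = Suc t" by (simp only: m'(1,2) mdeg_add one)
    moreover have "keys m = insert v (keys m')" by (simp add: m'(1) keys_add_nat)
    then have "keys m = W" using m'(3) assms by auto
    ultimately show "m \<in> {m. mdeg m = Suc t \<and> keys m = W}" by blast
  qed
  moreover have "inj_on ((+) (single v 1)) S" for S :: "('v \<Rightarrow>\<^sub>0 nat) set" by (simp add: inj_on_def)
  ultimately have "card {m. mdeg m = Suc t \<and> keys m = W}
    = card ({m. mdeg m = t \<and> keys m = W - {v}} \<union> {m. mdeg m = t \<and> keys m = W})" by (simp add: card_image)
  also have "\<dots> = card {m. mdeg m = t \<and> keys m = W - {v}} + card {m. mdeg m = t \<and> keys m = W}"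
    using assms by (intro card_Un_disjoint finite_mdeg) auto
  finally show ?thesis .
qed

text \<open>These are the compositions of \<open>Suc t\<close> into \<open>card W\<close> positive
  parts.\<close>

lemma card_monomials_support:
  fixes W :: "'v::finite set"
  assumes "W \<noteq> {}"
  shows "card {m. mdeg m = Suc t \<and> keys m = W} = t choose (card W - 1)"
  using assms
proof (induction t arbitrary: W)
  case 0
  obtain v where v: "v \<in> W" using 0 by blast
  have zero: "{m :: 'v \<Rightarrow>\<^sub>0 nat. mdeg m = 0 \<and> keys m = A} = (if A = {} then {0} else {})" for A
    by (auto simp: mdeg_eq_0_iff)
  have card: "card W = Suc (card (W - {v}))" using v by (intro card.remove) auto
  show ?case
  proof (cases "W - {v} = {}")
    case True
    have "card W = 1" unfolding card True by simp
    then show ?thesis using True 0 by (simp add: card_monomials_support_Suc[OF v] zero)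
  next
    case False
    then have "card (W - {v}) > 0" by (simp add: card_gt_0_iff)
    then show ?thesis using 0 False card by (simp only: card_monomials_support_Suc[OF v] zero) (simp add: binomial_eq_0)
  qed
next
  case (Suc t)
  obtain v where v: "v \<in> W" using Suc.prems by blast
  have card: "card W = Suc (card (W - {v}))" using v by (intro card.remove) auto
  show ?case
  proof (cases "W - {v} = {}")
    case True
    have "{m :: 'v \<Rightarrow>\<^sub>0 nat. mdeg m = Suc t \<and> keys m = {}} = {}" by (auto simp: mdeg_def)
    moreover have "card W = 1" unfolding card True by simp
    ultimately show ?thesis
      unfolding card_monomials_support_Suc[OF v, of "Suc t"] True Suc.IH[OF Suc.prems] by simp
  next
    case False
    then obtain j where "card (W - {v}) = Suc j" by (metis card_eq_0_iff finite not0_implies_Suc)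
    then show ?thesis
      using card by (simp only: card_monomials_support_Suc[OF v, of "Suc t"] Suc.IH[OF Suc.prems] Suc.IH[OF False]) simp
  qed
qed

lemma card_standard_monomials:
  fixes P :: "'v::finite set \<Rightarrow> bool"
  shows "card {m. mdeg m = Suc t \<and> \<not> P (keys m)} = (\<Sum>W | W \<noteq> {} \<and> \<not> P W. t choose (card W - 1))"
proof -
  have "keys m \<noteq> {}" if "mdeg m = Suc t" for m :: "'v \<Rightarrow>\<^sub>0 nat"
    using that by (auto simp: mdeg_def)
  then have "{m. mdeg m = Suc t \<and> \<not> P (keys m)} = (\<Union>W\<in>{W. W \<noteq> {} \<and> \<not> P W}. {m. mdeg m = Suc t \<and> keys m = W})"
    by auto
  then have "card {m. mdeg m = Suc t \<and> \<not> P (keys m)} = (\<Sum>W | W \<noteq> {} \<and> \<not> P W. card {m. mdeg m = Suc t \<and> keys m = W})"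
    by (simp only:) (rule card_UN_disjoint, auto intro: finite_mdeg)
  then show ?thesis by (simp add: card_monomials_support)
qed

text \<open>By Pascal's rule each shift by one subtracts a combination of lower basis elements, so
  the leading coefficient stays 1. The bound on \<open>t\<close> keeps the subtraction
  exact.\<close>

lemma binomial_basis_shift:
  "\<exists>b :: nat \<Rightarrow> int. b k = 1 \<and> (\<forall>t\<ge>s. int ((t + k - s) choose k) = (\<Sum>i\<le>k. b i * int ((t + i) choose i)))"
proof (induction k arbitrary: s)
  case 0
  show ?case by (rule exI[of _ "\<lambda>_. 1"]) simp
next
  case (Suc k)
  show ?case
  proof (induction s)
    case 0
    show ?case by (rule exI[of _ "\<lambda>i. if i = Suc k then 1 else 0"]) (simp add: if_distrib[of "\<lambda>x. x * _"] cong: if_cong)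
  next
    case (Suc s)
    obtain b where b: "b (Suc k) = 1" "\<And>t. t \<ge> s \<Longrightarrow> int ((t + Suc k - s) choose Suc k) = (\<Sum>i\<le>Suc k. b i * int ((t + i) choose i))"
      using Suc.IH by blast
    obtain c where c: "\<And>t. t \<ge> s \<Longrightarrow> int ((t + k - s) choose k) = (\<Sum>i\<le>k. c i * int ((t + i) choose i))"
      using \<open>\<And>s. \<exists>b. b k = 1 \<and> _ s b\<close> by blast
    define b' where "b' i = b i - (if i \<le> k then c i else 0)" for i
    have "int ((t + Suc k - Suc s) choose Suc k) = (\<Sum>i\<le>Suc k. b' i * int ((t + i) choose i))" if t: "t \<ge> Suc s" for t
    proof -
      have "t + Suc k - s = Suc (t + k - s)" using t by simp
      then have "int ((t + k - s) choose Suc k) = int ((t + Suc k - s) choose Suc k) - int ((t + k - s) choose k)"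
        by simp
      also have "\<dots> = (\<Sum>i\<le>Suc k. b' i * int ((t + i) choose i))"
        using t by (simp only: b(2) c Suc_leD) (simp add: b'_def left_diff_distrib sum_subtractf)
      finally show ?thesis by simp
    qed
    then show ?case using b(1) by (intro exI[of _ b']) (simp add: b'_def)
  qed
qed

text \<open>For positive \<open>i\<close> the difference in \<open>t\<close> of
  \<open>(t + i) choose i\<close> is the same expression for \<open>i - 1\<close>. Taking
  differences thus drops the lowest basis element and keeps the top coefficient.\<close>

lemma binomial_basis_leading_unique:
  fixes c :: "nat \<Rightarrow> int"
  assumes "\<forall>t\<ge>N. (\<Sum>i\<le>k. c i * int ((t + i) choose i)) = 0"
  shows "c k = 0"
  using assms
proof (induction k arbitrary: c N)
  case 0
  then show ?case by auto
next
  case (Suc k)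
  have "(\<Sum>i\<le>k. c (Suc i) * int ((t + i) choose i)) = 0" if t: "t \<ge> Suc N" for t
  proof -
    obtain u where u: "t = Suc u" "u \<ge> N" using t by (cases t) auto
    have "t \<ge> N" using u by simp
    note z = Suc.prems[rule_format, OF this] Suc.prems[rule_format, OF u(2)]
    have "0 = (\<Sum>i\<le>Suc k. c i * int ((t + i) choose i)) - (\<Sum>i\<le>Suc k. c i * int ((u + i) choose i))"
      unfolding z by simp
    also have "\<dots> = (\<Sum>i\<le>Suc k. c i * (int ((t + i) choose i) - int ((u + i) choose i)))"
      by (simp only: right_diff_distrib sum_subtractf)
    also have "\<dots> = (\<Sum>i\<le>k. c (Suc i) * int ((t + i) choose i))"
      unfolding sum.atMost_Suc_shift u(1) by simp
    finally show ?thesis by simp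
  qed
  then show ?case using Suc.IH[of "Suc N" "\<lambda>i. c (Suc i)"] by blast
qed

lemma card_noncover_le:
  fixes E :: "'v::finite set set"
  assumes "simple_graph E" "\<not> vertex_cover E W"
  shows "card W \<le> CARD('v) - 2" and "card W = CARD('v) - 2 \<Longrightarrow> - W \<in> E"
proof -
  have "card (- W) = CARD('v) - card W" by (simp add: Compl_eq_Diff_UNIV card_Diff_subset)
  with noncover_compl[OF assms] show "card W \<le> CARD('v) - 2" "card W = CARD('v) - 2 \<Longrightarrow> - W \<in> E"
    by auto
qed

lemma card_maximal_noncovers:
  fixes E :: "'v::finite set set"
  assumes "simple_graph E"
  shows "card {W. \<not> vertex_cover E W \<and> card W = CARD('v) - 2} = card E"
proof -
  have "{W. \<not> vertex_cover E W \<and> card W = CARD('v) - 2} = uminus ` E"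
  proof (intro equalityI subsetI)
    fix W assume "W \<in> {W. \<not> vertex_cover E W \<and> card W = CARD('v) - 2}"
    then have "- W \<in> E" using card_noncover_le(2)[OF assms] by blast
    then show "W \<in> uminus ` E" by (metis double_complement image_eqI)
  next
    fix W assume "W \<in> uminus ` E"
    then obtain e where "e \<in> E" "W = - e" by blast
    then show "W \<in> {W. \<not> vertex_cover E W \<and> card W = CARD('v) - 2}"
      using assms by (auto simp: vertex_cover_def simple_graph_def Compl_eq_Diff_UNIV card_Diff_subset)
  qed
  then show ?thesis by (simp add: card_image inj_on_def)
qed

lemma cover_ideal_hilbert_coeffs:
  fixes E :: "'v::finite set set"
  assumes simple: "simple_graph E" and "E \<noteq> {}" and d: "CARD('v) - 2 = Suc k"
  shows "\<exists>e. hilbert_coeffs (cover_ideal E :: ('v, 'k::field) mpoly set) (Suc k) e \<and> e 0 = int (card E)"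
proof -
  let ?N = "{W. W \<noteq> {} \<and> \<not> vertex_cover E W}"
  \<comment> \<open>The support \<open>W\<close> contributes
    \<open>(t - 1) choose (card W - 1)\<close>, whose degree in \<open>t\<close> is below
    \<open>k\<close> unless \<open>- W\<close> is an edge.\<close>
  have "\<exists>b :: nat \<Rightarrow> int. b k = (if card W = Suc k then 1 else 0) \<and>
      (\<forall>t\<ge>Suc k. int ((t - 1) choose (card W - 1)) = (\<Sum>i\<le>k. b i * int ((t + i) choose i)))"
    if W: "W \<in> ?N" for W
  proof -
    obtain l where l: "card W = Suc l" using W by (metis (mono_tags, lifting) card_eq_0_iff finite mem_Collect_eq not0_implies_Suc)
    have lk: "l \<le> k" using card_noncover_le(1)[OF simple, of W] W d l by simp
    obtain b :: "nat \<Rightarrow> int" where b: "b l = 1" "\<And>t. t \<ge> Suc l \<Longrightarrow> int ((t + l - Suc l) choose l) = (\<Sum>i\<le>l. b i * int ((t + i) choose i))"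
      using binomial_basis_shift[of l "Suc l"] by blast
    have "int ((t - 1) choose l) = (\<Sum>i\<le>k. (if i \<le> l then b i else 0) * int ((t + i) choose i))" if t: "t \<ge> Suc k" for t
    proof -
      have "t + l - Suc l = t - 1" using t by simp
      then have "int ((t - 1) choose l) = (\<Sum>i\<le>l. b i * int ((t + i) choose i))" using b(2)[of t] t lk by simp
      also have "\<dots> = (\<Sum>i\<le>k. (if i \<le> l then b i else 0) * int ((t + i) choose i))"
        using lk by (intro sum.mono_neutral_cong_left) auto
      finally show ?thesis .
    qed
    then show ?thesis using b(1) lk l by (intro exI[of _ "\<lambda>i. if i \<le> l then b i else 0"]) auto
  qed
  then have "\<exists>b :: 'v set \<Rightarrow> nat \<Rightarrow> int. \<forall>W\<in>?N. b W k = (if card W = Suc k then 1 else 0) \<and>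
      (\<forall>t\<ge>Suc k. int ((t - 1) choose (card W - 1)) = (\<Sum>i\<le>k. b W i * int ((t + i) choose i)))"
    by (intro bchoice ballI)
  then obtain b :: "'v set \<Rightarrow> nat \<Rightarrow> int" where b: "\<And>W. W \<in> ?N \<Longrightarrow> b W k = (if card W = Suc k then 1 else 0)"
    "\<And>W t. W \<in> ?N \<Longrightarrow> t \<ge> Suc k \<Longrightarrow> int ((t - 1) choose (card W - 1)) = (\<Sum>i\<le>k. b W i * int ((t + i) choose i))"
    by blast
  \<comment> \<open>The sign cancels the one in \<open>hilbert_coeffs\<close>; the index is reversed
    because \<open>e 0\<close> belongs to the top binomial.\<close>
  define e where "e j = (-1) ^ j * (\<Sum>W\<in>?N. b W (k - j))" for j
  have "e 0 = (\<Sum>W\<in>?N. if card W = Suc k then 1 else 0)" by (simp add: e_def b(1))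
  also have "\<dots> = int (card {W \<in> ?N. card W = Suc k})" by (simp add: sum.If_cases Int_def)
  also have "{W \<in> ?N. card W = Suc k} = {W. \<not> vertex_cover E W \<and> card W = CARD('v) - 2}" using d by auto
  finally have e0: "e 0 = int (card E)" by (simp add: card_maximal_noncovers[OF simple])
  have nc: "\<not> vertex_cover E {}" using assms(2) by (auto simp: vertex_cover_def)
  have "int (hilbert_function (cover_ideal E :: ('v, 'k) mpoly set) t) =
      (\<Sum>i = 0..Suc k - 1. (- 1) ^ (Suc k - 1 - i) * e (Suc k - 1 - i) * int ((t + i) choose i))" if t: "t \<ge> Suc k" for t
  proof -
    obtain u where u: "t = Suc u" using t by (cases t) auto
    have "int (hilbert_function (cover_ideal E :: ('v, 'k) mpoly set) t) = (\<Sum>W\<in>?N. int ((t - 1) choose (card W - 1)))"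
      unfolding cover_ideal_eq hilbert_function_supp_ideal[OF vertex_cover_mono nc] u card_standard_monomials by simp
    also have "\<dots> = (\<Sum>W\<in>?N. \<Sum>i\<le>k. b W i * int ((t + i) choose i))"
      using b(2) t by (intro sum.cong) auto
    also have "\<dots> = (\<Sum>i\<le>k. (\<Sum>W\<in>?N. b W i) * int ((t + i) choose i))"
      unfolding sum_distrib_right by (rule sum.swap)
    also have "\<dots> = (\<Sum>i\<le>k. (- 1) ^ (k - i) * e (k - i) * int ((t + i) choose i))"
      by (rule sum.cong) (auto simp: e_def mult.assoc[symmetric] power_add[symmetric])
    finally show ?thesis by (simp add: atMost_atLeast0)
  qed
  then have "hilbert_coeffs (cover_ideal E :: ('v, 'k) mpoly set) (Suc k) e"
    unfolding hilbert_coeffs_def eventually_sequentially by blast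
  then show ?thesis using e0 by blast
qed

lemma hilbert_coeffs_leading_unique:
  assumes "hilbert_coeffs I (Suc k) e" "hilbert_coeffs I (Suc k) e'"
  shows "e 0 = e' 0"
proof -
  obtain N N' where N: "\<And>t. t \<ge> N \<Longrightarrow> int (hilbert_function I t) = (\<Sum>i=0..k. (-1) ^ (k - i) * e (k - i) * int ((t + i) choose i))"
    and N': "\<And>t. t \<ge> N' \<Longrightarrow> int (hilbert_function I t) = (\<Sum>i=0..k. (-1) ^ (k - i) * e' (k - i) * int ((t + i) choose i))"
    using assms unfolding hilbert_coeffs_def eventually_sequentially by auto
  have "\<forall>t\<ge>max N N'. (\<Sum>i\<le>k. ((-1) ^ (k - i) * (e (k - i) - e' (k - i))) * int ((t + i) choose i)) = 0"
  proof (intro allI impI)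
    fix t assume "t \<ge> max N N'"
    then have "(\<Sum>i=0..k. (-1) ^ (k - i) * e (k - i) * int ((t + i) choose i)) = (\<Sum>i=0..k. (-1) ^ (k - i) * e' (k - i) * int ((t + i) choose i))"
      using N[of t] N'[of t] by simp
    then show "(\<Sum>i\<le>k. ((-1) ^ (k - i) * (e (k - i) - e' (k - i))) * int ((t + i) choose i)) = 0"
      by (simp add: atMost_atLeast0 algebra_simps sum_subtractf)
  qed
  from binomial_basis_leading_unique[OF this] show ?thesis by simp
qed

text \<open>This settles the multiplicity in dimension 0. The ideal is maximal, so the quotient is a
  field, and its two ideals form a chain with one step.\<close>

lemma ring_length_residue_field:
  "ring_length (polyring Quot (supp_ideal (\<lambda>A. A \<noteq> {}) :: ('v::finite, 'k::field) mpoly set)) = 1"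
proof -
  let ?I = "supp_ideal (\<lambda>A. A \<noteq> {}) :: ('v, 'k) mpoly set"
  let ?Q = "polyring Quot ?I"
  have I: "ideal ?I polyring" by (rule ideal_supp_ideal) (auto simp: mono_def)
  have "maximalideal ?I polyring"
  proof (rule maximalidealI[OF I])
    have "1 \<notin> ?I" by (simp add: supp_ideal_def)
    then show "carrier polyring \<noteq> ?I" by auto
    fix J assume J: "ideal J (polyring :: ('v, 'k) mpoly ring)" "?I \<subseteq> J" "J \<subseteq> carrier polyring"
    have "J = carrier polyring" if ne: "J \<noteq> ?I"
    proof -
      obtain f where f: "f \<in> J" "f \<notin> ?I" using J(2) ne by blast
      have "lookup f 0 \<noteq> 0"
      proof
        assume "lookup f 0 = 0"
        then have "m \<noteq> 0" if "m \<in> keys f" for m using that by (auto simp: in_keys_iff)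
        then show False using f(2) by (auto simp: supp_ideal_def)
      qed
      have "f - Const (lookup f 0) \<in> ?I"
        unfolding supp_ideal_def Const_def by (auto simp: in_keys_iff lookup_minus lookup_single)
      then have "- (f - Const (lookup f 0)) \<in> J" using J(2) supp_ideal_uminus by blast
      then have "- (f - Const (lookup f 0)) + f \<in> J" using J(1) f(1) unfolding ideal_polyring_iff by blast
      then have "Const (1 / lookup f 0) * Const (lookup f 0) \<in> J" using J(1) by (simp add: ideal_polyring_iff)
      then have "1 \<in> J" using \<open>lookup f 0 \<noteq> 0\<close> by (simp add: Const_def mult_single)
      then have "g * 1 \<in> J" for g using J(1) unfolding ideal_polyring_iff by blast
      then show ?thesis by auto
    qed
    then show "J = ?I \<or> J = carrier polyring" by blast
  qed
  then interpret F: field ?Q by (rule maximalideal.quotient_is_field[OF _ cring_polyring])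
  have ideals: "ideal J ?Q \<longleftrightarrow> J = {\<zero>\<^bsub>?Q\<^esub>} \<or> J = carrier ?Q" for J
    using F.all_ideals by blast
  show ?thesis
    unfolding ring_length_def
  proof (rule antisym)
    show "Sup {enat k |k. \<exists>J. (\<forall>i\<le>k. ideal (J i) ?Q) \<and> (\<forall>i<k. J i \<subset> J (Suc i))} \<le> 1"
    proof (rule Sup_least, clarify)
      fix k J assume J: "\<forall>i\<le>k. ideal (J i) ?Q" "\<forall>i<k. J i \<subset> J (Suc i)"
      have "k \<le> 1"
      proof (rule ccontr)
        assume "\<not> k \<le> 1"
        then have "J 0 \<subset> J 1" "J 1 \<subset> J 2" "ideal (J 0) ?Q" "ideal (J 1) ?Q" "ideal (J 2) ?Q"
          using J by (auto simp: numeral_2_eq_2)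
        moreover from this have "J 0 \<noteq> J 1" "J 1 \<noteq> J 2" "J 0 \<noteq> J 2" by blast+
        ultimately show False unfolding ideals by metis
      qed
      then show "enat k \<le> 1" by (simp add: one_enat_def)
    qed
    have "{\<zero>\<^bsub>?Q\<^esub>} \<subset> carrier ?Q" using F.zero_closed F.one_closed F.one_not_zero by blast
    then have "\<exists>J. (\<forall>i\<le>1::nat. ideal (J i) ?Q) \<and> (\<forall>i<1. J i \<subset> J (Suc i))"
      by (intro exI[of _ "\<lambda>i. if i = 0 then {\<zero>\<^bsub>?Q\<^esub>} else carrier ?Q"]) (auto simp: ideals)
    then show "1 \<le> Sup {enat k |k. \<exists>J. (\<forall>i\<le>k. ideal (J i) ?Q) \<and> (\<forall>i<k. J i \<subset> J (Suc i))}"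
      by (intro Sup_upper) (auto simp: one_enat_def)
  qed
qed

lemma multiplicity_cover_ideal:
  fixes E :: "'v::{finite, linorder} set set"
  assumes simple: "simple_graph E" and "E \<noteq> {}"
  shows "module_multiplicity (cover_ideal E :: ('v, 'k::field) mpoly set) = int (card E)"
proof -
  let ?I = "cover_ideal E :: ('v, 'k) mpoly set"
  have dim: "the_enat (krull_dim (polyring Quot ?I)) = CARD('v) - 2"
    by (simp add: krull_dim_cover_ideal[OF assms])
  show ?thesis
  proof (cases "CARD('v) - 2")
    \<comment> \<open>There are only two vertices, so the single edge is the whole vertex set and
      the cover ideal is the irrelevant ideal.\<close>
    case 0
    obtain e where e: "e \<in> E" using assms(2) by blast
    have full: "e = UNIV" if "e \<in> E" for e
    proof (rule card_subset_eq)
      have "card e = 2" using that simple by (simp add: simple_graph_def)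
      moreover have "card e \<le> CARD('v)" by (rule card_mono) auto
      ultimately show "card e = CARD('v)" using 0 by simp
    qed auto
    then have E: "E = {UNIV}" using e by blast
    then have "vertex_cover E = (\<lambda>A. A \<noteq> {})" by (auto simp: vertex_cover_def)
    then have "ring_length (polyring Quot ?I) = 1" by (simp only: cover_ideal_eq ring_length_residue_field)
    then show ?thesis unfolding module_multiplicity_def dim 0 by (simp add: E one_enat_def)
  next
    case (Suc k)
    obtain e where e: "hilbert_coeffs ?I (Suc k) e" "e 0 = int (card E)"
      using cover_ideal_hilbert_coeffs[OF assms Suc] by blast
    have "(THE e\<^sub>0. \<exists>e. hilbert_coeffs ?I (Suc k) e \<and> e 0 = e\<^sub>0) = int (card E)"
    proof (rule the_equality)
      show "e\<^sub>0 = int (card E)" if "\<exists>e. hilbert_coeffs ?I (Suc k) e \<and> e 0 = e\<^sub>0" for e\<^sub>0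
        using that hilbert_coeffs_leading_unique[OF e(1)] e(2) by auto
    qed (use e in blast)
    then show ?thesis by (simp add: module_multiplicity_def dim Suc)
  qed
qed

theorem proposition3p10:
  fixes E :: "('n::{finite, linorder} + 'n) set set"
    and K :: "'k::field itself"
  assumes "simple_graph E"
    and "very_well_covered K E"
    and "cohen_macaulay_graph K E"
    and "standard_labelling E"
  shows "(\<Sum>i | i \<ge> 1 \<and> betti (cover_ideal E :: ('n + 'n, 'k) mpoly set) i \<noteq> 0.
            (-1) ^ i * int (betti (cover_ideal E :: ('n + 'n, 'k) mpoly set) i)) = -1
    \<and> module_multiplicity (cover_ideal E :: ('n + 'n, 'k) mpoly set) = int (card E)
    \<and> real (card E) = 1 / 2 * (\<Sum>C\<in>minimal_covers E. \<Sum>i=0..card (exchange_set E C).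
            (-1) ^ (i + 1) * real (card (exchange_set E C) choose i) * (real CARD('n) + real i) ^ 2)"
proof (intro conjI)
  interpret standard_graph E
    using assms by unfold_locales (auto simp: very_well_covered_def)
  have nonempty: "E \<noteq> {}" using matching_edge by blast
  \<comment> \<open>The empty set is no cover because there is an edge, and the whole vertex set is
    one because edges are nonempty.\<close>
  show "(\<Sum>i | i \<ge> 1 \<and> betti (cover_ideal E :: ('n + 'n, 'k) mpoly set) i \<noteq> 0.
            (-1) ^ i * int (betti (cover_ideal E :: ('n + 'n, 'k) mpoly set) i)) = -1"
    using betti_alternating_sum[of "vertex_cover E"] cover_ideal_resolution_exists vertex_cover_mono nonempty simple
    unfolding cover_ideal_eq by (fastforce simp: vertex_cover_def simple_graph_def)
  show "module_multiplicity (cover_ideal E :: ('n + 'n, 'k) mpoly set) = int (card E)"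
    by (rule multiplicity_cover_ideal[OF simple nonempty])
  show "real (card E) = 1 / 2 * (\<Sum>C\<in>minimal_covers E. \<Sum>i=0..card (exchange_set E C).
            (-1) ^ (i + 1) * real (card (exchange_set E C) choose i) * (real CARD('n) + real i) ^ 2)"
    by (rule card_edges)
qed

end
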